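(* Let $\Sigma\subset M$ be a $k$-dimensional submanifold, not necessarily minimal, and let $(P_1,c_1),(P_2,c_2)$ be two positive weights. Let $\Theta_1,\Theta_2$ be the corresponding densities of $\Sigma$. (1) Suppose that $(P_1,c_1)\ll(P_2,c_2)$ and that $\Theta_2$ is increasing. Then $\Theta_1$ is also increasing and $\Theta_1\le\Theta_2$. (2) On the other hand, if $(P_2,c_2)\ll(P_1,c_1)$ and $\Theta_2$ is increasing, then $\Theta_1\ge\Theta_2$.
   Context: Setting: $(M,g)$ is a Riemannian manifold with a $C^2$ function $h$ such that $\operatorname{Hess}h=U\,g$, where $U$ and $V=|\nabla h|^2$ are functions of $h$ with $U=\frac12V'$. A starting level $h_0$ is fixed. $\Sigma$ is contained in $\{h\ge h_0\}$ and $\gamma_0=\Sigma\cap\{h=h_0\}$ has zero $k$-volume (e.g. it is empty or a transversally cut out $(k-1)$-submanifold). $\omega_{k-1}$ is the volume of the unit $(k-1)$-sphere; $\tilde g=V(h)^{-1}g$. Parallel volume: $|\gamma_0^{T\Sigma}|=\int_{\gamma_0}\cos\angle(\nabla h,T\Sigma)\,d\mathrm{vol}^{k-1}_{\tilde g}$, with $\angle(\nabla h,T\Sigma)$ the angle between $\nabla h$ and the tangent space of $\Sigma$. A weight is a pair $(P,c)$ of a function $P:\mathbb{R}\to\mathbb{R}$ and a real number $c$; it is positive if $P\ge0$. The weighted volume is $$A_{(P,c)}(\Sigma)(t)=\int_{\Sigma,\,h_0\le h\le t}P(h)+\frac ck|\gamma_0^{T\Sigma}|V(h_0)^{k/2}$$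 (the last term being dropped if $h_0$ is a critical value of $h$). The tube volume is $$Q_{(P,c)}(t)=\omega_{k-1}\left[\int_{h_0}^tP(s)V(s)^{\frac k2-1}ds+\frac ckV(h_0)^{k/2}\right],$$ and the density is $\Theta_{(P,c)}(t)=A_{(P,c)}(\Sigma)(t)/Q_{(P,c)}(t)$. With $Q_i=Q_{(P_i,c_i)}$, $(P_1,c_1)$ is weaker than $(P_2,c_2)$, written $(P_1,c_1)\ll(P_2,c_2)$, if $\frac{P_1}{Q_1}\le\frac{P_2}{Q_2}$ for all $t$; equivalently $\frac{d}{dt}\frac{Q_1}{Q_2}\le0$. "Increasing" is in the weak sense.
   Formalization: Part (2) additionally assumes that P_1 vanishes at every level t > h_0 where P_2 does (it is false otherwise: a flat disc with P_2 cut off beyond its edge); both parts assume the tube volumes Q_1, Q_2 are positive for t > h_0. *)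

theory Defs
  imports "HOL-Analysis.Analysis"
begin

section \<open>Riemannian manifolds in local coordinates\<close>

text \<open>For an open set \<open>S\<close>: \<open>f\<close> is of class $C^r$ on \<open>S\<close>.\<close>

primrec Ck_on :: "nat \<Rightarrow> (real^'n \<Rightarrow> 'b::real_normed_vector) \<Rightarrow> (real^'n) set \<Rightarrow> bool" where
  "Ck_on 0 f S = continuous_on S f"
| "Ck_on (Suc r) f S =
     ((\<forall>x\<in>S. f differentiable (at x)) \<and>
      (\<forall>i. Ck_on r (\<lambda>x. frechet_derivative f (at x) (axis i 1)) S))"

definition smooth_on :: "(real^'n \<Rightarrow> 'b::real_normed_vector) \<Rightarrow> (real^'n) set \<Rightarrow> bool" where
  "smooth_on f S \<longleftrightarrow> (\<forall>r. Ck_on r f S)"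

definition partial :: "'n::finite \<Rightarrow> (real^'n \<Rightarrow> real) \<Rightarrow> real^'n \<Rightarrow> real" where
  "partial i f x = frechet_derivative f (at x) (axis i 1)"

text \<open>A chart is a pair of its domain and its coordinate map; only the values of the map on the
  domain matter.\<close>

type_synonym ('m, 'n) chart = "'m set \<times> ('m \<Rightarrow> real^'n)"

definition chart_inv :: "('m, 'n::finite) chart \<Rightarrow> real^'n \<Rightarrow> 'm" where
  "chart_inv c = inv_into (fst c) (snd c)"

definition chart_image :: "('m, 'n::finite) chart \<Rightarrow> (real^'n) set" where
  "chart_image c = snd c ` fst c"

definition smooth_atlas :: "'m::{t2_space,second_countable_topology} set \<Rightarrow> ('m, 'n::finite) chart set \<Rightarrow> bool"
where
  "smooth_atlas M A \<longleftrightarrow>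
     (\<Union>c\<in>A. fst c) = M \<and>
     (\<forall>c\<in>A. open (fst c) \<and> open (chart_image c) \<and>
        homeomorphism (fst c) (chart_image c) (snd c) (chart_inv c)) \<and>
     (\<forall>c\<in>A. \<forall>d\<in>A. smooth_on (snd d \<circ> chart_inv c) (snd c ` (fst c \<inter> fst d)))"

text \<open>A metric is given by its component matrices \<open>g c u\<close> in each chart \<open>c\<close>, as functions of the
  coordinates \<open>u\<close>, related by the transformation law of covariant 2-tensors.\<close>

type_synonym ('m, 'n) metric = "('m, 'n) chart \<Rightarrow> real^'n \<Rightarrow> real^'n^'n"

definition riemannian_metric :: "('m, 'n::finite) chart set \<Rightarrow> ('m, 'n::finite) metric \<Rightarrow> bool" where
  "riemannian_metric A g \<longleftrightarrow>
     (\<forall>c\<in>A. smooth_on (g c) (chart_image c)) \<and>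
     (\<forall>c\<in>A. \<forall>u\<in>chart_image c.
        transpose (g c u) = g c u \<and> (\<forall>v. v \<noteq> 0 \<longrightarrow> 0 < v \<bullet> (g c u *v v))) \<and>
     (\<forall>c\<in>A. \<forall>d\<in>A. \<forall>u\<in>snd c ` (fst c \<inter> fst d).
        let \<tau> = snd d \<circ> chart_inv c; J = matrix (frechet_derivative \<tau> (at u))
        in g c u = transpose J ** g d (\<tau> u) ** J)"

definition riemannian_manifold ::
  "'m::{t2_space,second_countable_topology} set \<Rightarrow> ('m, 'n::finite) chart set \<Rightarrow> ('m, 'n::finite) metric \<Rightarrow> bool" where
  "riemannian_manifold M A g \<longleftrightarrow> smooth_atlas M A \<and> riemannian_metric A g"

definition C2_function :: "('m, 'n::finite) chart set \<Rightarrow> ('m \<Rightarrow> real) \<Rightarrow> bool" where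
  "C2_function A h \<longleftrightarrow> (\<forall>c\<in>A. Ck_on 2 (h \<circ> chart_inv c) (chart_image c))"

definition coord_differential :: "('m \<Rightarrow> real) \<Rightarrow> ('m, 'n::finite) chart \<Rightarrow> real^'n \<Rightarrow> real^'n" where
  "coord_differential h c u = (\<chi> i. partial i (h \<circ> chart_inv c) u)"

definition gradient :: "('m, 'n::finite) metric \<Rightarrow> ('m \<Rightarrow> real) \<Rightarrow> ('m, 'n::finite) chart \<Rightarrow> real^'n \<Rightarrow> real^'n" where
  "gradient g h c u = matrix_inv (g c u) *v coord_differential h c u"

definition inner_wrt :: "real^'n^'n \<Rightarrow> real^'n \<Rightarrow> real^'n \<Rightarrow> real" where
  "inner_wrt B v w = v \<bullet> (B *v w)"

definition norm_wrt :: "real^'n^'n \<Rightarrow> real^'n \<Rightarrow> real" where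
  "norm_wrt B v = sqrt (inner_wrt B v v)"

definition christoffel :: "('m, 'n::finite) metric \<Rightarrow> ('m, 'n::finite) chart \<Rightarrow> real^'n \<Rightarrow> 'n \<Rightarrow> 'n \<Rightarrow> 'n \<Rightarrow> real" where
  "christoffel g c u l i j =
     (\<Sum>m\<in>UNIV. matrix_inv (g c u) $ l $ m *
        (partial i (\<lambda>x. g c x $ j $ m) u + partial j (\<lambda>x. g c x $ i $ m) u
          - partial m (\<lambda>x. g c x $ i $ j) u)) / 2"

definition hessian :: "('m, 'n::finite) metric \<Rightarrow> ('m \<Rightarrow> real) \<Rightarrow> ('m, 'n::finite) chart \<Rightarrow> real^'n \<Rightarrow> real^'n^'n" where
  "hessian g h c u =
     (\<chi> i j. partial i (partial j (h \<circ> chart_inv c)) u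
        - (\<Sum>l\<in>UNIV. christoffel g c u l i j * partial l (h \<circ> chart_inv c) u))"

definition critical_value :: "('m, 'n::finite) chart set \<Rightarrow> ('m \<Rightarrow> real) \<Rightarrow> real \<Rightarrow> bool" where
  "critical_value A h s \<longleftrightarrow>
     (\<exists>c\<in>A. \<exists>u\<in>chart_image c. h (chart_inv c u) = s \<and> coord_differential h c u = 0)"

text \<open>The levels on which \<open>U\<close> and \<open>V\<close> have to be defined: the starting level need not be attained
  (for instance \<open>h0 = 0\<close> for a function with range \<open>{0<..}\<close>).\<close>

definition levels :: "'m set \<Rightarrow> ('m \<Rightarrow> real) \<Rightarrow> real \<Rightarrow> real set" where
  "levels M h h0 = insert h0 (h ` M)"

text \<open>The conformal metric $V(h)^{-1} g$. At critical points of \<open>h\<close> it is not defined; the matrix is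
  0 there, and these points never enter below.\<close>

definition rescaled_metric :: "('m \<Rightarrow> real) \<Rightarrow> (real \<Rightarrow> real) \<Rightarrow> ('m, 'n::finite) metric \<Rightarrow> ('m, 'n::finite) metric" where
  "rescaled_metric h V g = (\<lambda>c u. (1 / V (h (chart_inv c u))) *\<^sub>R g c u)"


section \<open>Submanifolds with boundary and their volumes\<close>

text \<open>Local parametrizations of a subset \<open>S\<close> by relatively open subsets of the half-space
  \<open>{x. 0 \<le> x $ i}\<close>: homeomorphisms onto relatively open subsets of \<open>S\<close> which are $C^1$ immersions,
  where $C^1$ at points of the boundary hyperplane means having a local $C^1$ extension. The
  parametrizations with \<open>U\<close> disjoint from the hyperplane are the interior ones.\<close>

definition local_param ::
  "('m::topological_space, 'n::finite) chart set \<Rightarrow> 'm set \<Rightarrow> 'k::finite \<Rightarrow> (real^'k) set \<Rightarrow> (real^'k \<Rightarrow> 'm) \<Rightarrow> bool"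
where
  "local_param A S i U \<phi> \<longleftrightarrow>
     openin (top_of_set {x. 0 \<le> x $ i}) U \<and>
     openin (top_of_set S) (\<phi> ` U) \<and>
     homeomorphism U (\<phi> ` U) \<phi> (inv_into U \<phi>) \<and>
     (\<forall>c\<in>A. \<forall>x\<in>U. \<phi> x \<in> fst c \<longrightarrow>
        (\<exists>W F. open W \<and> x \<in> W \<and> \<phi> ` (U \<inter> W) \<subseteq> fst c \<and> Ck_on 1 F W \<and>
           (\<forall>y\<in>U \<inter> W. F y = snd c (\<phi> y)) \<and> inj (frechet_derivative F (at x))))"

definition submanifold ::
  "'k::finite itself \<Rightarrow> 'm::topological_space set \<Rightarrow> ('m, 'n::finite) chart set \<Rightarrow> 'm set \<Rightarrow> bool" where
  "submanifold k M A S \<longleftrightarrow> S \<subseteq> M \<and>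
     (\<forall>p\<in>S. \<exists>(i::'k) U \<phi>. local_param A S i U \<phi> \<and> p \<in> \<phi> ` U)"

definition manifold_boundary ::
  "'k::finite itself \<Rightarrow> ('m::topological_space, 'n::finite) chart set \<Rightarrow> 'm set \<Rightarrow> 'm set" where
  "manifold_boundary k A S = {p. \<exists>(i::'k) U \<phi> x. local_param A S i U \<phi> \<and> x \<in> U \<and> x $ i = 0 \<and> \<phi> x = p}"

text \<open>The differential of \<open>\<phi>\<close> in the chart \<open>c\<close>; the derivative within \<open>U\<close> is unique also at points of
  the boundary hyperplane.\<close>

definition param_deriv ::
  "('m, 'n::finite) chart \<Rightarrow> (real^'k::finite) set \<Rightarrow> (real^'k \<Rightarrow> 'm) \<Rightarrow> real^'k \<Rightarrow> real^'k \<Rightarrow> real^'n" where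
  "param_deriv c U \<phi> x = frechet_derivative (snd c \<circ> \<phi>) (at x within U)"

definition tangent_space ::
  "'k::finite itself \<Rightarrow> ('m::topological_space, 'n::finite) chart set \<Rightarrow> 'm set \<Rightarrow> ('m, 'n::finite) chart \<Rightarrow> 'm
     \<Rightarrow> (real^'n) set" where
  "tangent_space k A S c p =
     {param_deriv c U \<phi> x v | (i::'k) U \<phi> x v. local_param A S i U \<phi> \<and> x \<in> U \<and> \<phi> x = p}"

definition gram_matrix ::
  "('m, 'n::finite) metric \<Rightarrow> ('m, 'n::finite) chart \<Rightarrow> (real^'k::finite) set \<Rightarrow> (real^'k \<Rightarrow> 'm) \<Rightarrow> real^'k \<Rightarrow> real^'k^'k"
where
  "gram_matrix g c U \<phi> x =
     (\<chi> a b. inner_wrt (g c (snd c (\<phi> x)))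
        (param_deriv c U \<phi> x (axis a 1)) (param_deriv c U \<phi> x (axis b 1)))"

text \<open>\<open>\<mu>\<close> is the \<open>k\<close>-dimensional Riemannian volume on the Borel sets of \<open>S\<close>. The area formula in all
  local parametrizations determines \<open>\<mu>\<close> uniquely.\<close>

definition volume_measure ::
  "'k::finite itself \<Rightarrow> ('m::topological_space, 'n::finite) chart set \<Rightarrow> ('m, 'n::finite) metric \<Rightarrow> 'm set \<Rightarrow> 'm measure
     \<Rightarrow> bool" where
  "volume_measure k A g S \<mu> \<longleftrightarrow>
     space \<mu> = S \<and> sets \<mu> = sets (restrict_space borel S) \<and>
     (\<forall>(i::'k) U \<phi>. local_param A S i U \<phi> \<longrightarrow>
        (\<forall>c\<in>A. \<forall>E\<in>sets borel. E \<subseteq> U \<and> \<phi> ` E \<subseteq> fst c \<longrightarrow>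
           emeasure \<mu> (\<phi> ` E) = (\<integral>\<^sup>+x\<in>E. ennreal (sqrt (det (gram_matrix g c U \<phi> x))) \<partial>lborel)))"

text \<open>Lebesgue measure of dimension \<open>CARD('k) - 1\<close> on the hyperplane \<open>{x. x $ i = 0}\<close>, as a measure on
  \<open>real^'k\<close>. For \<open>CARD('k) = 1\<close> it is the unit point mass at 0, so that the 0-dimensional
  volume is counting measure.\<close>

definition hyperplane_measure :: "'k::finite \<Rightarrow> (real^'k) measure" where
  "hyperplane_measure i =
     distr (\<Pi>\<^sub>M j\<in>UNIV - {i}. lborel) borel (\<lambda>y. \<chi> j. if j = i then 0 else y j)"

text \<open>The determinant of this matrix is the principal minor of \<open>B\<close> with row and column \<open>i\<close> deleted.\<close>

definition drop_index :: "'k \<Rightarrow> real^'k::finite^'k \<Rightarrow> real^'k^'k" where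
  "drop_index i B = (\<chi> a b. if a = i \<or> b = i then (if a = b then 1 else 0) else B $ a $ b)"

text \<open>The same for the (\<open>k\<close>-1)-dimensional volume of the boundary of \<open>S\<close>.\<close>

definition boundary_volume_measure ::
  "'k::finite itself \<Rightarrow> ('m::topological_space, 'n::finite) chart set \<Rightarrow> ('m, 'n::finite) metric \<Rightarrow> 'm set \<Rightarrow> 'm measure
     \<Rightarrow> bool" where
  "boundary_volume_measure k A g S \<beta> \<longleftrightarrow>
     space \<beta> = manifold_boundary k A S \<and>
     sets \<beta> = sets (restrict_space borel (manifold_boundary k A S)) \<and>
     (\<forall>(i::'k) U \<phi>. local_param A S i U \<phi> \<longrightarrow>
        (\<forall>c\<in>A. \<forall>E\<in>sets borel. E \<subseteq> U \<inter> {x. x $ i = 0} \<and> \<phi> ` E \<subseteq> fst c \<longrightarrow>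
           emeasure \<beta> (\<phi> ` E) =
             (\<integral>\<^sup>+x\<in>E. ennreal (sqrt (det (drop_index i (gram_matrix g c U \<phi> x))))
                \<partial>hyperplane_measure i)))"


section \<open>Parallel volume, weights and densities\<close>

definition vector_angle :: "real^'n^'n \<Rightarrow> real^'n \<Rightarrow> real^'n \<Rightarrow> real" where
  "vector_angle B v w = arccos (inner_wrt B v w / (norm_wrt B v * norm_wrt B w))"

definition subspace_angle :: "real^'n^'n \<Rightarrow> real^'n \<Rightarrow> (real^'n) set \<Rightarrow> real" where
  "subspace_angle B v T = (INF w\<in>T - {0}. vector_angle B v w)"

definition chart_at :: "('m, 'n::finite) chart set \<Rightarrow> 'm \<Rightarrow> ('m, 'n::finite) chart" where
  "chart_at A p = (SOME c. c \<in> A \<and> p \<in> fst c)"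

text \<open>Cosine of the angle between the gradient of \<open>h\<close> and the tangent space of \<open>S\<close> at \<open>p\<close>, computed in
  some chart at \<open>p\<close> (the angle does not depend on the chart).\<close>

definition cos_gradient_angle ::
  "'k::finite itself \<Rightarrow> ('m::topological_space, 'n::finite) chart set \<Rightarrow> ('m, 'n::finite) metric \<Rightarrow> ('m \<Rightarrow> real) \<Rightarrow> 'm set
     \<Rightarrow> 'm \<Rightarrow> real" where
  "cos_gradient_angle k A g h S p =
     (let c = chart_at A p; u = snd c p
      in cos (subspace_angle (g c u) (gradient g h c u) (tangent_space k A S c p)))"

text \<open>The set $\gamma_0$.\<close>

definition initial_slice :: "('m \<Rightarrow> real) \<Rightarrow> real \<Rightarrow> 'm set \<Rightarrow> 'm set" where
  "initial_slice h h0 S = {p\<in>S. h p = h0}"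

text \<open>Since \<open>S\<close> lies in \<open>{h0 \<le> h}\<close>, the restriction of \<open>h\<close> to \<open>S\<close> is minimal on $\gamma_0$. At interior
  points of \<open>S\<close> on $\gamma_0$ the gradient is therefore orthogonal to \<open>S\<close> and the integrand vanishes,
  so only the part of $\gamma_0$ on the boundary of \<open>S\<close> counts. Accordingly \<open>\<beta>\<close> is the volume
  of that boundary for the rescaled metric.\<close>

definition parallel_volume ::
  "'k::finite itself \<Rightarrow> ('m::topological_space, 'n::finite) chart set \<Rightarrow> ('m, 'n::finite) metric \<Rightarrow> ('m \<Rightarrow> real) \<Rightarrow> real
     \<Rightarrow> 'm set \<Rightarrow> 'm measure \<Rightarrow> real" where
  "parallel_volume k A g h h0 S \<beta> =
     (LINT p:initial_slice h h0 S|\<beta>. cos_gradient_angle k A g h S p)"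

type_synonym weight = "(real \<Rightarrow> real) \<times> real"

definition positive_weight :: "weight \<Rightarrow> bool" where
  "positive_weight w \<longleftrightarrow> (\<forall>s. 0 \<le> fst w s)"

definition weighted_volume ::
  "'k::finite itself \<Rightarrow> ('m::topological_space, 'n::finite) chart set \<Rightarrow> ('m, 'n::finite) metric \<Rightarrow> ('m \<Rightarrow> real)
     \<Rightarrow> (real \<Rightarrow> real) \<Rightarrow> real \<Rightarrow> 'm set \<Rightarrow> 'm measure \<Rightarrow> 'm measure \<Rightarrow> weight \<Rightarrow> real \<Rightarrow> real" where
  "weighted_volume k A g h V h0 S \<mu> \<beta> w t =
     (LINT p:{p\<in>S. h0 \<le> h p \<and> h p \<le> t}|\<mu>. fst w (h p)) +
     (if critical_value A h h0 then 0
      else snd w / real CARD('k) * parallel_volume k A g h h0 S \<beta> * V h0 powr (real CARD('k) / 2))"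

text \<open>The volume of the unit sphere in \<open>d\<close>-dimensional Euclidean space is \<open>d\<close> times that of the unit
  ball.\<close>

definition unit_sphere_volume :: "nat \<Rightarrow> real" where
  "unit_sphere_volume d = real d * unit_ball_vol (real d)"

definition tube_volume ::
  "'k::finite itself \<Rightarrow> (real \<Rightarrow> real) \<Rightarrow> real \<Rightarrow> weight \<Rightarrow> real \<Rightarrow> real" where
  "tube_volume k V h0 w t =
     unit_sphere_volume CARD('k) *
       ((LINT s:{h0..t}|lborel. fst w s * V s powr (real CARD('k) / 2 - 1))
        + snd w / real CARD('k) * V h0 powr (real CARD('k) / 2))"

definition weighted_density ::
  "'k::finite itself \<Rightarrow> ('m::topological_space, 'n::finite) chart set \<Rightarrow> ('m, 'n::finite) metric \<Rightarrow> ('m \<Rightarrow> real)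
     \<Rightarrow> (real \<Rightarrow> real) \<Rightarrow> real \<Rightarrow> 'm set \<Rightarrow> 'm measure \<Rightarrow> 'm measure \<Rightarrow> weight \<Rightarrow> real \<Rightarrow> real" where
  "weighted_density k A g h V h0 S \<mu> \<beta> w t =
     weighted_volume k A g h V h0 S \<mu> \<beta> w t / tube_volume k V h0 w t"

text \<open>The set of \<open>t\<close> for which the quotient defining the density makes sense. The level \<open>h0\<close> itself
  belongs to it iff the constant term of the tube volume is nonzero.\<close>

definition density_domain ::
  "'k::finite itself \<Rightarrow> 'm set \<Rightarrow> ('m \<Rightarrow> real) \<Rightarrow> (real \<Rightarrow> real) \<Rightarrow> real \<Rightarrow> weight \<Rightarrow> real set" where
  "density_domain k M h V h0 w = {t \<in> levels M h h0. h0 \<le> t \<and> tube_volume k V h0 w t \<noteq> 0}"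

text \<open>The integrals in the weighted volume and in the tube volume exist as real numbers, and tubes
  have positive volume.\<close>

definition density_defined ::
  "'k::finite itself \<Rightarrow> 'm set \<Rightarrow> ('m \<Rightarrow> real) \<Rightarrow> (real \<Rightarrow> real) \<Rightarrow> real \<Rightarrow> 'm set \<Rightarrow> 'm measure \<Rightarrow> weight
     \<Rightarrow> bool" where
  "density_defined k M h V h0 S \<mu> w \<longleftrightarrow>
     fst w \<in> borel_measurable borel \<and>
     (\<forall>t\<in>levels M h h0. h0 \<le> t \<longrightarrow>
        set_integrable \<mu> {p\<in>S. h0 \<le> h p \<and> h p \<le> t} (\<lambda>p. fst w (h p)) \<and>
        set_integrable lborel {h0..t} (\<lambda>s. fst w s * V s powr (real CARD('k) / 2 - 1))) \<and>
     (\<forall>t\<in>levels M h h0. h0 < t \<longrightarrow> 0 < tube_volume k V h0 w t)"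

definition weaker ::
  "'k::finite itself \<Rightarrow> 'm set \<Rightarrow> ('m \<Rightarrow> real) \<Rightarrow> (real \<Rightarrow> real) \<Rightarrow> real \<Rightarrow> weight \<Rightarrow> weight \<Rightarrow> bool" where
  "weaker k M h V h0 w1 w2 \<longleftrightarrow>
     (\<forall>t\<in>density_domain k M h V h0 w1 \<inter> density_domain k M h V h0 w2.
        fst w1 t / tube_volume k V h0 w1 t \<le> fst w2 t / tube_volume k V h0 w2 t)"

end

theory Submission
  imports Defs "HOL-Probability.Distribution_Functions"
begin

text \<open>Up to the factor \<open>\<omega>\<close> of the tube volumes, the densities are quotients \<open>a / q\<close> with
  \<open>da = P d\<nu>\<close> and \<open>dq = P W ds\<close>, where \<open>\<nu>\<close> is the image of the volume of \<open>S\<close> under \<open>h\<close>. Since \<open>\<theta>2\<close> is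
  increasing, \<open>d\<nu> - \<theta>2 W ds\<close> is nonnegative where \<open>P2 > 0\<close>, and
  $d(\theta_2 q_1 - a_1) = (q_1 P_2 / q_2 - P_1) (d\nu - \theta_2 W ds)$ has the sign given by the
  comparison of the weights; the claims follow by integrating from \<open>h0\<close>. The initial value has the right sign
  for trivial reasons except in part (1) when \<open>c1 > 0 = c2\<close>. Then one needs that near \<open>h0\<close> the
  volume of \<open>S\<close> is at least the one predicted by the parallel volume. This is seen on the
  coordinate lines that enter \<open>S\<close> from its boundary: \<open>h\<close> is minimal on $\gamma_0$, so its tangential
  derivatives along the boundary vanish there, and Cauchy-Schwarz bounds the speed at which such
  a line crosses the levels of \<open>h\<close>.\<close>

section \<open>Monotonicity on the real line\<close>

text \<open>\<open>\<theta>2\<close> is merely monotone and may jump, so the differential identity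
  has no pointwise meaning. It is replaced by increments over short intervals with the quotient
  \<open>q1 / q2\<close> frozen at one end. The error is an increment of a continuous function times
  an increment of \<open>\<theta>2\<close>, and such errors add up to something arbitrarily small.
  All increments are taken to the right of \<open>h0\<close>; the limit at \<open>h0\<close> comes
  afterwards.

  Where \<open>P2\<close> vanishes, the growth of \<open>\<theta>2\<close> says nothing about the
  volume of \<open>S\<close>. In part (1) \<open>P1\<close> vanishes there as well, because
  \<open>P1 / q1\<close> is at most \<open>P2 / q2\<close>. In part (2) the comparison points the
  other way, so the theorem asks for this vanishing separately.

  Both densities start from the same value, the parallel volume over the sphere volume, once their
  constant terms are nonzero. In part (2) a positive constant term of the first tube volume forces
  one of the second, so the delicate case of part (1) cannot occur.\<close>

lemma emeasure_mono_borel_realI: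
  fixes M N :: "real measure"
  assumes "finite_measure M" "finite_measure N"
    and M: "sets M = sets borel" and N: "sets N = sets borel"
    and le: "\<And>a b. a \<le> b \<Longrightarrow> measure N {a<..b} \<le> measure M {a<..b}"
    and X: "X \<in> sets borel"
  shows "emeasure N X \<le> emeasure M X"
proof -
  interpret M: finite_borel_measure M
    using assms by (simp add: finite_borel_measure_def finite_borel_measure_axioms_def)
  interpret N: finite_borel_measure N
    using assms by (simp add: finite_borel_measure_def finite_borel_measure_axioms_def)
  \<comment> \<open>The inequality is turned into an identity: \<open>G\<close>, the difference of
    the distribution functions, is monotone and right-continuous and so generates a measure
    \<open>H\<close> with \<open>M = N + H\<close> on half-open intervals. Unlike an inequality,
    this passes to complements and disjoint unions.\<close>
  define G where "G x = cdf M x - cdf N x" for x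
  have G_diff: "G b - G a = measure M {a<..b} - measure N {a<..b}" if "a \<le> b" for a b
    using that M.cdf_diff_eq[of a b] N.cdf_diff_eq[of a b]
    by (cases "a = b") (auto simp: G_def)
  have G_mono: "G a \<le> G b" if "a \<le> b" for a b
    using G_diff[OF that] le[OF that] by simp
  have G_cont: "continuous (at_right a) G" for a
    unfolding G_def using M.cdf_is_right_cont N.cdf_is_right_cont by (intro continuous_intros) auto
  define H where "H = interval_measure G"
  have H_Ioc: "emeasure H {a<..b} = ennreal (G b - G a)" if "a \<le> b" for a b
    unfolding H_def by (rule emeasure_interval_measure_Ioc[OF that G_mono G_cont])
  have sH: "sets H = sets borel" by (simp add: H_def)
  have Ioc: "emeasure M {a<..b} = emeasure N {a<..b} + emeasure H {a<..b}" for a b :: real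
  proof (cases "a \<le> b")
    case True
    then show ?thesis
      using H_Ioc[OF True] G_diff[OF True] le[OF True]
      by (simp add: M.emeasure_eq_measure N.emeasure_eq_measure flip: ennreal_plus)
  qed auto
  have lim: "(\<lambda>n. emeasure K {-real n<..real n}) \<longlonglongrightarrow> emeasure K UNIV"
    if "sets K = sets borel" for K :: "real measure"
  proof -
    have "(\<Union>n. {-real n<..real n}) = UNIV"
    proof (intro equalityI subsetI UNIV_I)
      fix x :: real
      obtain n where "\<bar>x\<bar> < real n" using reals_Archimedean2 by blast
      then show "x \<in> (\<Union>n. {-real n<..real n})" by (intro UN_I[of n]) auto
    qed
    moreover have "(\<lambda>n. emeasure K {-real n<..real n}) \<longlonglongrightarrow> emeasure K (\<Union>n. {-real n<..real n})"
      by (rule Lim_emeasure_incseq) (auto simp: that incseq_def)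
    ultimately show ?thesis by simp
  qed
  have "(\<lambda>n. emeasure M {-real n<..real n}) \<longlonglongrightarrow> emeasure N UNIV + emeasure H UNIV"
    unfolding Ioc by (intro tendsto_add lim N sH)
  then have UNIV: "emeasure M UNIV = emeasure N UNIV + emeasure H UNIV"
    using lim[OF M] LIMSEQ_unique by blast
  \<comment> \<open>Complements in the induction below are treated by subtraction, which needs
    finite masses.\<close>
  have "finite_measure H"
    using UNIV M.finite_emeasure_space M
    by (intro finite_measureI) (auto simp: H_def top_unique M.emeasure_eq_measure)
  then interpret H: finite_measure H .
  have "Int_stable (range (\<lambda>(a, b). {a<..b::real}))"
    by (auto simp: Int_stable_def image_iff)
  moreover have "range (\<lambda>(a, b). {a<..b::real}) \<subseteq> Pow UNIV" by simp
  moreover have "X \<in> sigma_sets UNIV (range (\<lambda>(a, b). {a<..b::real}))"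
    using X by (simp add: borel_sigma_sets_Ioc)
  ultimately have "emeasure M X = emeasure N X + emeasure H X"
  proof (induction rule: sigma_sets_induct_disjoint)
    case (basic A)
    then show ?case using Ioc by auto
  next
    case empty
    show ?case by simp
  next
    case (compl A)
    have A: "A \<in> sets borel" using compl(1) by (simp add: borel_sigma_sets_Ioc)
    have "measure M A = measure N A + measure H A"
      using compl(2)
      by (simp add: M.emeasure_eq_measure N.emeasure_eq_measure H.emeasure_eq_measure flip: ennreal_plus)
    moreover have "measure M UNIV = measure N UNIV + measure H UNIV"
      using UNIV
      by (simp add: M.emeasure_eq_measure N.emeasure_eq_measure H.emeasure_eq_measure flip: ennreal_plus)
    ultimately have "measure M (UNIV - A) = measure N (UNIV - A) + measure H (UNIV - A)"
      using A M.finite_measure_compl[of A] N.finite_measure_compl[of A] H.finite_measure_compl[of A]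
      by (simp add: M N sH sets_eq_imp_space_eq[OF M] sets_eq_imp_space_eq[OF N]
            sets_eq_imp_space_eq[OF sH])
    then show ?case
      by (simp add: M.emeasure_eq_measure N.emeasure_eq_measure H.emeasure_eq_measure flip: ennreal_plus)
  next
    case (union A)
    have A: "range A \<subseteq> sets borel" using union(2) by (simp add: borel_sigma_sets_Ioc)
    have "emeasure K (\<Union>i. A i) = (\<Sum>i. emeasure K (A i))" if "sets K = sets borel" for K
      using suminf_emeasure[of A K] A union(1) that by simp
    then show ?case using union(3) by (simp add: M N sH suminf_add)
  qed
  then show ?thesis by simp
qed

lemma mono_on_if_locally_mono:
  fixes f :: "real \<Rightarrow> real"
  assumes "0 < d" "a \<le> b"
    and loc: "\<And>x y. a \<le> x \<Longrightarrow> x \<le> y \<Longrightarrow> y \<le> b \<Longrightarrow> y - x \<le> d \<Longrightarrow> f x \<le> f y"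
  shows "f a \<le> f b"
proof -
  have "\<forall>y\<in>{a..b}. y - a \<le> real n * d \<longrightarrow> f a \<le> f y" for n
  proof (induction n)
    case 0
    then show ?case by (auto intro: loc)
  next
    case (Suc n)
    show ?case
    proof (intro ballI impI)
      fix y assume y: "y \<in> {a..b}" "y - a \<le> real (Suc n) * d"
      define x where "x = max a (y - d)"
      have "x \<in> {a..b}" "x - a \<le> real n * d"
        using y assms(1) by (auto simp: x_def algebra_simps max_def)
      then have "f a \<le> f x" using Suc by blast
      also have "f x \<le> f y" using y assms(1) by (intro loc) (auto simp: x_def)
      finally show "f a \<le> f y" .
    qed
  qed
  moreover obtain n where "b - a \<le> real n * d"
    using ex_less_of_nat_mult[OF assms(1), of "b - a"] less_imp_le by blast
  ultimately show ?thesis using assms(2) by auto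
qed

text \<open>On a fine partition the increments of \<open>r\<close> are uniformly small, while those
  of \<open>\<theta>\<close> telescope to \<open>\<theta> b - \<theta> a\<close>; the accumulated
  error is arbitrarily small. Adding a small multiple of \<open>\<theta>\<close> to \<open>F\<close>
  absorbs it in each step, and no continuity of \<open>F\<close> or \<open>\<theta>\<close> is
  involved.\<close>

lemma mono_on_if_second_order:
  fixes F r \<theta> :: "real \<Rightarrow> real"
  assumes "a \<le> b" "0 \<le> K" and cont: "continuous_on {a..b} r"
    and \<theta>: "\<And>x y. a \<le> x \<Longrightarrow> x \<le> y \<Longrightarrow> y \<le> b \<Longrightarrow> \<theta> x \<le> \<theta> y"
    and F: "\<And>x y. a \<le> x \<Longrightarrow> x \<le> y \<Longrightarrow> y \<le> b \<Longrightarrow>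
              F x - K * \<bar>r y - r x\<bar> * (\<theta> y - \<theta> x) \<le> F y"
  shows "F a \<le> F b"
proof (rule field_le_epsilon)
  fix e :: real assume "0 < e"
  \<comment> \<open>Chosen so that the total error \<open>e' * K * (\<theta> b - \<theta> a)\<close>
    is at most \<open>e\<close>; the \<open>1\<close> keeps the denominator positive when
    \<open>\<theta>\<close> is constant.\<close>
  define e' where "e' = e / (K * (\<theta> b - \<theta> a) + 1)"
  have pos: "0 \<le> K * (\<theta> b - \<theta> a)" using assms(1,2) \<theta>[of a b] by simp
  have "0 < e'" using \<open>0 < e\<close> pos by (simp add: e'_def)
  moreover have "uniformly_continuous_on {a..b} r"
    by (rule compact_uniformly_continuous[OF cont]) simp
  ultimately obtain d where d: "0 < d"
    "\<And>x y. x \<in> {a..b} \<Longrightarrow> y \<in> {a..b} \<Longrightarrow> dist y x < d \<Longrightarrow> dist (r y) (r x) < e'"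
    unfolding uniformly_continuous_on_def by metis
  have "F a + e' * K * \<theta> a \<le> F b + e' * K * \<theta> b"
  proof (rule mono_on_if_locally_mono[where d="d/2" and f="\<lambda>x. F x + e' * K * \<theta> x"])
    fix x y assume xy: "a \<le> x" "x \<le> y" "y \<le> b" "y - x \<le> d/2"
    then have "\<bar>r y - r x\<bar> < e'" using d(1) d(2)[of x y] by (auto simp: dist_real_def)
    then have "K * \<bar>r y - r x\<bar> * (\<theta> y - \<theta> x) \<le> K * e' * (\<theta> y - \<theta> x)"
      using \<theta>[of x y] xy assms(2) by (intro mult_right_mono mult_left_mono) auto
    with F[of x y] xy show "F x + e' * K * \<theta> x \<le> F y + e' * K * \<theta> y"
      by (simp add: algebra_simps)
  qed (use d assms in auto)
  then have "F a \<le> F b + e' * (K * (\<theta> b - \<theta> a))" by (simp add: algebra_simps)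
  also have "e' * (K * (\<theta> b - \<theta> a)) \<le> e"
    using pos \<open>0 < e\<close> by (simp add: e'_def divide_simps mult_left_mono)
  finally show "F a \<le> F b + e" by simp
qed

section \<open>Integrals over half-open intervals\<close>

lemma emeasure_density_indicator_real:
  fixes P :: "'a \<Rightarrow> real"
  assumes "set_integrable M I P" "P \<in> borel_measurable M" "\<And>s. 0 \<le> P s"
    and "I \<in> sets M" "X \<in> sets M"
  shows "emeasure (density M (\<lambda>s. ennreal (P s * indicator I s))) X = ennreal (LINT s:I \<inter> X|M. P s)"
proof -
  have "set_integrable M (I \<inter> X) P"
    by (rule set_integrable_subset[OF assms(1)]) (use assms in auto)
  then have int: "integrable M (\<lambda>s. indicator (I \<inter> X) s *\<^sub>R P s)"
    by (simp add: set_integrable_def)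
  have "emeasure (density M (\<lambda>s. ennreal (P s * indicator I s))) X
      = (\<integral>\<^sup>+s. ennreal (indicator (I \<inter> X) s *\<^sub>R P s) \<partial>M)"
    using assms by (subst emeasure_density) (auto intro!: nn_integral_cong simp: indicator_def)
  also have "\<dots> = ennreal (LINT s:I \<inter> X|M. P s)"
    unfolding set_lebesgue_integral_def
    by (rule nn_integral_eq_integral[OF int]) (auto simp: assms)
  finally show ?thesis .
qed

lemma set_integral_nonneg:
  fixes f :: "'a \<Rightarrow> real"
  assumes "\<And>x. x \<in> A \<Longrightarrow> 0 \<le> f x"
  shows "0 \<le> (LINT x:A|M. f x)"
  unfolding set_lebesgue_integral_def
  by (rule Bochner_Integration.integral_nonneg) (auto simp: indicator_def assms)

lemma set_integral_Ioc_diff: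
  fixes f :: "real \<Rightarrow> real"
  assumes "set_integrable M {a<..c} f" "a \<le> b" "b \<le> c" "sets M = sets borel"
  shows "(LINT s:{a<..c}|M. f s) - (LINT s:{a<..b}|M. f s) = (LINT s:{b<..c}|M. f s)"
proof -
  have "set_integrable M {a<..b} f" "set_integrable M {b<..c} f"
    using assms by (auto intro: set_integrable_subset[OF assms(1)])
  then have "(LINT s:{a<..b} \<union> {b<..c}|M. f s) = (LINT s:{a<..b}|M. f s) + (LINT s:{b<..c}|M. f s)"
    by (intro set_integral_Un) auto
  moreover have "{a<..b} \<union> {b<..c} = {a<..c}" using assms by auto
  ultimately show ?thesis by simp
qed

text \<open>The intervals omit \<open>a\<close>, so they shrink to the empty set and the limit is 0
  even if \<open>M\<close> has an atom at \<open>a\<close>; dominated convergence applies along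
  sequences.\<close>

lemma tendsto_set_integral_Ioc_at_right:
  fixes f :: "real \<Rightarrow> real"
  assumes "set_integrable M {a<..b} f" "a < b" "sets M = sets borel"
  shows "((\<lambda>t. LINT s:{a<..t}|M. f s) \<longlongrightarrow> 0) (at_right a)"
proof (rule tendsto_at_right_sequentially[OF assms(2)])
  fix S :: "nat \<Rightarrow> real"
  assume S: "\<And>n. a < S n" "\<And>n. S n < b" "S \<longlonglongrightarrow> a"
  have "(\<lambda>n. LINT s|M. indicator {a<..S n} s *\<^sub>R f s) \<longlonglongrightarrow> (LINT s|M. 0)"
  proof (rule integral_dominated_convergence[where w="\<lambda>s. norm (indicator {a<..b} s *\<^sub>R f s)"])
    show "(\<lambda>s. indicator {a<..S n} s *\<^sub>R f s) \<in> borel_measurable M" for n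
    proof -
      have "set_integrable M {a<..S n} f"
        using assms S(2)[of n] by (auto intro: set_integrable_subset[OF assms(1)])
      then show ?thesis by (simp add: set_integrable_def)
    qed
    show "AE s in M. (\<lambda>n. indicator {a<..S n} s *\<^sub>R f s) \<longlonglongrightarrow> 0"
    proof (rule AE_I2)
      fix s :: real
      have "\<forall>\<^sub>F n in sequentially. indicator {a<..S n} s *\<^sub>R f s = 0"
      proof (cases "a < s")
        case True
        then show ?thesis
          using order_tendstoD(2)[OF S(3) True] by (auto elim!: eventually_mono)
      qed simp
      then show "(\<lambda>n. indicator {a<..S n} s *\<^sub>R f s) \<longlonglongrightarrow> 0"
        by (rule tendsto_eventually)
    qed
    show "AE s in M. norm (indicator {a<..S n} s *\<^sub>R f s) \<le> norm (indicator {a<..b} s *\<^sub>R f s)" for n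
      using S(2)[of n] by (auto simp: indicator_def)
  qed (use assms in \<open>auto simp: set_integrable_def intro!: integrable_norm\<close>)
  then show "(\<lambda>n. LINT s:{a<..S n}|M. f s) \<longlonglongrightarrow> 0" by (simp add: set_lebesgue_integral_def)
qed

lemma continuous_on_set_integral_Ioc:
  fixes f :: "real \<Rightarrow> real"
  assumes "set_integrable lborel {a<..b} f"
  shows "continuous_on {a..b} (\<lambda>t. LINT s:{a<..t}|lborel. f s)"
proof -
  have spike: "integral {a<..t} f = integral {a..t} f" for t
    by (rule integral_spike_set) (auto intro: negligible_subset[OF negligible_sing[of a]])
  have "f integrable_on {a<..b}"
    by (rule set_borel_integral_eq_integral(1)[OF assms])
  then have "f integrable_on {a..b}"
    by (rule integrable_spike_set) (auto intro: negligible_subset[OF negligible_sing[of a]])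
  then have "continuous_on {a..b} (\<lambda>t. integral {a..t} f)"
    by (rule indefinite_integral_continuous_1)
  then show ?thesis
  proof (rule continuous_on_eq)
    fix t assume "t \<in> {a..b}"
    then have "set_integrable lborel {a<..t} f"
      by (intro set_integrable_subset[OF assms]) auto
    then show "integral {a..t} f = (LINT s:{a<..t}|lborel. f s)"
      by (simp add: set_borel_integral_eq_integral(2) spike)
  qed
qed

section \<open>Two weights and a measure on the line\<close>

locale weight_pair =
  fixes \<nu> :: "real measure" and W P1 P2 :: "real \<Rightarrow> real" and C1 C2 B h0 T :: real
  assumes sets_\<nu>: "sets \<nu> = sets borel"
    and W_meas [measurable]: "W \<in> borel_measurable borel"
    and P1_meas [measurable]: "P1 \<in> borel_measurable borel"
    and P2_meas [measurable]: "P2 \<in> borel_measurable borel"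
    and W_nonneg: "0 \<le> W s" and P1_nonneg: "0 \<le> P1 s" and P2_nonneg: "0 \<le> P2 s"
    and int_\<nu>1: "set_integrable \<nu> {h0<..T} P1"
    and int_\<nu>2: "set_integrable \<nu> {h0<..T} P2"
    and int_W1: "set_integrable lborel {h0<..T} (\<lambda>s. P1 s * W s)"
    and int_W2: "set_integrable lborel {h0<..T} (\<lambda>s. P2 s * W s)"
    and h0_less: "h0 < T"
begin

text \<open>\<open>B\<close> stands for the parallel volume, shared by both weights, and
  \<open>C1\<close>, \<open>C2\<close> for the constant terms of the tube volumes without the sphere
  factor. The half-open intervals make the integrals vanish in the limit at \<open>h0\<close>, so
  only these constants remain there.\<close>

definition "a1 t = (LINT s:{h0<..t}|\<nu>. P1 s) + C1 * B"
definition "a2 t = (LINT s:{h0<..t}|\<nu>. P2 s) + C2 * B"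
definition "q1 t = (LINT s:{h0<..t}|lborel. P1 s * W s) + C1"
definition "q2 t = (LINT s:{h0<..t}|lborel. P2 s * W s) + C2"
definition "\<theta>2 t = a2 t / q2 t"

end

locale weight_pair_pos = weight_pair +
  assumes q1_pos: "\<And>t. h0 < t \<Longrightarrow> t \<le> T \<Longrightarrow> 0 < q1 t"
    and q2_pos: "\<And>t. h0 < t \<Longrightarrow> t \<le> T \<Longrightarrow> 0 < q2 t"
    and \<theta>2_mono: "\<And>s t. h0 < s \<Longrightarrow> s \<le> t \<Longrightarrow> t \<le> T \<Longrightarrow> \<theta>2 s \<le> \<theta>2 t"
begin

lemma
  assumes "h0 \<le> s" "s \<le> t" "t \<le> T"
  shows a1_diff: "a1 t - a1 s = (LINT x:{s<..t}|\<nu>. P1 x)"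
    and a2_diff: "a2 t - a2 s = (LINT x:{s<..t}|\<nu>. P2 x)"
    and q1_diff: "q1 t - q1 s = (LINT x:{s<..t}|lborel. P1 x * W x)"
    and q2_diff: "q2 t - q2 s = (LINT x:{s<..t}|lborel. P2 x * W x)"
proof -
  have sub: "{h0<..t} \<subseteq> {h0<..T}" using assms by auto
  have *: "set_integrable M {h0<..t} f" if "set_integrable M {h0<..T} f" "sets M = sets borel"
    for M and f :: "real \<Rightarrow> real"
    by (rule set_integrable_subset[OF that(1) _ sub]) (simp add: that)
  show "a1 t - a1 s = (LINT x:{s<..t}|\<nu>. P1 x)" "a2 t - a2 s = (LINT x:{s<..t}|\<nu>. P2 x)"
    using set_integral_Ioc_diff[OF * assms(1,2)] int_\<nu>1 int_\<nu>2 sets_\<nu>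
    by (simp_all add: a1_def a2_def)
  show "q1 t - q1 s = (LINT x:{s<..t}|lborel. P1 x * W x)"
       "q2 t - q2 s = (LINT x:{s<..t}|lborel. P2 x * W x)"
    using set_integral_Ioc_diff[OF * assms(1,2)] int_W1 int_W2
    by (simp_all add: q1_def q2_def)
qed

lemma q_mono:
  assumes "h0 \<le> s" "s \<le> t" "t \<le> T"
  shows "q1 s \<le> q1 t" "q2 s \<le> q2 t"
proof -
  have "0 \<le> (LINT x:{s<..t}|lborel. P1 x * W x)" "0 \<le> (LINT x:{s<..t}|lborel. P2 x * W x)"
    by (auto intro!: set_integral_nonneg mult_nonneg_nonneg simp: W_nonneg P1_nonneg P2_nonneg)
  then show "q1 s \<le> q1 t" "q2 s \<le> q2 t"
    using q1_diff[OF assms] q2_diff[OF assms] by auto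
qed

lemma
  assumes "h0 \<le> s"
  shows q1_cont: "continuous_on {s..T} q1" and q2_cont: "continuous_on {s..T} q2"
proof -
  have "{s..T} \<subseteq> {h0..T}" using assms by auto
  then show "continuous_on {s..T} q1" "continuous_on {s..T} q2"
    unfolding q1_def q2_def
    by (auto intro!: continuous_intros intro: continuous_on_subset
        continuous_on_set_integral_Ioc[OF int_W1] continuous_on_set_integral_Ioc[OF int_W2])
qed

lemma
  shows a1_lim: "(a1 \<longlongrightarrow> C1 * B) (at_right h0)" and a2_lim: "(a2 \<longlongrightarrow> C2 * B) (at_right h0)"
    and q1_lim: "(q1 \<longlongrightarrow> C1) (at_right h0)" and q2_lim: "(q2 \<longlongrightarrow> C2) (at_right h0)"
proof -
  have *: "((\<lambda>t. (LINT x:{h0<..t}|M. f x) + c) \<longlongrightarrow> c) (at_right h0)"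
    if "set_integrable M {h0<..T} f" "sets M = sets borel" for M c and f :: "real \<Rightarrow> real"
    using tendsto_add[OF tendsto_set_integral_Ioc_at_right[OF that(1) h0_less that(2)] tendsto_const[of c]]
    by simp
  show "(a1 \<longlongrightarrow> C1 * B) (at_right h0)" "(a2 \<longlongrightarrow> C2 * B) (at_right h0)"
    "(q1 \<longlongrightarrow> C1) (at_right h0)" "(q2 \<longlongrightarrow> C2) (at_right h0)"
    using *[OF int_\<nu>1 sets_\<nu>] *[OF int_\<nu>2 sets_\<nu>] *[OF int_W1] *[OF int_W2]
    by (simp_all add: a1_def[abs_def] a2_def[abs_def] q1_def[abs_def] q2_def[abs_def])
qed

lemma eventually_right_h0:
  assumes "\<And>t. h0 < t \<Longrightarrow> t \<le> T \<Longrightarrow> Q t"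
  shows "eventually Q (at_right h0)"
  unfolding eventually_at_right_field using assms h0_less by (intro exI[of _ T]) auto

text \<open>Positivity of a weight concerns only \<open>P\<close>. The sign of the constants comes
  from the tubes: \<open>C1\<close> and \<open>C2\<close> are limits of the positive
  \<open>q1\<close> and \<open>q2\<close>.\<close>

lemma C_nonneg: "0 \<le> C1" "0 \<le> C2"
proof -
  have "\<forall>\<^sub>F t in at_right h0. 0 \<le> q1 t" "\<forall>\<^sub>F t in at_right h0. 0 \<le> q2 t"
    using q1_pos q2_pos by (auto intro!: eventually_right_h0 less_imp_le)
  then show "0 \<le> C1" "0 \<le> C2"
    using tendsto_lowerbound[OF q1_lim] tendsto_lowerbound[OF q2_lim] by auto
qed

text \<open>Monotonicity of \<open>\<theta>2\<close> says that on \<open>{t1<..t2}\<close> the measure \<open>da2\<close> dominates the measure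
  \<open>\<theta>2 t1 \<cdot> dq2\<close>. The inequality results by integrating the density \<open>(x P1 + y P2) / P2\<close>.\<close>

lemma key_inequality:
  assumes t: "h0 < t1" "t1 \<le> t2" "t2 \<le> T"
    and nonneg: "\<And>s. t1 < s \<Longrightarrow> s \<le> t2 \<Longrightarrow> 0 \<le> x * P1 s + y * P2 s"
    and zero: "\<And>s. t1 < s \<Longrightarrow> s \<le> t2 \<Longrightarrow> P2 s = 0 \<Longrightarrow> P1 s = 0"
  shows "\<theta>2 t1 * (x * (q1 t2 - q1 t1) + y * (q2 t2 - q2 t1))
           \<le> x * (a1 t2 - a1 t1) + y * (a2 t2 - a2 t1)"
proof -
  define I where "I = {t1<..t2}"
  define u where "u s = x * P1 s + y * P2 s" for s
  have I: "I \<in> sets borel" by (simp add: I_def)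
  have u_meas [measurable]: "u \<in> borel_measurable borel" unfolding u_def by measurable
  have IT: "I \<subseteq> {h0<..T}" using t by (auto simp: I_def)
  have sub: "set_integrable M I f" if "set_integrable M {h0<..T} f" "sets M = sets borel"
    for M and f :: "real \<Rightarrow> real"
    by (rule set_integrable_subset[OF that(1) _ IT]) (simp add: that I)
  note ints = sub[OF int_\<nu>1 sets_\<nu>] sub[OF int_\<nu>2 sets_\<nu>] sub[OF int_W1 sets_lborel] sub[OF int_W2 sets_lborel]
  have u_int: "set_integrable \<nu> I u" "set_integrable lborel I (\<lambda>s. u s * W s)"
    using ints by (auto simp: u_def[abs_def] distrib_right mult.assoc)
  have A: "x * (a1 t2 - a1 t1) + y * (a2 t2 - a2 t1) = (LINT s:I|\<nu>. u s)"
    using t ints by (simp add: a1_diff a2_diff u_def flip: I_def)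
  have Q: "x * (q1 t2 - q1 t1) + y * (q2 t2 - q2 t1) = (LINT s:I|lborel. u s * W s)"
    using t ints by (simp add: q1_diff q2_diff u_def distrib_right mult.assoc flip: I_def)
  have u_nonneg: "0 \<le> u s" if "s \<in> I" for s using nonneg that by (simp add: I_def u_def)
  have A0: "0 \<le> (LINT s:I|\<nu>. u s)" and Q0: "0 \<le> (LINT s:I|lborel. u s * W s)"
    using u_nonneg by (auto intro!: set_integral_nonneg simp: W_nonneg)
  show ?thesis
  \<comment> \<open>\<open>B\<close> carries no sign, hence neither does \<open>\<theta>2\<close>.
    If \<open>\<theta>2 t1\<close> is not positive, the two sides are separated by 0; otherwise it
    can serve as a factor in a measure.\<close>
  proof (cases "\<theta>2 t1 \<le> 0")
    case True
    then show ?thesis using A0 Q0 unfolding A Q by (meson mult_nonpos_nonneg order_trans)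
  next
    case False
    define c where "c = \<theta>2 t1"
    have "0 < c" using False by (simp add: c_def)
    define M1 where "M1 = density \<nu> (\<lambda>s. ennreal (P2 s * indicator I s))"
    define M2 where "M2 = density lborel (\<lambda>s. ennreal (c * (P2 s * W s) * indicator I s))"
    have P2_\<nu>: "f \<in> borel_measurable \<nu>" if "f \<in> borel_measurable borel" for f :: "real \<Rightarrow> real"
      using that measurable_cong_sets[OF sets_\<nu> refl] by blast
    have M1: "emeasure M1 X = ennreal (LINT s:I \<inter> X|\<nu>. P2 s)" if "X \<in> sets borel" for X
      unfolding M1_def using that sets_\<nu> I ints
      by (intro emeasure_density_indicator_real P2_\<nu>) (auto simp: P2_nonneg)
    have M2: "emeasure M2 X = ennreal (LINT s:I \<inter> X|lborel. c * (P2 s * W s))" if "X \<in> sets borel" for X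
      unfolding M2_def using that I ints \<open>0 < c\<close>
      by (intro emeasure_density_indicator_real) (auto simp: P2_nonneg W_nonneg)
    have sM: "sets M1 = sets borel" "sets M2 = sets borel" by (simp_all add: M1_def M2_def sets_\<nu>)
    have fin: "finite_measure M1" "finite_measure M2"
      using M1[of UNIV] M2[of UNIV] sM[THEN sets_eq_imp_space_eq] by (auto intro!: finite_measureI)
    have "emeasure M2 X \<le> emeasure M1 X" if "X \<in> sets borel" for X
    proof (rule emeasure_mono_borel_realI[OF fin sM _ that])
      fix a b :: real assume "a \<le> b"
      define a' b' where "a' = max a t1" and "b' = min b t2"
      have inter: "I \<inter> {a<..b} = {a'<..b'}" by (auto simp: I_def a'_def b'_def)
      have "(LINT s:{a'<..b'}|lborel. c * (P2 s * W s)) \<le> (LINT s:{a'<..b'}|\<nu>. P2 s)"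
      proof (cases "a' \<le> b'")
        case True
        have ab: "h0 < a'" "b' \<le> T" "t1 \<le> a'" "a' \<le> T" "h0 < b'" using t True by (auto simp: a'_def b'_def)
        \<comment> \<open>Monotonicity enters twice: \<open>\<theta>2 a' \<le> \<theta>2 b'\<close>
          bounds the increment of \<open>a2 = \<theta>2 * q2\<close> below by
          \<open>\<theta>2 a'\<close> times that of \<open>q2\<close>, and
          \<open>\<theta>2 t1 \<le> \<theta>2 a'\<close> makes the factor independent of the
          interval.\<close>
        have "a2 a' = \<theta>2 a' * q2 a'" "a2 b' = \<theta>2 b' * q2 b'"
          using q2_pos[of a'] q2_pos[of b'] ab by (simp_all add: \<theta>2_def)
        moreover have "\<theta>2 a' * q2 b' \<le> \<theta>2 b' * q2 b'"
          using \<theta>2_mono[of a' b'] q2_pos[of b'] ab True by simp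
        moreover have "c * (q2 b' - q2 a') \<le> \<theta>2 a' * (q2 b' - q2 a')"
          using \<theta>2_mono[of t1 a'] q_mono[of a' b'] ab True t by (intro mult_right_mono) (auto simp: c_def)
        ultimately have "c * (q2 b' - q2 a') \<le> a2 b' - a2 a'" by (simp add: algebra_simps)
        then show ?thesis using ab True by (simp add: q2_diff a2_diff)
      qed (simp add: set_lebesgue_integral_def)
      then show "measure M2 {a<..b} \<le> measure M1 {a<..b}"
        using M1[of "{a<..b}"] M2[of "{a<..b}"] \<open>0 < c\<close>
        by (simp add: measure_def inter) (auto intro!: enn2real_mono ennreal_leI)
    qed
    then have le: "M2 \<le> M1"
      using sM by (auto simp: le_measure)
    \<comment> \<open>Where \<open>P2\<close> vanishes the quotient is 0 by default; there
      \<open>u\<close> vanishes too by \<open>zero\<close>, so \<open>P2 * \<rho> = u\<close> on all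
      of \<open>I\<close>.\<close>
    define \<rho> where "\<rho> s = u s / P2 s" for s
    have [measurable]: "\<rho> \<in> borel_measurable borel" unfolding \<rho>_def by measurable
    have \<rho>: "P2 s * \<rho> s = u s" if "s \<in> I" for s
      using zero[of s] that by (auto simp: \<rho>_def u_def I_def)
    have \<rho>_nonneg: "0 \<le> \<rho> s" if "s \<in> I" for s using u_nonneg[OF that] P2_nonneg[of s] by (simp add: \<rho>_def)
    have I1: "(\<integral>\<^sup>+s. ennreal (\<rho> s) \<partial>M1) = ennreal (LINT s:I|\<nu>. u s)"
    proof -
      have "(\<integral>\<^sup>+s. ennreal (\<rho> s) \<partial>M1) = (\<integral>\<^sup>+s. ennreal (indicator I s *\<^sub>R u s) \<partial>\<nu>)"
        unfolding M1_def using sets_\<nu> I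
        by (subst nn_integral_density)
           (auto intro!: nn_integral_cong P2_\<nu> measurable_compose[OF P2_\<nu> measurable_ennreal]
             simp: indicator_def \<rho> \<rho>_nonneg P2_nonneg simp flip: ennreal_mult)
      also have "\<dots> = ennreal (LINT s:I|\<nu>. u s)" unfolding set_lebesgue_integral_def
        by (rule nn_integral_eq_integral)
           (use u_int u_nonneg in \<open>auto simp: set_integrable_def indicator_def\<close>)
      finally show ?thesis .
    qed
    have I2: "(\<integral>\<^sup>+s. ennreal (\<rho> s) \<partial>M2) = ennreal (c * (LINT s:I|lborel. u s * W s))"
    proof -
      have "(\<integral>\<^sup>+s. ennreal (\<rho> s) \<partial>M2) = (\<integral>\<^sup>+s. ennreal (indicator I s *\<^sub>R (c * (u s * W s))) \<partial>lborel)"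
        unfolding M2_def using I \<open>0 < c\<close> \<rho>
        by (subst nn_integral_density)
           (auto intro!: nn_integral_cong
             simp: indicator_def \<rho>_nonneg P2_nonneg W_nonneg mult_ac simp flip: ennreal_mult \<rho>)
      also have "\<dots> = ennreal (LINT s:I|lborel. c * (u s * W s))"
      proof -
        have "set_integrable lborel I (\<lambda>s. c * (u s * W s))" using u_int by simp
        then show ?thesis
          unfolding set_integrable_def set_lebesgue_integral_def using u_nonneg W_nonneg \<open>0 < c\<close>
          by (intro nn_integral_eq_integral) (auto simp: indicator_def)
      qed
      finally show ?thesis by simp
    qed
    have "ennreal (c * (LINT s:I|lborel. u s * W s)) \<le> ennreal (LINT s:I|\<nu>. u s)"
      unfolding I1[symmetric] I2[symmetric]
      using le sM by (intro nn_integral_mono_measure) auto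
    then show ?thesis using A0 unfolding A Q c_def by (simp add: ennreal_le_iff)
  qed
qed

end

text \<open>The pointwise hypothesis compares the logarithmic derivatives of \<open>F\<close> and
  \<open>G\<close>, which exist only as densities. On a short interval \<open>F\<close> is frozen at
  the right end and \<open>G\<close> at the left end; this costs the product of the increments of
  \<open>F\<close> and \<open>G\<close>, a second-order error. The constant
  \<open>1 / (G a)\<^sup>2\<close> bounds the reciprocals \<open>1 / (G x * G y)\<close>.\<close>

lemma quotient_antimono_if_log_deriv_le:
  fixes F G f g :: "real \<Rightarrow> real"
  assumes "a \<le> b"
    and int: "set_integrable lborel {a<..b} f" "set_integrable lborel {a<..b} g"
    and nonneg: "\<And>s. 0 \<le> f s" "\<And>s. 0 \<le> g s"
    and F: "\<And>x y. a \<le> x \<Longrightarrow> x \<le> y \<Longrightarrow> y \<le> b \<Longrightarrow> F y - F x = (LINT s:{x<..y}|lborel. f s)"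
    and G: "\<And>x y. a \<le> x \<Longrightarrow> x \<le> y \<Longrightarrow> y \<le> b \<Longrightarrow> G y - G x = (LINT s:{x<..y}|lborel. g s)"
    and pos: "0 < F a" "0 < G a"
    and cont: "continuous_on {a..b} F"
    and le: "\<And>s. a < s \<Longrightarrow> s \<le> b \<Longrightarrow> f s * G s \<le> g s * F s"
  shows "F b / G b \<le> F a / G a"
proof -
  have mono: "F x \<le> F y" "G x \<le> G y" if "a \<le> x" "x \<le> y" "y \<le> b" for x y
    using F[OF that] G[OF that] set_integral_nonneg[of "{x<..y}" f lborel]
      set_integral_nonneg[of "{x<..y}" g lborel] nonneg by auto
  have "- (F a / G a) \<le> - (F b / G b)"
  proof (rule mono_on_if_second_order[where r=F and \<theta>=G and K="1 / (G a)\<^sup>2" and F="\<lambda>t. - (F t / G t)"])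
    fix x y assume xy: "a \<le> x" "x \<le> y" "y \<le> b"
    have p: "0 < F x" "0 < G x" "0 < F y" "0 < G y"
      using pos mono[of a x] mono[of a y] xy by auto
    have sub: "set_integrable lborel {x<..y} f" "set_integrable lborel {x<..y} g"
      using xy by (auto intro: set_integrable_subset[OF int(1)] set_integrable_subset[OF int(2)])
    have "f s \<le> F y / G x * g s" if "s \<in> {x<..y}" for s
    proof -
      have s: "G x \<le> G s" "F s \<le> F y" using mono xy that by auto
      have "f s * G x \<le> f s * G s" using s nonneg by (intro mult_left_mono)
      also have "\<dots> \<le> g s * F s" using le[of s] that xy by auto
      also have "\<dots> \<le> g s * F y" using s nonneg by (intro mult_left_mono)
      finally show ?thesis using p by (simp add: field_simps)
    qed
    then have "(LINT s:{x<..y}|lborel. f s) \<le> (LINT s:{x<..y}|lborel. F y / G x * g s)"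
      using sub by (intro set_integral_mono) auto
    then have "F y - F x \<le> F y / G x * (G y - G x)"
      using F G xy by simp
    then have "(F y - F x) * G x \<le> F y * (G y - G x)"
      using p by (simp add: field_simps)
    then have *: "F y * G x - F x * G y \<le> (F y - F x) * (G y - G x)"
      by (simp add: algebra_simps)
    have "F y / G y - F x / G x = (F y * G x - F x * G y) / (G x * G y)"
      using p by (simp add: field_simps)
    also have "\<dots> \<le> ((F y - F x) * (G y - G x)) / (G x * G y)"
      using * p by (intro divide_right_mono) auto
    also have "\<dots> \<le> ((F y - F x) * (G y - G x)) / (G a)\<^sup>2"
      using mono[of x y] mono[of a x] mono[of a y] xy pos
      by (intro divide_left_mono) (auto simp: power2_eq_square intro!: mult_mono mult_pos_pos)
    finally show "- (F x / G x) - 1 / (G a)\<^sup>2 * \<bar>F y - F x\<bar> * (G y - G x) \<le> - (F y / G y)"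
      using mono[of x y] xy by simp
  qed (use assms mono in auto)
  then show ?thesis by simp
qed

section \<open>Comparison of the two densities on the line\<close>

context weight_pair_pos
begin

lemma q1_over_q2_antimono:
  assumes weaker: "\<And>t. h0 < t \<Longrightarrow> t \<le> T \<Longrightarrow> P1 t / q1 t \<le> P2 t / q2 t"
    and st: "h0 < s" "s \<le> t" "t \<le> T"
  shows "q1 t / q2 t \<le> q1 s / q2 s"
proof (rule quotient_antimono_if_log_deriv_le[where f="\<lambda>s. P1 s * W s" and g="\<lambda>s. P2 s * W s"])
  show "continuous_on {s..t} q1"
    by (rule continuous_on_subset[OF q1_cont[of s]]) (use st in auto)
  show "set_integrable lborel {s<..t} (\<lambda>s. P1 s * W s)"
    by (rule set_integrable_subset[OF int_W1]) (use st in auto)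
  show "set_integrable lborel {s<..t} (\<lambda>s. P2 s * W s)"
    by (rule set_integrable_subset[OF int_W2]) (use st in auto)
  fix x assume x: "s < x" "x \<le> t"
  then have "P1 x * q2 x \<le> P2 x * q1 x"
    using weaker[of x] q1_pos[of x] q2_pos[of x] st by (simp add: field_simps)
  then have "P1 x * q2 x * W x \<le> P2 x * q1 x * W x" using W_nonneg by (rule mult_right_mono)
  then show "P1 x * W x * q2 x \<le> P2 x * W x * q1 x" by (simp add: mult_ac)
qed (use st in \<open>simp_all add: q1_diff q2_diff q1_pos q2_pos P1_nonneg P2_nonneg W_nonneg\<close>)

lemma q2_over_q1_antimono:
  assumes weaker: "\<And>t. h0 < t \<Longrightarrow> t \<le> T \<Longrightarrow> P2 t / q2 t \<le> P1 t / q1 t"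
    and st: "h0 < s" "s \<le> t" "t \<le> T"
  shows "q2 t / q1 t \<le> q2 s / q1 s"
proof (rule quotient_antimono_if_log_deriv_le[where f="\<lambda>s. P2 s * W s" and g="\<lambda>s. P1 s * W s"])
  show "continuous_on {s..t} q2"
    by (rule continuous_on_subset[OF q2_cont[of s]]) (use st in auto)
  show "set_integrable lborel {s<..t} (\<lambda>s. P1 s * W s)"
    by (rule set_integrable_subset[OF int_W1]) (use st in auto)
  show "set_integrable lborel {s<..t} (\<lambda>s. P2 s * W s)"
    by (rule set_integrable_subset[OF int_W2]) (use st in auto)
  fix x assume x: "s < x" "x \<le> t"
  then have "P2 x * q1 x \<le> P1 x * q2 x"
    using weaker[of x] q1_pos[of x] q2_pos[of x] st by (simp add: field_simps)
  then have "P2 x * q1 x * W x \<le> P1 x * q2 x * W x" using W_nonneg by (rule mult_right_mono)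
  then show "P2 x * W x * q1 x \<le> P1 x * W x * q2 x" by (simp add: mult_ac)
qed (use st in \<open>simp_all add: q1_diff q2_diff q1_pos q2_pos P1_nonneg P2_nonneg W_nonneg\<close>)

lemma a2_eq: "h0 < t \<Longrightarrow> t \<le> T \<Longrightarrow> a2 t = \<theta>2 t * q2 t"
  using q2_pos[of t] by (simp add: \<theta>2_def)

lemma \<theta>2_lim:
  assumes "0 < C2"
  shows "(\<theta>2 \<longlongrightarrow> B) (at_right h0)"
  using tendsto_divide[OF a2_lim q2_lim] assms by (simp add: \<theta>2_def[abs_def])

lemma a2_nonneg_if_C2_eq_0: "C2 = 0 \<Longrightarrow> 0 \<le> a2 t"
  unfolding a2_def by (simp add: set_integral_nonneg P2_nonneg)

text \<open>As \<open>q2 / q1\<close> decreases, its limit \<open>C2 / C1\<close> at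
  \<open>h0\<close> is at least its positive value at \<open>T\<close>.\<close>

lemma C2_pos:
  assumes weaker: "\<And>t. h0 < t \<Longrightarrow> t \<le> T \<Longrightarrow> P2 t / q2 t \<le> P1 t / q1 t" and "0 < C1"
  shows "0 < C2"
proof -
  have "((\<lambda>s. q2 s / q1 s) \<longlongrightarrow> C2 / C1) (at_right h0)"
    using assms(2) by (intro tendsto_divide q1_lim q2_lim) auto
  moreover have "\<forall>\<^sub>F s in at_right h0. q2 T / q1 T \<le> q2 s / q1 s"
    using q2_over_q1_antimono[OF weaker] by (auto intro!: eventually_right_h0)
  ultimately have "q2 T / q1 T \<le> C2 / C1" by (intro tendsto_lowerbound) auto
  moreover have "0 < q2 T / q1 T" using q1_pos q2_pos h0_less by simp
  ultimately have "0 < C2 / C1" by linarith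
  then show ?thesis using assms(2) by (simp add: zero_less_divide_iff)
qed

text \<open>The key inequality with coefficients 1 and 0: from level \<open>s\<close> on,
  \<open>a1\<close> gains at least \<open>\<theta>2 s\<close> times what \<open>q1\<close>
  gains.\<close>

lemma a1_ge:
  assumes zero: "\<And>t. h0 < t \<Longrightarrow> t \<le> T \<Longrightarrow> P2 t = 0 \<Longrightarrow> P1 t = 0"
    and st: "h0 < s" "s \<le> t" "t \<le> T"
  shows "\<theta>2 s * (q1 t - q1 s) \<le> a1 t - a1 s"
  using key_inequality[of s t 1 0] st zero P1_nonneg by simp

text \<open>For small steps the product rule for \<open>\<theta>2 * q1\<close> holds up to an error that is of second order
  in the increments of the continuous function \<open>q1 / q2\<close> and the monotone function \<open>\<theta>2\<close>.\<close>

lemma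
  assumes st: "h0 < s" "s \<le> t" "t \<le> T"
  shows defect_mono: "(\<And>t. h0 < t \<Longrightarrow> t \<le> T \<Longrightarrow> P1 t / q1 t \<le> P2 t / q2 t) \<Longrightarrow>
            \<theta>2 s * q1 s - a1 s \<le> \<theta>2 t * q1 t - a1 t"
    and excess_mono: "(\<And>t. h0 < t \<Longrightarrow> t \<le> T \<Longrightarrow> P2 t / q2 t \<le> P1 t / q1 t) \<Longrightarrow>
            (\<And>t. h0 < t \<Longrightarrow> t \<le> T \<Longrightarrow> P2 t = 0 \<Longrightarrow> P1 t = 0) \<Longrightarrow>
            a1 s - \<theta>2 s * q1 s \<le> a1 t - \<theta>2 t * q1 t"
proof -
  define R where "R t = q1 t / q2 t" for t
  have R: "q1 t = R t * q2 t" if "h0 < t" "t \<le> T" for t using q2_pos[OF that] by (simp add: R_def)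
  have R_cont: "continuous_on {s..t} R"
    unfolding R_def
  proof (intro continuous_on_divide ballI)
    show "continuous_on {s..t} q1" "continuous_on {s..t} q2"
      using st by (auto intro: continuous_on_subset[OF q1_cont[of s]] continuous_on_subset[OF q2_cont[of s]])
    show "q2 x \<noteq> 0" if "x \<in> {s..t}" for x using q2_pos[of x] that st by simp
  qed
  have K: "0 \<le> q2 t" using q2_pos[of t] st by simp
  have err: "q2 y * \<bar>R y - R x\<bar> * (\<theta>2 y - \<theta>2 x) \<le> q2 t * \<bar>R y - R x\<bar> * (\<theta>2 y - \<theta>2 x)"
    if "s \<le> x" "x \<le> y" "y \<le> t" for x y
    using q_mono(2)[of y t] \<theta>2_mono[of x y] st that by (intro mult_right_mono) auto
  show "\<theta>2 s * q1 s - a1 s \<le> \<theta>2 t * q1 t - a1 t" 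
    if weak: "\<And>t. h0 < t \<Longrightarrow> t \<le> T \<Longrightarrow> P1 t / q1 t \<le> P2 t / q2 t"
  proof (rule mono_on_if_second_order[OF st(2) K R_cont, where \<theta>=\<theta>2])
    fix x y assume xy: "s \<le> x" "x \<le> y" "y \<le> t"
    then show "\<theta>2 x \<le> \<theta>2 y" using st by (intro \<theta>2_mono) auto
    have x: "h0 < x" "x \<le> T" and y: "h0 < y" "y \<le> T" using xy st by auto
    \<comment> \<open>Since \<open>R = q1 / q2\<close> decreases, the weight comparison at
      \<open>z\<close> survives when \<open>R z\<close> is replaced by its value at the left end.
      The key inequality then applies with the constant coefficients -1 and
      \<open>R x\<close>.\<close>
    have P: "P1 z \<le> R x * P2 z" if "x < z" "z \<le> y" for z
    proof -
      have z: "h0 < z" "z \<le> T" using that x y by auto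
      have "P1 z \<le> R z * P2 z" using weak[OF z] q1_pos[OF z] q2_pos[OF z]
        by (simp add: R_def field_simps)
      also have "R z \<le> R x" unfolding R_def using that x z by (intro q1_over_q2_antimono weak) auto
      finally show ?thesis using P2_nonneg[of z] by (simp add: mult_right_mono)
    qed
    have "P1 z = 0" if "x < z" "z \<le> y" "P2 z = 0" for z
      using P[OF that(1,2)] that(3) P1_nonneg[of z] by simp
    then have "\<theta>2 x * (-1 * (q1 y - q1 x) + R x * (q2 y - q2 x))
           \<le> -1 * (a1 y - a1 x) + R x * (a2 y - a2 x)"
      using P x y xy by (intro key_inequality) auto
    \<comment> \<open>Substituting \<open>a2 = \<theta>2 * q2\<close> and \<open>q1 = R * q2\<close>
      at both ends leaves exactly one extra term, the product of the increments of \<open>R\<close>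
      and \<open>\<theta>2\<close> with \<open>q2 y\<close>.\<close>
    then have "\<theta>2 x * q1 x - a1 x + (R y - R x) * q2 y * (\<theta>2 y - \<theta>2 x) \<le> \<theta>2 y * q1 y - a1 y"
      by (simp add: a2_eq x y R algebra_simps)
    moreover have "- (q2 y * \<bar>R y - R x\<bar> * (\<theta>2 y - \<theta>2 x)) \<le> (R y - R x) * q2 y * (\<theta>2 y - \<theta>2 x)"
    proof -
      have "- \<bar>R y - R x\<bar> * (q2 y * (\<theta>2 y - \<theta>2 x)) \<le> (R y - R x) * (q2 y * (\<theta>2 y - \<theta>2 x))"
        using \<open>\<theta>2 x \<le> \<theta>2 y\<close> q2_pos[OF y] by (intro mult_right_mono) auto
      then show ?thesis by (simp add: mult_ac)
    qed
    ultimately show "\<theta>2 x * q1 x - a1 x - q2 t * \<bar>R y - R x\<bar> * (\<theta>2 y - \<theta>2 x) \<le> \<theta>2 y * q1 y - a1 y"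
      using err[OF xy] by linarith
  qed
  show "a1 s - \<theta>2 s * q1 s \<le> a1 t - \<theta>2 t * q1 t" 
    if weak: "\<And>t. h0 < t \<Longrightarrow> t \<le> T \<Longrightarrow> P2 t / q2 t \<le> P1 t / q1 t"
      and zero: "\<And>t. h0 < t \<Longrightarrow> t \<le> T \<Longrightarrow> P2 t = 0 \<Longrightarrow> P1 t = 0"
  proof (rule mono_on_if_second_order[OF st(2) K R_cont, where \<theta>=\<theta>2])
    fix x y assume xy: "s \<le> x" "x \<le> y" "y \<le> t"
    then show "\<theta>2 x \<le> \<theta>2 y" using st by (intro \<theta>2_mono) auto
    have x: "h0 < x" "x \<le> T" and y: "h0 < y" "y \<le> T" using xy st by auto
    \<comment> \<open>Now \<open>R\<close> increases, so freezing it at the left end is again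
      harmless, with all inequalities reversed.\<close>
    have P: "R x * P2 z \<le> P1 z" if "x < z" "z \<le> y" for z
    proof -
      have z: "h0 < z" "z \<le> T" using that x y by auto
      have "R x \<le> R z"
        using q2_over_q1_antimono[of x z] weak that x z q1_pos[OF x] q1_pos[OF z] q2_pos[OF x] q2_pos[OF z]
        by (simp add: R_def field_simps)
      then have "R x * P2 z \<le> R z * P2 z" using P2_nonneg by (rule mult_right_mono)
      also have "\<dots> \<le> P1 z" using weak[OF z] q1_pos[OF z] q2_pos[OF z]
        by (simp add: R_def field_simps)
      finally show ?thesis .
    qed
    have "\<theta>2 x * (1 * (q1 y - q1 x) + (- R x) * (q2 y - q2 x))
           \<le> 1 * (a1 y - a1 x) + (- R x) * (a2 y - a2 x)"
      using P x y xy zero by (intro key_inequality) auto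
    then have "a1 x - \<theta>2 x * q1 x - (R y - R x) * q2 y * (\<theta>2 y - \<theta>2 x) \<le> a1 y - \<theta>2 y * q1 y"
      by (simp add: a2_eq x y R algebra_simps)
    moreover have "(R y - R x) * q2 y * (\<theta>2 y - \<theta>2 x) \<le> q2 y * \<bar>R y - R x\<bar> * (\<theta>2 y - \<theta>2 x)"
    proof -
      have "(R y - R x) * (q2 y * (\<theta>2 y - \<theta>2 x)) \<le> \<bar>R y - R x\<bar> * (q2 y * (\<theta>2 y - \<theta>2 x))"
        using \<open>\<theta>2 x \<le> \<theta>2 y\<close> q2_pos[OF y] by (intro mult_right_mono) auto
      then show ?thesis by (simp add: mult_ac)
    qed
    ultimately show "a1 x - \<theta>2 x * q1 x - q2 t * \<bar>R y - R x\<bar> * (\<theta>2 y - \<theta>2 x) \<le> a1 y - \<theta>2 y * q1 y"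
      using err[OF xy] by linarith
  qed
qed

text \<open>The defect \<open>\<theta>2 * q1 - a1\<close> increases, so its sign is decided near
  \<open>h0\<close>. There \<open>\<theta>2\<close> is replaced by a constant lower bound
  \<open>b\<close> whose limiting defect \<open>b * C1 - C1 * B\<close> is not negative:
  \<open>b = 0\<close> if both constants vanish, and \<open>b = B\<close> otherwise. The latter is a
  lower bound by the limit of \<open>\<theta>2\<close> if \<open>C2 > 0\<close>, and by
  \<open>initial\<close> if \<open>C2 = 0 < C1\<close>.\<close>

lemma a1_le_\<theta>2_q1:
  assumes weak: "\<And>t. h0 < t \<Longrightarrow> t \<le> T \<Longrightarrow> P1 t / q1 t \<le> P2 t / q2 t"
    and initial: "\<And>t. 0 < C1 \<Longrightarrow> C2 = 0 \<Longrightarrow> h0 < t \<Longrightarrow> t \<le> T \<Longrightarrow> B \<le> \<theta>2 t"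
    and t: "h0 < t" "t \<le> T"
  shows "a1 t \<le> \<theta>2 t * q1 t"
proof -
  obtain b where b: "\<And>s. h0 < s \<Longrightarrow> s \<le> T \<Longrightarrow> b \<le> \<theta>2 s" "C1 * B \<le> b * C1"
  proof (cases "C2 = 0")
    case True
    show ?thesis
    proof (cases "C1 = 0")
      case True
      show ?thesis
      proof (rule that[of 0])
        show "0 \<le> \<theta>2 s" if "h0 < s" "s \<le> T" for s
          unfolding \<theta>2_def
          by (rule divide_nonneg_pos[OF a2_nonneg_if_C2_eq_0[OF \<open>C2 = 0\<close>] q2_pos[OF that]])
      qed (simp add: True)
    next
      case False
      show ?thesis
      proof (rule that[OF _ eq_refl[OF mult.commute]])
        show "B \<le> \<theta>2 s" if "h0 < s" "s \<le> T" for s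
        proof (rule initial[OF _ \<open>C2 = 0\<close> that])
          show "0 < C1" using C_nonneg(1) False by simp
        qed
      qed
    qed
  next
    case False
    have B_le: "B \<le> \<theta>2 s" if "h0 < s" "s \<le> T" for s
    proof (rule tendsto_upperbound[OF \<theta>2_lim])
      show "\<forall>\<^sub>F x in at_right h0. \<theta>2 x \<le> \<theta>2 s"
        unfolding eventually_at_right_field using that by (intro exI[of _ s]) (auto intro!: \<theta>2_mono)
    next
      show "0 < C2" using C_nonneg(2) False by simp
    qed simp
    show ?thesis by (rule that[OF B_le eq_refl[OF mult.commute]])
  qed
  have "((\<lambda>s. b * q1 s - a1 s) \<longlongrightarrow> b * C1 - C1 * B) (at_right h0)"
    by (intro tendsto_diff tendsto_mult tendsto_const a1_lim q1_lim)
  moreover have "\<forall>\<^sub>F s in at_right h0. b * q1 s - a1 s \<le> \<theta>2 t * q1 t - a1 t"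
    unfolding eventually_at_right_field
  proof (intro exI[of _ t] conjI allI impI t(1))
    fix s assume s: "h0 < s" "s < t"
    then have "b * q1 s - a1 s \<le> \<theta>2 s * q1 s - a1 s"
      using b(1)[of s] q1_pos[of s] t by (intro diff_right_mono mult_right_mono) auto
    also have "\<dots> \<le> \<theta>2 t * q1 t - a1 t" using s t by (intro defect_mono weak) auto
    finally show "b * q1 s - a1 s \<le> \<theta>2 t * q1 t - a1 t" .
  qed
  ultimately have "b * C1 - C1 * B \<le> \<theta>2 t * q1 t - a1 t" by (intro tendsto_upperbound) auto
  then show ?thesis using b(2) by simp
qed

text \<open>Dually, the excess \<open>a1 - \<theta>2 * q1\<close> increases and
  \<open>\<theta>2\<close> is replaced by an upper bound near \<open>h0\<close>. If
  \<open>C1 = 0\<close>, the constant \<open>\<theta>2 t\<close> works because \<open>q1\<close>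
  tends to 0; if \<open>C1 > 0\<close>, then \<open>C2 > 0\<close> and \<open>\<theta>2\<close>
  itself tends to \<open>B\<close>.\<close>

lemma \<theta>2_q1_le_a1:
  assumes weak: "\<And>t. h0 < t \<Longrightarrow> t \<le> T \<Longrightarrow> P2 t / q2 t \<le> P1 t / q1 t"
    and zero: "\<And>t. h0 < t \<Longrightarrow> t \<le> T \<Longrightarrow> P2 t = 0 \<Longrightarrow> P1 t = 0"
    and t: "h0 < t" "t \<le> T"
  shows "\<theta>2 t * q1 t \<le> a1 t"
proof -
  obtain b where lim: "((\<lambda>s. b s * q1 s) \<longlongrightarrow> C1 * B) (at_right h0)"
    and b: "\<And>s. h0 < s \<Longrightarrow> s \<le> t \<Longrightarrow> \<theta>2 s \<le> b s"
  proof (cases "C1 = 0")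
    case True
    have "((\<lambda>s. \<theta>2 t * q1 s) \<longlongrightarrow> \<theta>2 t * C1) (at_right h0)"
      by (rule tendsto_mult_left[OF q1_lim])
    moreover have "\<theta>2 t * C1 = C1 * B" unfolding True by simp
    ultimately show ?thesis using \<theta>2_mono t(2) by (intro that[of "\<lambda>_. \<theta>2 t"]) simp_all
  next
    case False
    then have "(\<theta>2 \<longlongrightarrow> B) (at_right h0)" using C_nonneg by (intro \<theta>2_lim C2_pos weak) auto
    from tendsto_mult[OF this q1_lim] have "((\<lambda>s. \<theta>2 s * q1 s) \<longlongrightarrow> C1 * B) (at_right h0)"
      unfolding mult.commute[of C1 B] .
    then show ?thesis by (rule that) (rule order_refl)
  qed
  have "((\<lambda>s. a1 s - b s * q1 s) \<longlongrightarrow> C1 * B - C1 * B) (at_right h0)"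
    by (intro tendsto_diff a1_lim lim)
  moreover have "\<forall>\<^sub>F s in at_right h0. a1 s - b s * q1 s \<le> a1 t - \<theta>2 t * q1 t"
    unfolding eventually_at_right_field
  proof (intro exI[of _ t] conjI allI impI t(1))
    fix s assume s: "h0 < s" "s < t"
    then have "a1 s - b s * q1 s \<le> a1 s - \<theta>2 s * q1 s"
      using b[of s] q1_pos[of s] t by (intro diff_left_mono mult_right_mono) auto
    also have "\<dots> \<le> a1 t - \<theta>2 t * q1 t" using s t by (intro excess_mono weak zero) auto
    finally show "a1 s - b s * q1 s \<le> a1 t - \<theta>2 t * q1 t" .
  qed
  ultimately have "C1 * B - C1 * B \<le> a1 t - \<theta>2 t * q1 t" by (intro tendsto_upperbound) auto
  then show ?thesis by simp
qed

text \<open>At level \<open>s\<close> the first quotient is at most \<open>\<theta>2 s\<close>,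
  whereas beyond \<open>s\<close> the ratio of the gains of \<open>a1\<close> and \<open>q1\<close>
  is at least \<open>\<theta>2 s\<close>. Adding gains of a larger ratio can only raise a
  quotient.\<close>

lemma \<theta>1_mono:
  assumes weak: "\<And>t. h0 < t \<Longrightarrow> t \<le> T \<Longrightarrow> P1 t / q1 t \<le> P2 t / q2 t"
    and initial: "\<And>t. 0 < C1 \<Longrightarrow> C2 = 0 \<Longrightarrow> h0 < t \<Longrightarrow> t \<le> T \<Longrightarrow> B \<le> \<theta>2 t"
    and st: "h0 < s" "s \<le> t" "t \<le> T"
  shows "a1 s / q1 s \<le> a1 t / q1 t"
proof -
  have pos: "0 < q1 s" "0 < q1 t" using q1_pos st by auto
  have zero: "P1 x = 0" if "h0 < x" "x \<le> T" "P2 x = 0" for x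
  proof -
    have "P1 x \<le> 0"
      using weak[OF that(1,2)] that(3) q1_pos[OF that(1,2)] by (simp add: divide_le_0_iff)
    then show ?thesis using P1_nonneg[of x] by simp
  qed
  define \<theta> where "\<theta> = a1 s / q1 s"
  have \<theta>: "a1 s = \<theta> * q1 s" using pos by (simp add: \<theta>_def)
  have "a1 s \<le> \<theta>2 s * q1 s" using st by (intro a1_le_\<theta>2_q1 weak initial) auto
  then have "\<theta> \<le> \<theta>2 s" unfolding \<theta> using pos by simp
  then have "\<theta> * (q1 t - q1 s) \<le> \<theta>2 s * (q1 t - q1 s)"
    using q_mono(1)[of s t] st by (intro mult_right_mono) auto
  also have "\<dots> \<le> a1 t - a1 s" using st by (intro a1_ge zero) auto
  finally have "\<theta> * q1 t \<le> a1 t" unfolding \<theta> by (simp add: right_diff_distrib)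
  then show ?thesis unfolding \<theta>_def[symmetric] using pos by (simp add: pos_le_divide_eq)
qed

text \<open>If \<open>\<theta>2 t\<close> were below \<open>B\<close>, take \<open>b\<close> between
  them. Near \<open>h0\<close> the measure \<open>\<nu>\<close> dominates \<open>b W ds\<close>;
  integrating \<open>P2\<close> against both gives \<open>b * q2 u \<le> a2 u\<close>, without
  constant terms because \<open>C2 = 0\<close>. Then
  \<open>\<theta>2 u \<ge> b > \<theta>2 t\<close> for some \<open>u \<le> t\<close>, against
  monotonicity.\<close>

lemma initial_density_le:
  assumes lower: "\<And>b. 0 \<le> b \<Longrightarrow> b < B \<Longrightarrow> \<exists>\<delta>>0. \<forall>J\<in>sets borel. J \<subseteq> {h0<..<h0+\<delta>} \<longrightarrow>
            ennreal b * (\<integral>\<^sup>+s\<in>J. ennreal (W s) \<partial>lborel) \<le> emeasure \<nu> J"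
    and "C2 = 0" and t: "h0 < t" "t \<le> T"
  shows "B \<le> \<theta>2 t"
proof (rule ccontr)
  assume less: "\<not> B \<le> \<theta>2 t"
  have "0 \<le> \<theta>2 t" using a2_nonneg_if_C2_eq_0[OF assms(2)] q2_pos[OF t] by (simp add: \<theta>2_def)
  define b where "b = (\<theta>2 t + B) / 2"
  have b: "\<theta>2 t < b" "b < B" "0 < b" using less \<open>0 \<le> \<theta>2 t\<close> by (auto simp: b_def)
  then obtain \<delta> where \<delta>: "0 < \<delta>" "\<And>J. J \<in> sets borel \<Longrightarrow> J \<subseteq> {h0<..<h0+\<delta>} \<Longrightarrow>
      ennreal b * (\<integral>\<^sup>+s\<in>J. ennreal (W s) \<partial>lborel) \<le> emeasure \<nu> J"
    using lower[of b] by auto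
  \<comment> \<open>Half of \<open>\<delta>\<close>, because \<open>I\<close> contains its right end
    while the bound is given on an open interval.\<close>
  define u where "u = min t (h0 + \<delta> / 2)"
  have u: "h0 < u" "u \<le> T" "u \<le> t" using t \<delta>(1) by (auto simp: u_def)
  define I where "I = {h0<..u}"
  have I [measurable]: "I \<in> sets borel" by (simp add: I_def)
  have I\<delta>: "I \<subseteq> {h0<..<h0+\<delta>}" using \<delta>(1) by (auto simp: I_def u_def)
  have IT: "I \<subseteq> {h0<..T}" using u by (auto simp: I_def)
  define M1 where "M1 = density \<nu> (indicator I)"
  define M2 where "M2 = density lborel (\<lambda>s. ennreal (b * W s) * indicator I s)"
  have sM: "sets M1 = sets borel" "sets M2 = sets borel" by (simp_all add: M1_def M2_def sets_\<nu>)
  have "emeasure M2 X \<le> emeasure M1 X" if X [measurable]: "X \<in> sets borel" for X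
  proof -
    have "emeasure M2 X = (\<integral>\<^sup>+s. ennreal b * (ennreal (W s) * indicator (I \<inter> X) s) \<partial>lborel)"
      unfolding M2_def using X b W_nonneg
      by (subst emeasure_density) (auto intro!: nn_integral_cong simp: indicator_def ennreal_mult)
    also have "\<dots> = ennreal b * (\<integral>\<^sup>+s\<in>I \<inter> X. ennreal (W s) \<partial>lborel)"
      by (rule nn_integral_cmult) simp
    also have "\<dots> \<le> emeasure \<nu> (I \<inter> X)" using I\<delta> by (intro \<delta>(2)) auto
    also have "\<dots> = emeasure M1 X"
      unfolding M1_def using X I sets_\<nu>
      by (subst emeasure_density) (auto simp flip: indicator_inter_arith)
    finally show ?thesis .
  qed
  then have le: "M2 \<le> M1" using sM by (auto simp: le_measure)
  have P2_\<nu>: "P2 \<in> borel_measurable \<nu>"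
    using P2_meas measurable_cong_sets[OF sets_\<nu> refl] by blast
  have int: "set_integrable \<nu> I P2" "set_integrable lborel I (\<lambda>s. P2 s * W s)"
    using IT sets_\<nu> by (auto intro: set_integrable_subset[OF int_\<nu>2] set_integrable_subset[OF int_W2])
  have I1: "(\<integral>\<^sup>+s. ennreal (P2 s) \<partial>M1) = ennreal (LINT s:I|\<nu>. P2 s)"
  proof -
    have "(\<integral>\<^sup>+s. ennreal (P2 s) \<partial>M1) = (\<integral>\<^sup>+s. ennreal (indicator I s *\<^sub>R P2 s) \<partial>\<nu>)"
      unfolding M1_def using sets_\<nu> I P2_\<nu>
      by (subst nn_integral_density) (auto intro!: nn_integral_cong simp: indicator_def)
    also have "\<dots> = ennreal (LINT s:I|\<nu>. P2 s)"
      unfolding set_lebesgue_integral_def using int P2_nonneg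
      by (intro nn_integral_eq_integral) (auto simp: set_integrable_def)
    finally show ?thesis .
  qed
  have I2: "(\<integral>\<^sup>+s. ennreal (P2 s) \<partial>M2) = ennreal (b * (LINT s:I|lborel. P2 s * W s))"
  proof -
    have "(\<integral>\<^sup>+s. ennreal (P2 s) \<partial>M2) = (\<integral>\<^sup>+s. ennreal b * ennreal (indicator I s *\<^sub>R (P2 s * W s)) \<partial>lborel)"
      unfolding M2_def using I b P2_nonneg W_nonneg
      by (subst nn_integral_density)
         (auto intro!: nn_integral_cong simp: indicator_def mult_ac simp flip: ennreal_mult)
    also have "\<dots> = ennreal b * (\<integral>\<^sup>+s. ennreal (indicator I s *\<^sub>R (P2 s * W s)) \<partial>lborel)"
      by (rule nn_integral_cmult) simp
    also have "(\<integral>\<^sup>+s. ennreal (indicator I s *\<^sub>R (P2 s * W s)) \<partial>lborel) = ennreal (LINT s:I|lborel. P2 s * W s)"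
      unfolding set_lebesgue_integral_def using int P2_nonneg W_nonneg
      by (intro nn_integral_eq_integral) (auto simp: set_integrable_def)
    finally show ?thesis using b set_integral_nonneg[of I "\<lambda>s. P2 s * W s" lborel] P2_nonneg W_nonneg
      by (simp add: ennreal_mult)
  qed
  have "ennreal (b * (LINT s:I|lborel. P2 s * W s)) \<le> ennreal (LINT s:I|\<nu>. P2 s)"
    unfolding I1[symmetric] I2[symmetric] using le sM by (intro nn_integral_mono_measure) auto
  then have "b * (LINT s:I|lborel. P2 s * W s) \<le> (LINT s:I|\<nu>. P2 s)"
    using set_integral_nonneg[of I P2 \<nu>] P2_nonneg by (simp add: ennreal_le_iff)
  then have "b * q2 u \<le> a2 u" using assms(2) unfolding q2_def a2_def I_def by simp
  then have "b \<le> \<theta>2 u" using q2_pos[of u] u by (simp add: \<theta>2_def field_simps)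
  also have "\<dots> \<le> \<theta>2 t" using u t by (intro \<theta>2_mono)
  finally show False using b by simp
qed

end

section \<open>Gram determinants and integration over parallel hyperplanes\<close>

text \<open>The segment from the identity to \<open>G\<close> consists of positive definite, hence
  invertible matrices; along it the determinant is continuous, starts at 1 and never
  vanishes.\<close>

lemma det_pos_if_posdef:
  fixes G :: "real^'k^'k"
  assumes "\<And>v. v \<noteq> 0 \<Longrightarrow> 0 < v \<bullet> (G *v v)"
  shows "0 < det G"
proof -
  define H where "H t = t *\<^sub>R G + (1 - t) *\<^sub>R mat 1" for t :: real
  have pos: "0 < v \<bullet> (H t *v v)" if "v \<noteq> 0" "t \<in> {0..1}" for v t
  proof -
    have "v \<bullet> (H t *v v) = t * (v \<bullet> (G *v v)) + (1 - t) * (v \<bullet> v)"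
      by (simp add: H_def matrix_vector_mult_add_rdistrib inner_add_right
          flip: scaleR_matrix_vector_assoc)
    moreover have "0 < t * (v \<bullet> (G *v v)) + (1 - t) * (v \<bullet> v)"
      using that assms[OF that(1)] by (cases "t = 0") (auto intro!: add_pos_nonneg)
    ultimately show ?thesis by simp
  qed
  have nz: "det (H t) \<noteq> 0" if "t \<in> {0..1}" for t
  proof -
    have "inj ((*v) (H t))"
      by (rule vec.inj_iff_eq_0[THEN iffD2]) (use pos[OF _ that] in force)
    then show ?thesis
      using det_nz_iff_inj[OF matrix_vector_mul_linear[of "H t"]] by simp
  qed
  have cont: "continuous_on {0..1} (\<lambda>t. det (H t))"
    unfolding H_def det_def by (intro continuous_intros)
  have ends: "det (H 0) = 1" "H 1 = G" by (simp_all add: H_def)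
  show ?thesis
  proof (rule ccontr)
    assume "\<not> 0 < det G"
    then have "\<exists>t\<ge>0. t \<le> 1 \<and> det (H t) = 0"
      using cont ends by (intro IVT2') auto
    then show False using nz by auto
  qed
qed

text \<open>Termwise in the Leibniz formula: a permutation fixing \<open>i\<close> meets the same
  entries on both sides, and any other one meets a zero on both sides. The left side is the
  numerator in Cramer's rule for \<open>axis i 1\<close>.\<close>

lemma det_replace_column_axis:
  fixes G :: "real^'k^'k"
  shows "det (\<chi> a b. if b = i then axis i 1 $ a else G $ a $ b) = det (drop_index i G)"
  unfolding det_def
proof (rule sum.cong[OF refl])
  fix p assume "p \<in> {p. p permutes (UNIV :: 'k set)}"
  then have p: "p permutes UNIV" by simp
  have "(\<Prod>a\<in>UNIV. (\<chi> a b. if b = i then axis i 1 $ a else G $ a $ b) $ a $ p a)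
      = (\<Prod>a\<in>UNIV. drop_index i G $ a $ p a)"
  proof (cases "p i = i")
    case True
    have "(\<chi> a b. if b = i then axis i 1 $ a else G $ a $ b) $ a $ p a = drop_index i G $ a $ p a" for a
      using True permutes_inj[OF p, THEN injD, of a i] by (auto simp: drop_index_def axis_def)
    then show ?thesis by simp
  next
    case False
    obtain a where a: "p a = i" using permutes_surj[OF p] by (metis surjD)
    then have "a \<noteq> i" using False by auto
    then have "(\<chi> a b. if b = i then axis i 1 $ a else G $ a $ b) $ a $ p a = 0"
      using a by (simp add: axis_def)
    moreover have "drop_index i G $ i $ p i = 0" using False by (simp add: drop_index_def)
    ultimately show ?thesis
      by (metis (no_types, lifting) UNIV_I finite prod_zero)
  qed
  then show "of_int (sign p) * (\<Prod>a\<in>UNIV. (\<chi> a b. if b = i then axis i 1 $ a else G $ a $ b) $ a $ p a)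
      = of_int (sign p) * (\<Prod>a\<in>UNIV. drop_index i G $ a $ p a)" by simp
qed

lemma inner_wrt_Cauchy_Schwarz:
  fixes B :: "real^'n^'n"
  assumes sym: "transpose B = B" and pos: "\<And>v. 0 \<le> inner_wrt B v v"
  shows "(inner_wrt B v w)\<^sup>2 \<le> inner_wrt B v v * inner_wrt B w w"
proof -
  have comm: "inner_wrt B w v = inner_wrt B v w" for v w
    unfolding inner_wrt_def by (metis sym dot_lmul_matrix inner_commute transpose_matrix_vector)
  have "0 \<le> inner_wrt B v v + 2 * t * inner_wrt B v w + t\<^sup>2 * inner_wrt B w w" for t
  proof -
    have "inner_wrt B (v + t *\<^sub>R w) (v + t *\<^sub>R w)
       = inner_wrt B v v + t * inner_wrt B v w + t * inner_wrt B w v + t\<^sup>2 * inner_wrt B w w"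
      by (simp add: inner_wrt_def algebra_simps matrix_vector_right_distrib matrix_vector_mult_scaleR power2_eq_square)
    then show ?thesis using pos[of "v + t *\<^sub>R w"] comm[of w v] by simp
  qed
  then have *: "0 \<le> inner_wrt B w w * t\<^sup>2 + (2 * inner_wrt B v w) * t + inner_wrt B v v" for t
    by (simp add: algebra_simps)
  \<comment> \<open>If the quadratic term vanished but not the linear one, the polynomial would take
    the value -1 at the chosen \<open>t\<close>.\<close>
  have "\<not> (inner_wrt B w w = 0 \<and> inner_wrt B v w \<noteq> 0)"
  proof
    assume A: "inner_wrt B w w = 0 \<and> inner_wrt B v w \<noteq> 0"
    show False
      using *[of "- (inner_wrt B v v + 1) / (2 * inner_wrt B v w)"] A by (simp add: field_simps)
  qed
  show ?thesis
  proof (cases "inner_wrt B w w = 0")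
    case True
    then show ?thesis using \<open>\<not> (_ \<and> _)\<close> by simp
  next
    case False
    then have w: "0 < inner_wrt B w w" using pos[of w] by simp
    show ?thesis
      using *[of "- inner_wrt B v w / inner_wrt B w w"] w
      by (simp add: field_simps power2_eq_square)
  qed
qed

lemma gram_quadratic_form:
  fixes B :: "real^'n^'n" and L :: "real^'k \<Rightarrow> real^'n"
  assumes L: "linear L"
    and G: "G = (\<chi> a b. inner_wrt B (L (axis a 1)) (L (axis b 1)))"
  shows "v \<bullet> (G *v v) = inner_wrt B (L v) (L v)"
proof -
  have expand: "L v = (\<Sum>j\<in>UNIV. v $ j *\<^sub>R L (axis j 1))" for v
  proof -
    have "L v = L (\<Sum>j\<in>UNIV. v $ j *\<^sub>R axis j 1)" using basis_expansion[of v] by (simp add: scalar_mult_eq_scaleR)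
    also have "\<dots> = (\<Sum>j\<in>UNIV. v $ j *\<^sub>R L (axis j 1))"
      by (simp add: linear_sum[OF L] linear_cmul[OF L])
    finally show ?thesis .
  qed
  show ?thesis
  proof -
    have "inner_wrt B (L v) (L v)
       = (\<Sum>p\<in>UNIV. \<Sum>q\<in>UNIV. v $ p * (v $ q * inner_wrt B (L (axis p 1)) (L (axis q 1))))"
      by (subst (1 2) expand)
         (simp add: inner_wrt_def inner_sum_left inner_sum_right sum_distrib_left
            linear_sum[OF matrix_vector_mul_linear] matrix_vector_mult_scaleR,
          subst sum.swap, simp add: mult.left_commute)
    also have "\<dots> = v \<bullet> (G *v v)"
      by (simp add: G inner_vec_def matrix_vector_mult_def sum_distrib_left mult_ac)
    finally show ?thesis by simp
  qed
qed

lemma gram_posdef: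
  fixes B :: "real^'n^'n" and L :: "real^'k \<Rightarrow> real^'n"
  assumes pos: "\<And>v. v \<noteq> 0 \<Longrightarrow> 0 < v \<bullet> (B *v v)" and L: "linear L" "inj L"
    and G: "G = (\<chi> a b. inner_wrt B (L (axis a 1)) (L (axis b 1)))" and "v \<noteq> 0"
  shows "0 < v \<bullet> (G *v v)"
proof -
  have "L v \<noteq> 0" using L \<open>v \<noteq> 0\<close> by (metis linear_0 injD)
  then show ?thesis unfolding gram_quadratic_form[OF L(1) G] inner_wrt_def by (rule pos)
qed

text \<open>Suppose that the covector \<open>d\<close> annihilates all columns of \<open>L\<close> except the \<open>i\<close>-th one. With
  \<open>b = G\<^sup>-\<^sup>1 e\<^sub>i\<close>, Cauchy-Schwarz for the dual vector of \<open>d\<close> and \<open>L b\<close> bounds \<open>d(L e\<^sub>i)\<close> in terms of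
  \<open>b $ i\<close>, which is a quotient of determinants by Cramer's rule.\<close>

lemma gram_minor_bound:
  fixes B :: "real^'n^'n" and L :: "real^'k \<Rightarrow> real^'n" and d :: "real^'n"
  assumes sym: "transpose B = B" and pos: "\<And>v. v \<noteq> 0 \<Longrightarrow> 0 < v \<bullet> (B *v v)"
    and L: "linear L" "inj L" and "0 < V"
    and V: "V = inner_wrt B (matrix_inv B *v d) (matrix_inv B *v d)"
    and G: "G = (\<chi> a b. inner_wrt B (L (axis a 1)) (L (axis b 1)))"
    and d: "\<And>j. j \<noteq> i \<Longrightarrow> d \<bullet> L (axis j 1) = 0"
  shows "0 < det (drop_index i ((1 / V) *\<^sub>R G))"
    "\<bar>d \<bullet> L (axis i 1)\<bar> * sqrt (det (drop_index i ((1 / V) *\<^sub>R G)))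
       \<le> V powr (1 - real CARD('k) / 2) * sqrt (det G)"
proof -
  define G' where "G' = (1 / V) *\<^sub>R G"
  define a where "a = d \<bullet> L (axis i 1)"
  have expand: "L v = (\<Sum>j\<in>UNIV. v $ j *\<^sub>R L (axis j 1))" for v
  proof -
    have "L v = L (\<Sum>j\<in>UNIV. v $ j *\<^sub>R axis j 1)" using basis_expansion[of v] by (simp add: scalar_mult_eq_scaleR)
    also have "\<dots> = (\<Sum>j\<in>UNIV. v $ j *\<^sub>R L (axis j 1))"
      by (simp add: linear_sum[OF L(1)] linear_cmul[OF L(1)])
    finally show ?thesis .
  qed
  note quad = gram_quadratic_form[OF L(1) G]
  note Gpos = gram_posdef[OF pos L G]
  have detG: "0 < det G" using Gpos by (rule det_pos_if_posdef)
  have G'quad: "v \<bullet> (G' *v v) = (v \<bullet> (G *v v)) / V" for v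
    by (simp add: G'_def flip: scaleR_matrix_vector_assoc)
  have detG': "0 < det G'"
    by (rule det_pos_if_posdef) (use Gpos \<open>0 < V\<close> in \<open>simp add: G'quad\<close>)
  define b where "b = (\<chi> k. det (\<chi> i' j. if j = k then axis i 1 $ i' else G' $ i' $ j) / det G')"
  have b: "G' *v b = axis i 1"
    using cramer[of G' b "axis i 1"] detG' by (simp add: b_def)
  have bi: "b $ i = det (drop_index i G') / det G'"
    using det_replace_column_axis[of i G'] by (simp add: b_def)
  have bq: "b \<bullet> (G' *v b) = b $ i" by (simp add: b inner_axis)
  have "b \<noteq> 0" using b by (auto simp: axis_eq_0_iff)
  then have bpos: "0 < b $ i" using Gpos[of b] \<open>0 < V\<close> unfolding bq[symmetric] G'quad by simp
  then show "0 < det (drop_index i ((1 / V) *\<^sub>R G))"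
    using bi detG' by (simp add: G'_def zero_less_divide_iff)
  have "invertible B"
    using det_pos_if_posdef[OF pos] by (simp add: invertible_det_nz)
  then have "B ** matrix_inv B = mat 1"
    unfolding invertible_def matrix_inv_def by (rule someI2_ex) blast
  then have B_inv: "B *v (matrix_inv B *v d) = d"
    by (simp add: matrix_vector_mul_assoc)
  have nonneg: "0 \<le> inner_wrt B v v" for v
    using pos[of v] by (cases "v = 0") (auto simp: inner_wrt_def)
  \<comment> \<open>Only the \<open>i\<close>-th column of \<open>L\<close> is seen by
    \<open>d\<close>, so the pairing with \<open>L b\<close> isolates the coordinate
    \<open>b $ i\<close>.\<close>
  have "d \<bullet> L b = (\<Sum>j\<in>UNIV. b $ j * (d \<bullet> L (axis j 1)))"
    by (subst expand) (simp add: inner_sum_right)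
  also have "\<dots> = (\<Sum>j\<in>{i}. b $ j * (d \<bullet> L (axis j 1)))"
    using d by (intro sum.mono_neutral_right) auto
  finally have dLb: "d \<bullet> L b = b $ i * a" by (simp add: a_def)
  \<comment> \<open>\<open>matrix_inv B *v d\<close> is the gradient dual to \<open>d\<close>, and
    \<open>V\<close> is its squared length. One factor \<open>b $ i\<close> cancels from the
    resulting inequality.\<close>
  have "(inner_wrt B (L b) (matrix_inv B *v d))\<^sup>2 \<le> inner_wrt B (L b) (L b) * V"
    unfolding V by (rule inner_wrt_Cauchy_Schwarz[OF sym nonneg])
  moreover have "inner_wrt B (L b) (matrix_inv B *v d) = b $ i * a"
    using dLb by (simp add: inner_wrt_def B_inv inner_commute)
  moreover have "inner_wrt B (L b) (L b) = V * b $ i"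
    using bq quad[of b] G'quad[of b] \<open>0 < V\<close> by (simp add: field_simps)
  ultimately have "b $ i * (b $ i * a\<^sup>2) \<le> b $ i * V\<^sup>2" by (simp add: power2_eq_square mult_ac)
  then have "b $ i * a\<^sup>2 \<le> V\<^sup>2" using bpos by simp
  then have "a\<^sup>2 * det (drop_index i G') \<le> V\<^sup>2 * det G'"
    using detG' by (simp add: bi field_simps)
  \<comment> \<open>The boundary minor belongs to the rescaled metric and the full determinant to
    the original one. Scaling a determinant of size \<open>k\<close> gives \<open>V ^ k\<close>, and
    the square root of \<open>V\<^sup>2 / V ^ k\<close> is the power in the claim.\<close>
  moreover have "det G' = det G / V ^ CARD('k)"
  proof -
    have "det G' = (1 / V) ^ CARD('k) * det G"
      by (simp add: G'_def det_def prod_dividef power_one_over sum_divide_distrib)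
    then show ?thesis by (simp add: power_one_over field_simps)
  qed
  ultimately have "a\<^sup>2 * det (drop_index i G') \<le> V\<^sup>2 / V ^ CARD('k) * det G" by simp
  then have "sqrt (a\<^sup>2 * det (drop_index i G')) \<le> sqrt (V\<^sup>2 / V ^ CARD('k) * det G)"
    by (rule real_sqrt_le_mono)
  then have "\<bar>a\<bar> * sqrt (det (drop_index i G')) \<le> sqrt (V\<^sup>2 / V ^ CARD('k)) * sqrt (det G)"
    by (simp only: real_sqrt_mult real_sqrt_abs)
  moreover have "sqrt (V\<^sup>2 / V ^ CARD('k)) = V powr (1 - real CARD('k) / 2)"
  proof -
    have "V\<^sup>2 / V ^ CARD('k) = V powr (2 - real CARD('k))"
      using \<open>0 < V\<close> powr_realpow[of V 2] powr_realpow[of V "CARD('k)"] by (simp add: powr_diff)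
    then have "sqrt (V\<^sup>2 / V ^ CARD('k)) = V powr ((2 - real CARD('k)) * (1 / 2))"
      using \<open>0 < V\<close> by (simp add: powr_powr flip: powr_half_sqrt)
    also have "(2 - real CARD('k)) * (1 / 2) = 1 - real CARD('k) / 2" by (simp add: field_simps)
    finally show ?thesis .
  qed
  ultimately show "\<bar>d \<bullet> L (axis i 1)\<bar> * sqrt (det (drop_index i ((1 / V) *\<^sub>R G)))
       \<le> V powr (1 - real CARD('k) / 2) * sqrt (det G)"
    by (simp only: a_def G'_def)
qed

section \<open>Slicing Lebesgue measure along a coordinate\<close>

lemma borel_measurable_vec_lambda:
  fixes f :: "'a \<Rightarrow> 'k::finite \<Rightarrow> real"
  assumes "\<And>j. (\<lambda>x. f x j) \<in> borel_measurable M"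
  shows "(\<lambda>x. \<chi> j. f x j) \<in> borel_measurable M"
  by (rule borel_measurable_euclidean_space[THEN iffD2]) (auto simp: Basis_vec_def inner_axis assms)

lemma vec_lambda_measurable_PiM [measurable]:
  "vec_lambda \<in> borel_measurable (\<Pi>\<^sub>M j\<in>(UNIV::'k::finite set). (lborel :: real measure))"
proof -
  have "(\<lambda>x. x j) \<in> borel_measurable (\<Pi>\<^sub>M j\<in>UNIV. lborel)" for j :: 'k
    by simp
  from borel_measurable_vec_lambda[of "\<lambda>x. x", OF this] show ?thesis by simp
qed

text \<open>Lebesgue measure is determined by the volumes of boxes, which are products of side
  lengths. In product form a single coordinate can be split off.\<close>

lemma lborel_vec_eq_distr_PiM:
  "(lborel :: (real^'k::finite) measure) = distr (\<Pi>\<^sub>M j\<in>UNIV. lborel) borel (\<lambda>x. \<chi> j. x j)"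
proof (rule lborel_eqI)
  interpret product_sigma_finite "\<lambda>_::'k. lborel :: real measure" ..
  fix l u :: "real^'k"
  assume le: "\<And>b. b \<in> Basis \<Longrightarrow> l \<bullet> b \<le> u \<bullet> b"
  have le': "l $ j \<le> u $ j" for j using le[of "axis j 1"] by (simp add: inner_axis)
  have "(\<lambda>x. \<chi> j. x j) -` box l u \<inter> space (\<Pi>\<^sub>M j\<in>(UNIV::'k set). lborel)
      = (\<Pi>\<^sub>E j\<in>UNIV. {l $ j <..< u $ j})"
    by (auto simp: space_PiM mem_box_cart PiE_iff)
  then have "emeasure (distr (\<Pi>\<^sub>M j\<in>(UNIV::'k set). lborel) borel (\<lambda>x. \<chi> j. x j)) (box l u)
     = (\<Prod>j\<in>UNIV. emeasure lborel {l $ j <..< u $ j})"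
    by (simp add: emeasure_distr emeasure_PiM)
  also have "\<dots> = ennreal (\<Prod>j\<in>UNIV. u $ j - l $ j)"
    using le' by (simp add: prod_ennreal)
  also have "(\<Prod>j\<in>UNIV. u $ j - l $ j) = (\<Prod>b\<in>Basis. (u - l) \<bullet> b)"
  proof -
    have "Basis = range (\<lambda>j::'k. axis j (1::real))" by (auto simp: Basis_vec_def)
    show ?thesis
      unfolding \<open>Basis = _\<close> by (subst prod.reindex) (auto simp: inj_on_def axis_eq_axis inner_axis)
  qed
  finally show "emeasure (distr (\<Pi>\<^sub>M j\<in>UNIV. lborel) borel (\<lambda>x. \<chi> j. x j)) (box l u)
      = ennreal (\<Prod>b\<in>Basis. (u - l) \<bullet> b)" .
qed simp

lemma nn_integral_lborel_hyperplane_measure: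
  fixes f :: "real^'k::finite \<Rightarrow> ennreal"
  assumes [measurable]: "f \<in> borel_measurable borel"
  shows "(\<integral>\<^sup>+x. f x \<partial>lborel)
       = (\<integral>\<^sup>+y. \<integral>\<^sup>+s. f (y + s *\<^sub>R axis i 1) \<partial>lborel \<partial>hyperplane_measure i)"
proof -
  interpret product_sigma_finite "\<lambda>_::'k. lborel :: real measure" ..
  have [measurable]: "(\<lambda>y. \<chi> j. if j = i then 0 else y j) \<in> borel_measurable (\<Pi>\<^sub>M j\<in>UNIV - {i}. (lborel :: real measure))"
  proof (rule borel_measurable_vec_lambda[where f="\<lambda>y j. if j = i then 0 else y j"])
    show "(\<lambda>y. if j = i then 0 else y j) \<in> borel_measurable (\<Pi>\<^sub>M j\<in>UNIV - {i}. (lborel :: real measure))" for j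
      using measurable_component_singleton[of j "UNIV - {i}" "\<lambda>_. lborel :: real measure"]
      by (cases "j = i") simp_all
  qed
  have [measurable]: "(\<lambda>p. f (fst p + snd p *\<^sub>R axis i 1)) \<in> borel_measurable (borel \<Otimes>\<^sub>M lborel)"
    by measurable
  have "(\<integral>\<^sup>+x. f x \<partial>lborel) = (\<integral>\<^sup>+x. f (\<chi> j. x j) \<partial>(\<Pi>\<^sub>M j\<in>insert i (UNIV - {i}). lborel))"
    by (subst lborel_vec_eq_distr_PiM) (simp add: nn_integral_distr insert_absorb)
  also have "\<dots> = (\<integral>\<^sup>+y. \<integral>\<^sup>+s. f (\<chi> j. (y(i := s)) j) \<partial>lborel \<partial>(\<Pi>\<^sub>M j\<in>UNIV - {i}. lborel))"
    by (rule product_nn_integral_insert) (auto simp: insert_absorb)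
  also have "\<dots> = (\<integral>\<^sup>+y. \<integral>\<^sup>+s. f ((\<chi> j. if j = i then 0 else y j) + s *\<^sub>R axis i 1) \<partial>lborel
      \<partial>(\<Pi>\<^sub>M j\<in>UNIV - {i}. lborel))"
    by (intro nn_integral_cong arg_cong[where f=f]) (auto simp: vec_eq_iff axis_def)
  also have "\<dots> = (\<integral>\<^sup>+y. \<integral>\<^sup>+s. f (y + s *\<^sub>R axis i 1) \<partial>lborel \<partial>hyperplane_measure i)"
    unfolding hyperplane_measure_def
    by (subst nn_integral_distr) auto
  finally show ?thesis .
qed

section \<open>Volume of a submanifold near its initial boundary\<close>

text \<open>An upper bound on the upward speed of a path bounds from below the time that it spends in any
  set of levels it has to cross.\<close>

lemma emeasure_le_crossing_time:
  fixes f :: "real \<Rightarrow> real"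
  assumes cont: "continuous_on {0..r} f" and "0 \<le> r" and f0: "f 0 = u" and "0 < \<delta>"
    and reach: "\<exists>s\<in>{0..r}. u + \<delta> \<le> f s"
    and "0 \<le> L" and speed: "\<And>x y. 0 \<le> x \<Longrightarrow> x \<le> y \<Longrightarrow> y \<le> r \<Longrightarrow> f y - f x \<le> L * (y - x)"
    and J: "J \<in> sets borel" "J \<subseteq> {u<..<u + \<delta>}"
  shows "emeasure lborel J \<le> ennreal L * emeasure lborel {s\<in>{0..r}. f s \<in> J}"
proof -
  define f' where "f' s = (if s \<in> {0..r} then f s else u - 1)" for s
  have f'[measurable]: "f' \<in> borel_measurable borel"
    unfolding f'_def using cont by (intro borel_measurable_continuous_on_if) auto
  \<comment> \<open>\<open>M\<close> is \<open>L\<close> times the time spent in a set of levels,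
    and \<open>N\<close> is Lebesgue measure on the levels to be crossed. It suffices to compare
    them on intervals.\<close>
  define M where "M = distr (density lborel (\<lambda>s. ennreal L * indicator {0..r} s)) borel f'"
  define N where "N = density lborel (indicator {u<..<u+\<delta>} :: real \<Rightarrow> ennreal)"
  have sM: "sets M = sets borel" "sets N = sets borel" by (simp_all add: M_def N_def)
  have pre_meas: "{s\<in>{0..r}. f s \<in> X} \<in> sets borel" if "X \<in> sets borel" for X
  proof -
    have "{s\<in>{0..r}. f s \<in> X} = {0..r} \<inter> (f' -` X)" by (auto simp: f'_def)
    then show ?thesis using measurable_sets[OF f' that] by simp
  qed
  have M: "emeasure M X = ennreal L * emeasure lborel {s\<in>{0..r}. f s \<in> X}" if X[measurable]: "X \<in> sets borel" for X
  proof -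
    have "emeasure M X = (\<integral>\<^sup>+s. ennreal L * indicator {0..r} s * indicator (f' -` X) s \<partial>lborel)"
      unfolding M_def using measurable_sets[OF f' X] by (simp add: emeasure_distr emeasure_density)
    also have "\<dots> = (\<integral>\<^sup>+s. ennreal L * indicator {s\<in>{0..r}. f s \<in> X} s \<partial>lborel)"
      by (intro nn_integral_cong) (auto simp: indicator_def f'_def)
    also have "\<dots> = ennreal L * emeasure lborel {s\<in>{0..r}. f s \<in> X}"
      using pre_meas[OF X] by (intro nn_integral_cmult_indicator) auto
    finally show ?thesis .
  qed
  have N: "emeasure N X = emeasure lborel ({u<..<u+\<delta>} \<inter> X)" if "X \<in> sets borel" for X
    unfolding N_def using that by (simp add: emeasure_density flip: indicator_inter_arith)
  have Ioc_borel: "{a<..b} \<in> sets borel" for a b :: real by simp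
  have pre_le: "emeasure lborel {s\<in>{0..r}. f s \<in> X} \<le> ennreal r" for X
  proof -
    have "emeasure lborel {s\<in>{0..r}. f s \<in> X} \<le> emeasure lborel {0..r}"
      by (rule emeasure_mono) auto
    then show ?thesis using \<open>0 \<le> r\<close> by simp
  qed
  have "emeasure N J \<le> emeasure M J"
  proof (rule emeasure_mono_borel_realI[OF _ _ sM _ J(1)])
    show "finite_measure M"
    proof (rule finite_measureI)
      have "emeasure M UNIV < \<infinity>"
        using pre_le[of UNIV] by (simp add: M ennreal_mult_less_top le_less_trans[OF _ ennreal_less_top])
      then show "emeasure M (space M) \<noteq> \<infinity>" by (simp add: M_def)
    qed
    show "finite_measure N"
    proof (rule finite_measureI)
      show "emeasure N (space N) \<noteq> \<infinity>"
        using N[of UNIV] \<open>0 < \<delta>\<close> by (simp add: sets_eq_imp_space_eq[OF sM(2)])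
    qed
    fix a b :: real assume "a \<le> b"
    define a' b' where "a' = max a u" and "b' = min b (u + \<delta>)"
    have "emeasure N {a<..b} \<le> emeasure M {a<..b}"
    proof (cases "a' < b'")
      case False
      then have "{u<..<u+\<delta>} \<inter> {a<..b} = {}" by (auto simp: a'_def b'_def)
      then show ?thesis using N[of "{a<..b}"] by simp
    next
      case True
      have comp: "compact ({0..t} \<inter> f -` C)" if "t \<le> r" "closed C" for t C
        by (rule closedin_compact[OF compact_Icc continuous_closedin_preimage[OF continuous_on_subset[OF cont] that(2)]])
          (use that in auto)
      \<comment> \<open>\<open>s2\<close> is the first time at which \<open>b'\<close> is reached
        and \<open>s1\<close> the last time before it with value at most \<open>a'\<close>. In
        between, the path stays strictly between the two levels, and the speed bound makes this
        passage last at least \<open>(b' - a') / L\<close> when \<open>L > 0\<close>.\<close>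
      obtain s2 where s2: "s2 \<in> {0..r}" "b' \<le> f s2" "\<And>s. s \<in> {0..r} \<Longrightarrow> b' \<le> f s \<Longrightarrow> s2 \<le> s"
      proof -
        have "{0..r} \<inter> f -` {b'..} \<noteq> {}" using reach by (force simp: b'_def)
        from compact_attains_inf[OF comp[OF order_refl closed_atLeast] this] show ?thesis
          using that by auto
      qed
      obtain s1 where s1: "s1 \<in> {0..s2}" "f s1 \<le> a'" "\<And>s. s \<in> {0..s2} \<Longrightarrow> f s \<le> a' \<Longrightarrow> s \<le> s1"
      proof -
        have "0 \<in> {0..s2} \<inter> f -` {..a'}" using s2 f0 by (auto simp: a'_def)
        then have "{0..s2} \<inter> f -` {..a'} \<noteq> {}" by blast
        from compact_attains_sup[OF comp[OF _ closed_atMost] this] show ?thesis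
          using that s2(1) by auto
      qed
      have "b' - a' \<le> L * (s2 - s1)" using speed[of s1 s2] s1 s2 by auto
      then have "ennreal (b' - a') \<le> ennreal L * ennreal (s2 - s1)"
        using \<open>0 \<le> L\<close> s1(1) by (simp flip: ennreal_mult)
      also have "ennreal (s2 - s1) = emeasure lborel {s1<..<s2}" using s1(1) by simp
      also have "\<dots> \<le> emeasure lborel {s\<in>{0..r}. f s \<in> {a<..b}}"
      proof (rule emeasure_mono)
        show "{s1<..<s2} \<subseteq> {s\<in>{0..r}. f s \<in> {a<..b}}"
        proof
          fix s assume s: "s \<in> {s1<..<s2}"
          have "\<not> b' \<le> f s" using s2(1) s2(3)[of s] s1(1) s by auto
          moreover have "\<not> f s \<le> a'" using s1(1) s1(3)[of s] s by auto
          ultimately show "s \<in> {s\<in>{0..r}. f s \<in> {a<..b}}"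
            using s s1(1) s2(1) by (auto simp: a'_def b'_def)
        qed
      qed (use pre_meas[of "{a<..b}"] in auto)
      finally have "ennreal (b' - a') \<le> emeasure M {a<..b}" by (simp add: M mult_left_mono)
      moreover have "emeasure N {a<..b} \<le> emeasure lborel {a'<..b'}"
        unfolding N[OF Ioc_borel] by (rule emeasure_mono) (auto simp: a'_def b'_def)
      ultimately show ?thesis using True by simp
    qed
    then show "measure N {a<..b} \<le> measure M {a<..b}"
      unfolding measure_def using pre_le[of "{a<..b}"]
      by (intro enn2real_mono)
         (simp_all add: M ennreal_mult_less_top le_less_trans[OF _ ennreal_less_top])
  qed
  moreover have "emeasure N J = emeasure lborel J"
    using J by (simp add: N Int_absorb1)
  ultimately show ?thesis using M[OF J(1)] by simp
qed

text \<open>The tube lemma: an open condition that holds at \<open>s = 0\<close> over a compact set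
  persists for a time independent of the point.\<close>

lemma uniform_tube:
  fixes E :: "'a::euclidean_space set"
  assumes "compact E" "0 < r0" and cont: "continuous_on (E \<times> {0..r0}) f" and "open O'"
    and f0: "\<And>x. x \<in> E \<Longrightarrow> f (x, 0::real) \<in> O'"
  obtains r where "0 < r" "r \<le> r0" "\<And>x s. x \<in> E \<Longrightarrow> 0 \<le> s \<Longrightarrow> s \<le> r \<Longrightarrow> f (x, s) \<in> O'"
proof -
  have "openin (top_of_set (E \<times> {0..r0})) (E \<times> {0..r0} \<inter> f -` O')"
    by (rule continuous_openin_preimage_gen[OF cont \<open>open O'\<close>])
  then obtain Q where Q: "open Q" "E \<times> {0..r0} \<inter> f -` O' = E \<times> {0..r0} \<inter> Q"
    unfolding openin_open by blast
  have "E \<times> {0} \<subseteq> Q"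
  proof
    fix z assume "z \<in> E \<times> {0::real}"
    then have "z \<in> E \<times> {0..r0} \<inter> f -` O'" using f0 \<open>0 < r0\<close> by auto
    then show "z \<in> Q" using Q(2) by blast
  qed
  moreover have "compact (E \<times> {0::real})" using \<open>compact E\<close> by (simp add: compact_Times)
  ultimately obtain e where e: "0 < e" "(\<Union>x\<in>E \<times> {0}. ball x e) \<subseteq> Q"
    using compact_subset_open_imp_ball_epsilon_subset[OF _ Q(1)] by metis
  show ?thesis
  proof (rule that[of "min r0 (e / 2)"])
    fix x s assume xs: "x \<in> E" "0 \<le> s" "s \<le> min r0 (e / 2)"
    have "(x, s) \<in> ball (x, 0) e" using xs e(1) by (simp add: dist_Pair_Pair dist_real_def)
    then have "(x, s) \<in> (\<Union>x\<in>E \<times> {0}. ball x e)" using xs(1) by (intro UN_I[of "(x, 0)"]) auto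
    with e(2) have "(x, s) \<in> Q" by (rule subsetD)
    then have "(x, s) \<in> E \<times> {0..r0} \<inter> Q" using xs by auto
    then show "f (x, s) \<in> O'" using Q(2) by blast
  qed (use e \<open>0 < r0\<close> in auto)
qed

text \<open>At a boundary point only directions into the half-space are available. Small positive
  multiples of the basis vectors stay in \<open>U\<close>, which suffices for uniqueness of the
  derivative within \<open>U\<close>.\<close>

lemma frechet_derivative_eq_within_halfspace:
  fixes f F :: "real^'k::finite \<Rightarrow> 'b::real_normed_vector"
  assumes U: "openin (top_of_set {x. 0 \<le> x $ i}) U" and W: "open W" and x: "x \<in> U \<inter> W"
    and eq: "\<And>y. y \<in> U \<inter> W \<Longrightarrow> F y = f y"
    and F: "(F has_derivative F') (at x)"
  shows "frechet_derivative f (at x within U) = F'"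
proof -
  obtain e where e: "0 < e" "ball x e \<subseteq> W" using W x openE by blast
  have "(F has_derivative F') (at x within U)" using F by (rule has_derivative_at_withinI)
  then have f: "(f has_derivative F') (at x within U)"
    by (rule has_derivative_transform_within[OF _ e(1)]) (use x e(2) eq in \<open>auto simp: dist_commute subset_iff\<close>)
  then have "(f has_derivative frechet_derivative f (at x within U)) (at x within U)"
    using frechet_derivative_works differentiableI by blast
  then show ?thesis
  proof (rule frechet_derivative_unique_within[OF _ f])
    fix b :: "real^'k" and e' :: real assume b: "b \<in> Basis" "0 < e'"
    obtain O' where O': "open O'" "U = {x. 0 \<le> x $ i} \<inter> O'" using U by (auto simp: openin_open)
    then obtain d where d: "0 < d" "ball x d \<subseteq> O'" using x openE by blast
    define t where "t = min e' d / 2"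
    have t: "0 < t" "t < e'" "t < d" using b d by (auto simp: t_def)
    have "0 \<le> b $ i" using b(1) by (auto simp: Basis_vec_def axis_def)
    moreover have "0 \<le> x $ i" using x O' by auto
    moreover have "x + t *\<^sub>R b \<in> ball x d" using t b(1) by (simp add: dist_norm)
    ultimately have "x + t *\<^sub>R b \<in> U" using O' d t by auto
    then show "\<exists>d. 0 < \<bar>d\<bar> \<and> \<bar>d\<bar> < e' \<and> x + d *\<^sub>R b \<in> U" using t by (intro exI[of _ t]) auto
  qed
qed

lemma frechet_derivative_eq_inner:
  fixes f :: "real^'n::finite \<Rightarrow> real"
  assumes "f differentiable (at u)"
  shows "frechet_derivative f (at u) v = (\<chi> j. partial j f u) \<bullet> v"
proof -
  have lin: "linear (frechet_derivative f (at u))"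
    using assms frechet_derivative_works has_derivative_linear by blast
  have "frechet_derivative f (at u) v = frechet_derivative f (at u) (\<Sum>j\<in>UNIV. v $ j *\<^sub>R axis j 1)"
    using basis_expansion[of v] by (simp add: scalar_mult_eq_scaleR)
  also have "\<dots> = (\<Sum>j\<in>UNIV. v $ j * partial j f u)"
    by (simp add: linear_sum[OF lin] linear_cmul[OF lin] partial_def)
  finally show ?thesis by (simp add: inner_vec_def mult.commute)
qed

section \<open>Submanifolds above the starting level\<close>

locale level_setting =
  fixes M S :: "'m::{t2_space,second_countable_topology} set"
    and A :: "('m, 'n::finite) chart set" and g :: "('m, 'n) metric"
    and h :: "'m \<Rightarrow> real" and V :: "real \<Rightarrow> real" and h0 :: real
    and \<mu> \<beta> :: "'m measure" and k :: "'k::finite itself"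
  assumes riemannian: "riemannian_manifold M A g"
    and h_C2: "C2_function A h"
    and V_eq: "\<forall>c\<in>A. \<forall>u\<in>chart_image c. V (h (chart_inv c u)) = (norm_wrt (g c u) (gradient g h c u))\<^sup>2"
    and submfd: "submanifold k M A S"
    and S_above: "\<forall>p\<in>S. h0 \<le> h p"
    and \<mu>: "volume_measure k A g S \<mu>"
    and \<beta>: "boundary_volume_measure k A (rescaled_metric h V g) S \<beta>"
    and \<mu>_slice: "emeasure \<mu> (initial_slice h h0 S) = 0"
begin

lemma
  assumes "c \<in> A"
  shows open_chart: "open (fst c)" and open_chart_image: "open (chart_image c)"
    and continuous_chart: "continuous_on (fst c) (snd c)"
    and chart_inv_chart: "p \<in> fst c \<Longrightarrow> chart_inv c (snd c p) = p"
  using riemannian assms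
  by (auto simp: riemannian_manifold_def smooth_atlas_def homeomorphism_def)

lemma chart_cover: "(\<Union>c\<in>A. fst c) = M"
  using riemannian by (auto simp: riemannian_manifold_def smooth_atlas_def)

lemma chart_mem_image: "p \<in> fst c \<Longrightarrow> snd c p \<in> chart_image c"
  by (simp add: chart_image_def)

lemma open_M: "open M"
  unfolding chart_cover[symmetric] by (rule open_UN) (use open_chart in blast)

lemma S_subset_M: "S \<subseteq> M"
  using submfd by (simp add: submanifold_def)

lemma continuous_metric: "c \<in> A \<Longrightarrow> continuous_on (chart_image c) (g c)"
  using riemannian unfolding riemannian_manifold_def riemannian_metric_def smooth_on_def
  by (metis Ck_on.simps(1))

lemma
  assumes "c \<in> A" "u \<in> chart_image c"
  shows metric_sym: "transpose (g c u) = g c u"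
    and metric_pos: "v \<noteq> 0 \<Longrightarrow> 0 < v \<bullet> (g c u *v v)"
  using riemannian assms by (auto simp: riemannian_manifold_def riemannian_metric_def)

lemma
  assumes "c \<in> A"
  shows differentiable_h_chart: "u \<in> chart_image c \<Longrightarrow> (h \<circ> chart_inv c) differentiable (at u)"
    and continuous_coord_differential: "continuous_on (chart_image c) (coord_differential h c)"
proof -
  have C2: "Ck_on 2 (h \<circ> chart_inv c) (chart_image c)"
    using h_C2 assms by (simp add: C2_function_def)
  then show "u \<in> chart_image c \<Longrightarrow> (h \<circ> chart_inv c) differentiable (at u)"
    by (simp add: numeral_2_eq_2)
  have "continuous_on (chart_image c) (partial j (h \<circ> chart_inv c))" for j
  proof -
    have "(partial j (h \<circ> chart_inv c)) differentiable (at u)" if "u \<in> chart_image c" for u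
      using C2 that by (auto simp: numeral_2_eq_2 partial_def[abs_def])
    then show ?thesis
      by (intro continuous_at_imp_continuous_on ballI differentiable_imp_continuous_within)
  qed
  then show "continuous_on (chart_image c) (coord_differential h c)"
    unfolding coord_differential_def by (intro continuous_on_vec_lambda)
qed

lemma continuous_h_chart: "c \<in> A \<Longrightarrow> continuous_on (chart_image c) (h \<circ> chart_inv c)"
  using differentiable_h_chart
  by (intro continuous_at_imp_continuous_on ballI differentiable_imp_continuous_within) auto

lemma continuous_on_h: "continuous_on M h"
  unfolding chart_cover[symmetric]
proof (rule continuous_on_open_UN)
  fix c assume c: "c \<in> A"
  then show "open (fst c)" by (rule open_chart)
  have "continuous_on (fst c) ((h \<circ> chart_inv c) \<circ> snd c)"
    using c by (intro continuous_on_compose continuous_chart continuous_on_subset[OF continuous_h_chart])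
      (auto simp: chart_image_def)
  then show "continuous_on (fst c) h"
    by (rule continuous_on_eq) (simp add: chart_inv_chart[OF c])
qed

lemma
  shows space_\<mu>: "space \<mu> = S" and sets_\<mu>: "sets \<mu> = sets (restrict_space borel S)"
    and space_\<beta>: "space \<beta> = manifold_boundary k A S"
    and sets_\<beta>: "sets \<beta> = sets (restrict_space borel (manifold_boundary k A S))"
  using \<mu> \<beta> by (simp_all add: volume_measure_def boundary_volume_measure_def)

lemma sets_\<mu>I: "B \<in> sets borel \<Longrightarrow> S \<inter> B \<in> sets \<mu>"
  unfolding sets_\<mu> sets_restrict_space by blast

lemma sets_\<beta>I: "B \<in> sets borel \<Longrightarrow> manifold_boundary k A S \<inter> B \<in> sets \<beta>"
  unfolding sets_\<beta> sets_restrict_space by blast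

lemma level_set_borel:
  assumes "J \<in> sets borel"
  shows "M \<inter> h -` J \<in> sets borel"
proof -
  have "h \<in> borel_measurable (restrict_space borel M)"
    by (rule borel_measurable_continuous_on_restrict[OF continuous_on_h])
  from measurable_sets[OF this assms] show ?thesis
    using open_M by (auto simp: space_restrict_space sets_restrict_space_iff Int_commute)
qed

lemma level_set_\<mu>:
  assumes "J \<in> sets borel" "open O'"
  shows "{p \<in> S \<inter> O'. h p \<in> J} \<in> sets \<mu>"
proof -
  have "{p \<in> S \<inter> O'. h p \<in> J} = S \<inter> (O' \<inter> (M \<inter> h -` J))" using S_subset_M by auto
  then show ?thesis
    using sets_\<mu>I[of "O' \<inter> (M \<inter> h -` J)"] level_set_borel[OF assms(1)] assms(2) by auto
qed

end

text \<open>One parametrization read in one chart. \<open>F\<close> is a $C^1$ extension of the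
  coordinate expression across the hyperplane, and \<open>UW\<close> says that within
  \<open>W\<close> nothing of the half-space is missing from \<open>U\<close>, so that lines going
  inward from the hyperplane remain in \<open>U\<close> as long as they remain in
  \<open>W\<close>.\<close>

locale level_patch = level_setting M S A g h V h0 \<mu> \<beta> k
  for M S :: "'m::{t2_space,second_countable_topology} set"
    and A :: "('m, 'n::finite) chart set" and g :: "('m, 'n) metric"
    and h :: "'m \<Rightarrow> real" and V :: "real \<Rightarrow> real" and h0 :: real
    and \<mu> \<beta> :: "'m measure" and k :: "'k::finite itself" +
  fixes i :: 'k and U :: "(real^'k) set" and \<phi> :: "real^'k \<Rightarrow> 'm" and c :: "('m, 'n) chart"
    and F :: "real^'k \<Rightarrow> real^'n" and W :: "(real^'k) set"
  assumes V0: "0 < V h0"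
    and param: "local_param A S i U \<phi>"
    and c: "c \<in> A" and W: "open W" and UW: "U \<inter> W = {x. 0 \<le> x $ i} \<inter> W"
    and \<phi>_chart: "\<phi> ` (U \<inter> W) \<subseteq> fst c"
    and F_C1: "Ck_on 1 F W" and F_eq: "\<And>y. y \<in> U \<inter> W \<Longrightarrow> F y = snd c (\<phi> y)"
begin

text \<open>\<open>D\<close> is the volume density of \<open>S\<close>, and \<open>slope j\<close>
  the derivative of \<open>h\<close> along the \<open>j\<close>-th coordinate. In \<open>q\<close>
  the factor \<open>V\<close> is frozen at \<open>h0\<close>: it is the density of the rescaled
  boundary volume at hyperplane points of level \<open>h0\<close>, yet continuous on the whole
  patch.\<close>

definition "DF y = frechet_derivative F (at y)"
definition "G y = (\<chi> a b. inner_wrt (g c (F y)) (DF y (axis a 1)) (DF y (axis b 1)))"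
definition "D y = sqrt (det (G y))"
definition "slope j y = coord_differential h c (F y) \<bullet> DF y (axis j 1)"
definition "q y = sqrt (det (drop_index i ((1 / V h0) *\<^sub>R G y)))"

lemma openin_U: "openin (top_of_set {x. 0 \<le> x $ i}) U"
  and \<phi>_S: "\<phi> ` U \<subseteq> S" and continuous_\<phi>: "continuous_on U \<phi>"
proof -
  have "openin (top_of_set S) (\<phi> ` U)" "homeomorphism U (\<phi> ` U) \<phi> (inv_into U \<phi>)"
    using param by (simp_all add: local_param_def)
  then show "\<phi> ` U \<subseteq> S" "continuous_on U \<phi>"
    by (auto simp: openin_subset homeomorphism_def dest: openin_imp_subset)
  show "openin (top_of_set {x. 0 \<le> x $ i}) U" using param by (simp add: local_param_def)
qed

lemma F_deriv: "y \<in> W \<Longrightarrow> (F has_derivative DF y) (at y)"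
  using F_C1 frechet_derivative_works by (auto simp: DF_def)

lemma continuous_DF: "continuous_on W (\<lambda>y. DF y (axis a 1))"
  using F_C1 by (simp add: DF_def)

lemma continuous_F: "continuous_on W F"
  using F_deriv by (meson W continuous_at_imp_continuous_on has_derivative_continuous)

lemma F_image: "y \<in> U \<inter> W \<Longrightarrow> F y \<in> chart_image c"
  using \<phi>_chart by (auto simp: F_eq intro!: chart_mem_image)

lemma chart_inv_F: "y \<in> U \<inter> W \<Longrightarrow> chart_inv c (F y) = \<phi> y"
  using \<phi>_chart by (auto simp: F_eq chart_inv_chart[OF c])

lemma param_deriv_eq:
  assumes "y \<in> U \<inter> W"
  shows "param_deriv c U \<phi> y = DF y"
  unfolding param_deriv_def
  by (rule frechet_derivative_eq_within_halfspace[OF openin_U W assms, of F])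
     (use assms F_eq F_deriv in auto)

text \<open>The definition of a parametrization provides an immersive extension that depends on the
  point. Uniqueness of the derivative within \<open>U\<close> transfers its injectivity to
  \<open>F\<close>.\<close>

lemma
  assumes "y \<in> U \<inter> W"
  shows linear_DF: "linear (DF y)" and inj_DF: "inj (DF y)"
proof -
  show "linear (DF y)" using F_deriv[of y] assms has_derivative_linear by blast
  obtain W' F' where W': "open W'" "y \<in> W'" "\<phi> ` (U \<inter> W') \<subseteq> fst c" "Ck_on 1 F' W'"
    "\<forall>z\<in>U \<inter> W'. F' z = snd c (\<phi> z)" "inj (frechet_derivative F' (at y))"
    using param c assms \<phi>_chart unfolding local_param_def by blast
  have "(F' has_derivative frechet_derivative F' (at y)) (at y)"
    using W'(2,4) frechet_derivative_works[of F' "at y"] by auto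
  then have "param_deriv c U \<phi> y = frechet_derivative F' (at y)"
    unfolding param_deriv_def using assms W'
    by (intro frechet_derivative_eq_within_halfspace[OF openin_U W'(1), of _ F']) auto
  then show "inj (DF y)" using W'(6) param_deriv_eq[OF assms] by simp
qed

lemma gram_eq: "y \<in> U \<inter> W \<Longrightarrow> gram_matrix g c U \<phi> y = G y"
  by (simp add: gram_matrix_def G_def param_deriv_eq F_eq)

lemma rescaled_gram_eq:
  assumes "y \<in> U \<inter> W" "h (\<phi> y) = h0"
  shows "gram_matrix (rescaled_metric h V g) c U \<phi> y = (1 / V h0) *\<^sub>R G y"
  using assms chart_inv_F[OF assms(1)]
  by (simp add: gram_matrix_def G_def param_deriv_eq rescaled_metric_def inner_wrt_def vec_eq_iff
      flip: F_eq scaleR_matrix_vector_assoc)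

lemma continuous_G: "continuous_on (U \<inter> W) G"
proof -
  have "continuous_on (U \<inter> W) (\<lambda>y. g c (F y))"
    by (rule continuous_on_compose2[OF continuous_metric[OF c] continuous_on_subset[OF continuous_F]])
       (use F_image in auto)
  moreover have "continuous_on (U \<inter> W) (\<lambda>y. DF y (axis a 1))" for a
    by (rule continuous_on_subset[OF continuous_DF]) auto
  ultimately show ?thesis
    unfolding G_def inner_wrt_def matrix_vector_mult_def
    by (intro continuous_on_vec_lambda continuous_intros) auto
qed

lemma continuous_D: "continuous_on (U \<inter> W) D"
  unfolding D_def det_def by (intro continuous_intros continuous_G)

lemma continuous_q: "continuous_on (U \<inter> W) q"
proof -
  have "continuous_on (U \<inter> W) (\<lambda>y. drop_index i ((1 / V h0) *\<^sub>R G y) $ a $ b)" for a b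
    unfolding drop_index_def by (cases "a = i \<or> b = i") (use V0 in \<open>auto intro!: continuous_intros continuous_G\<close>)
  then show ?thesis unfolding q_def det_def
    by (intro continuous_on_real_sqrt continuous_on_sum continuous_on_mult continuous_on_const continuous_on_prod)
qed

lemma continuous_slope: "continuous_on (U \<inter> W) (slope j)"
proof -
  have "continuous_on (U \<inter> W) (\<lambda>y. coord_differential h c (F y))"
    by (rule continuous_on_compose2[OF continuous_coord_differential[OF c] continuous_on_subset[OF continuous_F]])
       (use F_image in auto)
  moreover have "continuous_on (U \<inter> W) (\<lambda>y. DF y (axis j 1))"
    by (rule continuous_on_subset[OF continuous_DF]) auto
  ultimately show ?thesis unfolding slope_def by (intro continuous_intros)
qed

lemma continuous_h_\<phi>: "continuous_on (U \<inter> W) (\<lambda>y. h (\<phi> y))"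
  by (rule continuous_on_compose2[OF continuous_on_h continuous_on_subset[OF continuous_\<phi>]])
     (use \<phi>_S S_subset_M in auto)

text \<open>Differentiating along \<open>F\<close> instead of \<open>\<phi>\<close> gives a
  two-sided derivative even on the hyperplane, because \<open>F\<close> continues past it and the
  chart image is open. The minimum argument on the boundary relies on this.\<close>

lemma h_F_deriv:
  assumes "y \<in> U \<inter> W"
  shows "((\<lambda>t. h (chart_inv c (F (y + t *\<^sub>R axis j 1)))) has_real_derivative slope j y) (at 0)"
proof -
  have "((h \<circ> chart_inv c) has_derivative (\<lambda>v. coord_differential h c (F y) \<bullet> v)) (at (F y))"
  proof -
    have d: "(h \<circ> chart_inv c) differentiable (at (F y))"
      using differentiable_h_chart[OF c F_image[OF assms]] .
    have "frechet_derivative (h \<circ> chart_inv c) (at (F y)) = (\<lambda>v. coord_differential h c (F y) \<bullet> v)"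
      using frechet_derivative_eq_inner[OF d] by (simp add: coord_differential_def fun_eq_iff)
    then show ?thesis using d frechet_derivative_works by metis
  qed
  moreover have "(F has_derivative DF y) (at y)" using F_deriv assms by auto
  ultimately have hF: "((\<lambda>x. (h \<circ> chart_inv c) (F x)) has_derivative (\<lambda>v. coord_differential h c (F y) \<bullet> DF y v)) (at y)"
    using has_derivative_compose by fastforce
  have "((\<lambda>t::real. y + t *\<^sub>R axis j 1) has_derivative (\<lambda>t. t *\<^sub>R axis j 1)) (at 0)"
    by (auto intro!: derivative_eq_intros)
  from has_derivative_compose[OF this] hF
  have "((\<lambda>t. (h \<circ> chart_inv c) (F (y + t *\<^sub>R axis j 1))) has_derivative
     (\<lambda>t. coord_differential h c (F y) \<bullet> DF y (t *\<^sub>R axis j 1))) (at 0)"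
    by simp
  then show ?thesis
    by (simp add: has_field_derivative_def slope_def linear_cmul[OF linear_DF[OF assms]]
        mult_commute_abs)
qed

lemma slope_tangential:
  assumes y: "y \<in> U \<inter> W" "y $ i = 0" "h (\<phi> y) = h0" and "j \<noteq> i"
  shows "slope j y = 0"
proof -
  obtain e where e: "0 < e" "ball y e \<subseteq> W" using W y openE by blast
  have "h (chart_inv c (F (y + 0 *\<^sub>R axis j 1))) \<le> h (chart_inv c (F (y + t *\<^sub>R axis j 1)))"
    if "\<bar>0 - t\<bar> < e" for t
  proof -
    have "y + t *\<^sub>R axis j 1 \<in> W" using that e(2) by (auto simp: subset_iff dist_norm)
    moreover have "(y + t *\<^sub>R axis j 1) $ i = 0" using y assms(4) by (simp add: axis_def)
    ultimately have "y + t *\<^sub>R axis j 1 \<in> U \<inter> W" using UW by auto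
    then show ?thesis using y chart_inv_F[of y] chart_inv_F[of "y + t *\<^sub>R axis j 1"] \<phi>_S S_above by auto
  qed
  then show ?thesis using DERIV_local_min[OF h_F_deriv[OF y(1)] e(1)] by blast
qed

lemma D_pos: "y \<in> U \<inter> W \<Longrightarrow> 0 < D y"
  unfolding D_def
  using det_pos_if_posdef[OF gram_posdef[OF metric_pos[OF c F_image] linear_DF inj_DF G_def]] by simp

text \<open>For positive \<open>slope i y\<close> the second claim reads
  \<open>D y / slope i y \<ge> q y * V h0 powr (k / 2 - 1)\<close>: volume per unit of level,
  measured along an inward line, is at least boundary density times the weight factor of the
  tube.\<close>

lemma
  assumes y: "y \<in> U \<inter> W" "y $ i = 0" "h (\<phi> y) = h0"
  shows q_pos: "0 < q y"
    and slope_bound: "\<bar>slope i y\<bar> * q y \<le> V h0 powr (1 - real CARD('k) / 2) * D y"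
proof -
  have u: "F y \<in> chart_image c" by (rule F_image[OF y(1)])
  have "(norm_wrt (g c (F y)) (gradient g h c (F y)))\<^sup>2
      = inner_wrt (g c (F y)) (gradient g h c (F y)) (gradient g h c (F y))"
    using metric_pos[OF c u, of "gradient g h c (F y)"]
    by (cases "gradient g h c (F y) = 0") (auto simp: norm_wrt_def inner_wrt_def)
  then have V: "V h0 = inner_wrt (g c (F y)) (matrix_inv (g c (F y)) *v coord_differential h c (F y))
      (matrix_inv (g c (F y)) *v coord_differential h c (F y))"
    using V_eq c u y(3) chart_inv_F[OF y(1)] by (simp add: gradient_def) metis
  note * = gram_minor_bound[OF metric_sym[OF c u] metric_pos[OF c u] linear_DF[OF y(1)] inj_DF[OF y(1)] V0 V
      G_def[of y] slope_tangential[unfolded slope_def, OF y]]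
  show "0 < q y" using *(1) by (simp add: q_def)
  show "\<bar>slope i y\<bar> * q y \<le> V h0 powr (1 - real CARD('k) / 2) * D y"
    using *(2) by (simp add: q_def D_def slope_def)
qed

definition line :: "real^'k \<Rightarrow> real \<Rightarrow> real^'k" where "line x s = x + s *\<^sub>R axis i 1"

lemma continuous_line: "continuous_on X (\<lambda>p. line (fst p) (snd p))"
  unfolding line_def by (intro continuous_intros)

lemma boundary_subset:
  assumes "E \<subseteq> {x \<in> W. x $ i = 0 \<and> h (\<phi> x) = h0}"
  shows "E \<subseteq> U \<inter> W"
  using assms UW by auto

text \<open>At \<open>s = 0\<close> the last two estimates hold strictly thanks to
  \<open>\<epsilon>\<close> and the positivity of \<open>D\<close>. They are then open conditions
  and hold up to a common \<open>r\<close> by compactness of \<open>E\<close>.\<close>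

lemma tube_exists:
  assumes E: "compact E" "E \<subseteq> {x \<in> W. x $ i = 0 \<and> h (\<phi> x) = h0}"
    and O': "open O'" "\<phi> ` E \<subseteq> O'" and \<epsilon>: "0 < \<epsilon>" "\<epsilon> < 1"
  obtains r where "0 < r"
    "\<And>x s. x \<in> E \<Longrightarrow> 0 \<le> s \<Longrightarrow> s \<le> r \<Longrightarrow> line x s \<in> U \<inter> W"
    "\<And>x s. x \<in> E \<Longrightarrow> 0 \<le> s \<Longrightarrow> s \<le> r \<Longrightarrow> \<phi> (line x s) \<in> O'"
    "\<And>x s. x \<in> E \<Longrightarrow> 0 \<le> s \<Longrightarrow> s \<le> r \<Longrightarrow> (1 - \<epsilon>) * D x \<le> D (line x s)"
    "\<And>x s. x \<in> E \<Longrightarrow> 0 \<le> s \<Longrightarrow> s \<le> r \<Longrightarrow>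
        slope i (line x s) * q x \<le> (1 + \<epsilon>) * (V h0 powr (1 - real CARD('k) / 2) * D x)"
proof -
  define v where "v = V h0 powr (1 - real CARD('k) / 2)"
  have v: "0 < v" using V0 by (simp add: v_def)
  have EUW: "E \<subseteq> U \<inter> W" by (rule boundary_subset[OF E(2)])
  obtain e where e: "0 < e" "(\<Union>x\<in>E. ball x e) \<subseteq> W"
    using compact_subset_open_imp_ball_epsilon_subset[OF E(1) W] E(2) by auto
  define r0 where "r0 = e / 2"
  have r0: "0 < r0" using e by (simp add: r0_def)
  have line_UW: "line x s \<in> U \<inter> W" if "x \<in> E" "0 \<le> s" "s \<le> r0" for x s
  proof -
    have "line x s \<in> ball x e" using that e(1) by (simp add: line_def dist_norm r0_def)
    then have "line x s \<in> W" using e(2) that(1) by blast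
    moreover have "0 \<le> line x s $ i" using that E(2) by (auto simp: line_def)
    ultimately show ?thesis using UW by auto
  qed
  have on_line: "continuous_on (E \<times> {0..r0}) (\<lambda>p. f (line (fst p) (snd p)))"
    if "continuous_on (U \<inter> W) f" for f :: "real^'k \<Rightarrow> 'z::topological_space"
    by (rule continuous_on_compose2[OF that continuous_line]) (use line_UW in auto)
  have on_fst: "continuous_on (E \<times> {0..r0}) (\<lambda>p. f (fst p))"
    if "continuous_on (U \<inter> W) f" for f :: "real^'k \<Rightarrow> real"
    by (rule continuous_on_compose2[OF that]) (use EUW in \<open>auto intro!: continuous_intros\<close>)
  have line_0: "line x 0 = x" for x by (simp add: line_def)
  have "continuous_on (E \<times> {0..r0}) (\<lambda>p. \<phi> (line (fst p) (snd p)))"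
    by (intro on_line continuous_on_subset[OF continuous_\<phi>]) auto
  then obtain r1 where r1: "0 < r1" "r1 \<le> r0"
    "\<And>x s. x \<in> E \<Longrightarrow> 0 \<le> s \<Longrightarrow> s \<le> r1 \<Longrightarrow> \<phi> (line x s) \<in> O'"
    by (rule uniform_tube[OF E(1) r0 _ O'(1)]) (use O'(2) line_0 in auto)
  have "continuous_on (E \<times> {0..r0}) (\<lambda>p. D (line (fst p) (snd p)) - (1 - \<epsilon>) * D (fst p))"
    by (intro continuous_intros on_line on_fst continuous_D)
  then obtain r2 where r2: "0 < r2" "r2 \<le> r0"
    "\<And>x s. x \<in> E \<Longrightarrow> 0 \<le> s \<Longrightarrow> s \<le> r2 \<Longrightarrow> D (line x s) - (1 - \<epsilon>) * D x \<in> {0<..}"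
  proof (rule uniform_tube[OF E(1) r0 _ open_greaterThan])
    fix x assume "x \<in> E"
    then have "0 < \<epsilon> * D x" using \<epsilon>(1) D_pos[of x] EUW by (intro mult_pos_pos) auto
    then show "D (line (fst (x, 0)) (snd (x, 0))) - (1 - \<epsilon>) * D (fst (x, 0)) \<in> {0<..}"
      by (simp add: line_0 algebra_simps)
  qed auto
  have "continuous_on (E \<times> {0..r0})
     (\<lambda>p. (1 + \<epsilon>) * (v * D (fst p)) - slope i (line (fst p) (snd p)) * q (fst p))"
    by (intro continuous_intros on_line on_fst continuous_D continuous_slope continuous_q)
  then obtain r3 where r3: "0 < r3" "r3 \<le> r0"
    "\<And>x s. x \<in> E \<Longrightarrow> 0 \<le> s \<Longrightarrow> s \<le> r3 \<Longrightarrow>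
      (1 + \<epsilon>) * (v * D x) - slope i (line x s) * q x \<in> {0<..}"
  proof (rule uniform_tube[OF E(1) r0 _ open_greaterThan])
    fix x assume x: "x \<in> E"
    then have "\<bar>slope i x\<bar> * q x \<le> v * D x" and "0 < q x"
      using slope_bound[of x] q_pos[of x] EUW E(2) by (auto simp: v_def)
    then have "slope i x * q x \<le> v * D x"
      by (meson abs_ge_self less_imp_le mult_right_mono order_trans)
    moreover have "0 < \<epsilon> * (v * D x)"
      using \<epsilon>(1) v D_pos[of x] EUW x by (intro mult_pos_pos) auto
    ultimately show "(1 + \<epsilon>) * (v * D (fst (x, 0))) - slope i (line (fst (x, 0)) (snd (x, 0))) * q (fst (x, 0)) \<in> {0<..}"
      by (simp add: line_0 algebra_simps)
  qed auto
  show ?thesis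
  proof (rule that[of "min r1 (min r2 r3)"])
    fix x s assume xs: "x \<in> E" "0 \<le> s" "s \<le> min r1 (min r2 r3)"
    show "line x s \<in> U \<inter> W" using line_UW xs r1 by auto
    show "\<phi> (line x s) \<in> O'" using r1(3) xs by auto
    show "(1 - \<epsilon>) * D x \<le> D (line x s)" using r2(3)[of x s] xs by auto
    show "slope i (line x s) * q x \<le> (1 + \<epsilon>) * (V h0 powr (1 - real CARD('k) / 2) * D x)"
      using r3(3)[of x s] xs by (auto simp: v_def)
  qed (use r1 r2 r3 in auto)
qed

lemma continuous_h_line:
  assumes "\<And>s. 0 \<le> s \<Longrightarrow> s \<le> r \<Longrightarrow> line x s \<in> U \<inter> W"
  shows "continuous_on {0..r} (\<lambda>s. h (\<phi> (line x s)))"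
  by (rule continuous_on_compose2[OF continuous_h_\<phi>])
     (use assms in \<open>auto simp: line_def intro!: continuous_intros\<close>)

lemma h_line_speed:
  assumes UW: "\<And>s. 0 \<le> s \<Longrightarrow> s \<le> r \<Longrightarrow> line x s \<in> U \<inter> W"
    and slope: "\<And>s. 0 \<le> s \<Longrightarrow> s \<le> r \<Longrightarrow> slope i (line x s) \<le> L"
    and ab: "0 \<le> a" "a \<le> b" "b \<le> r"
  shows "h (\<phi> (line x b)) - h (\<phi> (line x a)) \<le> L * (b - a)"
proof -
  define f where "f s = h (chart_inv c (F (line x s)))" for s
  have f: "f s = h (\<phi> (line x s))" if "0 \<le> s" "s \<le> r" for s
    using chart_inv_F[OF UW[OF that]] by (simp add: f_def)
  have "(f has_real_derivative slope i (line x s)) (at s)" if "0 \<le> s" "s \<le> r" for s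
  proof -
    have "((\<lambda>t. f (t + s)) has_real_derivative slope i (line x s)) (at 0)"
      using h_F_deriv[OF UW[OF that], of i] by (simp add: f_def line_def algebra_simps)
    then show ?thesis using DERIV_at_within_shift[of f "slope i (line x s)" s 0 UNIV] by (simp add: add.commute)
  qed
  then have "f b - L * b \<le> f a - L * a"
  proof (intro DERIV_nonpos_imp_nonincreasing[OF ab(2)])
    fix s assume "a \<le> s" "s \<le> b" and deriv: "\<And>s. 0 \<le> s \<Longrightarrow> s \<le> r \<Longrightarrow>
      (f has_real_derivative slope i (line x s)) (at s)"
    then have s: "0 \<le> s" "s \<le> r" using ab by auto
    show "\<exists>y. ((\<lambda>s. f s - L * s) has_real_derivative y) (at s) \<and> y \<le> 0"
      using slope[OF s] deriv[OF s]
      by (intro exI[of _ "slope i (line x s) - L"]) (auto intro!: derivative_eq_intros)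
  qed
  then show ?thesis using f ab by (simp add: algebra_simps)
qed

text \<open>The lines from \<open>E\<close> sweep out a compact set \<open>T\<close>. The area
  formula on its part with levels in \<open>J\<close>, followed by Fubini along the lines, leaves
  for each starting point the density times the time spent in \<open>J\<close>.\<close>

lemma \<mu>_tube_lower_bound:
  assumes E: "compact E" "E \<subseteq> {x \<in> W. x $ i = 0 \<and> h (\<phi> x) = h0}" and "0 \<le> r" "open O'"
    and UW: "\<And>x s. x \<in> E \<Longrightarrow> 0 \<le> s \<Longrightarrow> s \<le> r \<Longrightarrow> line x s \<in> U \<inter> W"
    and O': "\<And>x s. x \<in> E \<Longrightarrow> 0 \<le> s \<Longrightarrow> s \<le> r \<Longrightarrow> \<phi> (line x s) \<in> O'"
    and D: "\<And>x s. x \<in> E \<Longrightarrow> 0 \<le> s \<Longrightarrow> s \<le> r \<Longrightarrow> C * D x \<le> D (line x s)"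
    and J: "J \<in> sets borel"
  shows "(\<integral>\<^sup>+x\<in>E. (ennreal (C * D x) * emeasure lborel {s\<in>{0..r}. h (\<phi> (line x s)) \<in> J}) \<partial>hyperplane_measure i)
      \<le> emeasure \<mu> {p \<in> S \<inter> O'. h p \<in> J}"
proof -
  define T where "T = (\<lambda>p. line (fst p) (snd p)) ` (E \<times> {0..r})"
  have T: "compact T" unfolding T_def
    by (intro compact_continuous_image continuous_line compact_Times E) simp
  have TUW: "T \<subseteq> U \<inter> W" using UW by (auto simp: T_def)
  define X where "X = {y \<in> T. h (\<phi> y) \<in> J}"
  have Tb: "T \<in> sets borel" using T by (simp add: borel_compact)
  have X: "X \<in> sets borel"
  proof -
    have "(\<lambda>y. h (\<phi> y)) \<in> borel_measurable (restrict_space borel T)"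
      by (rule borel_measurable_continuous_on_restrict[OF continuous_on_subset[OF continuous_h_\<phi> TUW]])
    from measurable_sets[OF this J] show ?thesis
      using Tb by (auto simp: space_restrict_space sets_restrict_space_iff X_def vimage_def Int_def conj_commute)
  qed
  have \<phi>X: "\<phi> ` X = {p \<in> S \<inter> \<phi> ` T. h p \<in> J}"
    using \<phi>_S TUW by (auto simp: X_def)
  have "emeasure \<mu> (\<phi> ` X) = (\<integral>\<^sup>+y\<in>X. ennreal (sqrt (det (gram_matrix g c U \<phi> y))) \<partial>lborel)"
  proof -
    have "X \<subseteq> U" "\<phi> ` X \<subseteq> fst c" using TUW \<phi>_chart by (auto simp: X_def)
    moreover have "\<forall>(i::'k) U \<phi>. local_param A S i U \<phi> \<longrightarrow>
        (\<forall>c\<in>A. \<forall>E\<in>sets borel. E \<subseteq> U \<and> \<phi> ` E \<subseteq> fst c \<longrightarrow>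
           emeasure \<mu> (\<phi> ` E) = (\<integral>\<^sup>+x\<in>E. ennreal (sqrt (det (gram_matrix g c U \<phi> x))) \<partial>lborel))"
      by (rule conjunct2[OF conjunct2[OF \<mu>[unfolded volume_measure_def]]])
    ultimately show ?thesis using param c X by blast
  qed
  also have "\<dots> = (\<integral>\<^sup>+y. ennreal (D y * indicator T y) * indicator X y \<partial>lborel)"
    using TUW by (intro nn_integral_cong) (auto simp: indicator_def D_def gram_eq X_def subset_iff)
  also have "\<dots> = (\<integral>\<^sup>+x. \<integral>\<^sup>+s. ennreal (D (line x s) * indicator T (line x s)) * indicator X (line x s) \<partial>lborel
      \<partial>hyperplane_measure i)"
  proof -
    have "(\<lambda>y. D y * indicator T y) \<in> borel_measurable borel"
      using borel_measurable_continuous_on_indicator[OF Tb continuous_on_subset[OF continuous_D TUW]]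
      by (simp add: mult.commute)
    then show ?thesis unfolding line_def using X
      by (intro nn_integral_lborel_hyperplane_measure) auto
  qed
  also have "\<dots> \<ge> (\<integral>\<^sup>+x\<in>E. (ennreal (C * D x) * emeasure lborel {s\<in>{0..r}. h (\<phi> (line x s)) \<in> J}) \<partial>hyperplane_measure i)"
  proof (rule nn_integral_mono)
    fix x :: "real^'k"
    show "ennreal (C * D x) * emeasure lborel {s\<in>{0..r}. h (\<phi> (line x s)) \<in> J} * indicator E x
       \<le> (\<integral>\<^sup>+s. ennreal (D (line x s) * indicator T (line x s)) * indicator X (line x s) \<partial>lborel)"
    proof (cases "x \<in> E")
      case True
      have meas: "{s\<in>{0..r}. h (\<phi> (line x s)) \<in> J} \<in> sets borel"
      proof -
        have "(\<lambda>s. h (\<phi> (line x s))) \<in> borel_measurable (restrict_space borel {0..r})"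
          by (rule borel_measurable_continuous_on_restrict[OF continuous_h_line]) (use UW True in auto)
        from measurable_sets[OF this J] show ?thesis
          by (auto simp: space_restrict_space sets_restrict_space_iff vimage_def Int_def conj_commute)
      qed
      have "ennreal (C * D x) * emeasure lborel {s\<in>{0..r}. h (\<phi> (line x s)) \<in> J}
          = (\<integral>\<^sup>+s. ennreal (C * D x) * indicator {s\<in>{0..r}. h (\<phi> (line x s)) \<in> J} s \<partial>lborel)"
        using meas by (intro nn_integral_cmult_indicator[symmetric]) auto
      also have "\<dots> \<le> (\<integral>\<^sup>+s. ennreal (D (line x s) * indicator T (line x s)) * indicator X (line x s) \<partial>lborel)"
      proof (rule nn_integral_mono)
        fix s :: real
        show "ennreal (C * D x) * indicator {s\<in>{0..r}. h (\<phi> (line x s)) \<in> J} s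
           \<le> ennreal (D (line x s) * indicator T (line x s)) * indicator X (line x s)"
        proof (cases "s \<in> {0..r} \<and> h (\<phi> (line x s)) \<in> J")
          case s: True
          then have "line x s \<in> T" using True by (auto simp: T_def intro!: image_eqI[of _ _ "(x, s)"])
          then show ?thesis using s D[of x s] True by (auto simp: X_def intro!: ennreal_leI)
        qed auto
      qed
      finally show ?thesis using True by simp
    qed simp
  qed
  also have "emeasure \<mu> (\<phi> ` X) \<le> emeasure \<mu> {p \<in> S \<inter> O'. h p \<in> J}"
  proof (rule emeasure_mono)
    show "\<phi> ` X \<subseteq> {p \<in> S \<inter> O'. h p \<in> J}"
      unfolding \<phi>X using O' by (auto simp: T_def)
  qed (rule level_set_\<mu>[OF J \<open>open O'\<close>])
  finally show ?thesis .
qed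

end

context level_patch
begin

lemma \<beta>_patch:
  assumes E: "E \<in> sets borel" "E \<subseteq> {x \<in> W. x $ i = 0 \<and> h (\<phi> x) = h0}"
  shows "emeasure \<beta> (\<phi> ` E) = (\<integral>\<^sup>+x\<in>E. ennreal (q x) \<partial>hyperplane_measure i)"
proof -
  have EUW: "E \<subseteq> U \<inter> W" by (rule boundary_subset[OF E(2)])
  have "\<forall>(i::'k) U \<phi>. local_param A S i U \<phi> \<longrightarrow>
        (\<forall>c\<in>A. \<forall>E\<in>sets borel. E \<subseteq> U \<inter> {x. x $ i = 0} \<and> \<phi> ` E \<subseteq> fst c \<longrightarrow>
           emeasure \<beta> (\<phi> ` E) = (\<integral>\<^sup>+x\<in>E. ennreal (sqrt (det (drop_index i
              (gram_matrix (rescaled_metric h V g) c U \<phi> x)))) \<partial>hyperplane_measure i))"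
    by (rule conjunct2[OF conjunct2[OF \<beta>[unfolded boundary_volume_measure_def]]])
  moreover have "E \<subseteq> U \<inter> {x. x $ i = 0}" using E EUW by auto
  moreover have "\<phi> ` E \<subseteq> fst c" using EUW \<phi>_chart by (meson image_mono order_trans)
  ultimately have "emeasure \<beta> (\<phi> ` E) = (\<integral>\<^sup>+x\<in>E. ennreal (sqrt (det (drop_index i
              (gram_matrix (rescaled_metric h V g) c U \<phi> x)))) \<partial>hyperplane_measure i)"
    using param c E(1) by blast
  also have "\<dots> = (\<integral>\<^sup>+x\<in>E. ennreal (q x) \<partial>hyperplane_measure i)"
    using EUW E(2) by (intro nn_integral_cong) (auto simp: indicator_def q_def rescaled_gram_eq subset_iff)
  finally show ?thesis .
qed

text \<open>Lines starting in \<open>E\<close> that stay in the level \<open>h0\<close> up to \<open>r\<close> form a null set, as they sweep out a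
  subset of $\gamma_0$; all other lines cross the levels between \<open>h0\<close> and some \<open>h0 + 1 / Suc n\<close>.\<close>

lemma patch_lower_bound:
  assumes E: "compact E" "E \<subseteq> {x \<in> W. x $ i = 0 \<and> h (\<phi> x) = h0}"
    and O': "open O'" "\<phi> ` E \<subseteq> O'" and b: "0 < b" "ennreal b < emeasure \<beta> (\<phi> ` E)"
  shows "\<exists>\<delta>>0. \<forall>J\<in>sets borel. J \<subseteq> {h0<..<h0+\<delta>} \<longrightarrow>
     ennreal (b * V h0 powr (real CARD('k) / 2 - 1)) * emeasure lborel J \<le> emeasure \<mu> {p \<in> S \<inter> O'. h p \<in> J}"
proof -
  define v where "v = V h0 powr (1 - real CARD('k) / 2)"
  have v: "0 < v" using V0 by (simp add: v_def)
  have v_inv: "1 / v = V h0 powr (real CARD('k) / 2 - 1)"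
    by (simp add: v_def powr_minus_divide[symmetric])
  have EUW: "E \<subseteq> U \<inter> W" by (rule boundary_subset[OF E(2)])
  have Eb: "E \<in> sets borel" using E(1) by (rule borel_compact)
  obtain e where e: "ennreal b < e" "e < emeasure \<beta> (\<phi> ` E)" using dense[OF b(2)] by auto
  then obtain b' where b': "e = ennreal b'" "0 \<le> b'" by (cases e) auto
  have bb': "b < b'" using e(1) b' b(1) by (simp add: ennreal_less_iff)
  \<comment> \<open>Solves \<open>(1 - \<epsilon>) * b' = (1 + \<epsilon>) * b\<close>: the slack
    between \<open>b\<close> and \<open>b'\<close> pays for the relative errors in density and
    speed.\<close>
  define \<epsilon> where "\<epsilon> = (b' - b) / (b' + b)"
  have \<epsilon>: "0 < \<epsilon>" "\<epsilon> < 1" "(1 - \<epsilon>) * b' = (1 + \<epsilon>) * b"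
    using bb' b(1) by (auto simp: \<epsilon>_def field_simps)
  obtain r where r: "0 < r"
    and line_UW: "\<And>x s. x \<in> E \<Longrightarrow> 0 \<le> s \<Longrightarrow> s \<le> r \<Longrightarrow> line x s \<in> U \<inter> W"
    and line_O': "\<And>x s. x \<in> E \<Longrightarrow> 0 \<le> s \<Longrightarrow> s \<le> r \<Longrightarrow> \<phi> (line x s) \<in> O'"
    and line_D: "\<And>x s. x \<in> E \<Longrightarrow> 0 \<le> s \<Longrightarrow> s \<le> r \<Longrightarrow> (1 - \<epsilon>) * D x \<le> D (line x s)"
    and line_slope: "\<And>x s. x \<in> E \<Longrightarrow> 0 \<le> s \<Longrightarrow> s \<le> r \<Longrightarrow>
        slope i (line x s) * q x \<le> (1 + \<epsilon>) * (v * D x)"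
    by (rule tube_exists[OF E O' \<epsilon>(1,2), folded v_def, OF that])
  have sets_H: "sets (hyperplane_measure i) = sets borel" by (simp add: hyperplane_measure_def)
  have q_meas: "(\<lambda>x. q x * indicator E x) \<in> borel_measurable borel"
    using borel_measurable_continuous_on_indicator[OF Eb continuous_on_subset[OF continuous_q EUW]]
    by (simp add: mult.commute)
  have D_meas: "(\<lambda>x. D x * indicator E x) \<in> borel_measurable borel"
    using borel_measurable_continuous_on_indicator[OF Eb continuous_on_subset[OF continuous_D EUW]]
    by (simp add: mult.commute)
  define \<rho> where "\<rho> = density (hyperplane_measure i) (\<lambda>x. ennreal (q x * indicator E x))"
  have sets_\<rho>: "sets \<rho> = sets borel" by (simp add: \<rho>_def sets_H)
  have \<rho>: "emeasure \<rho> X = (\<integral>\<^sup>+x\<in>X. ennreal (q x) \<partial>hyperplane_measure i)"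
    if "X \<in> sets borel" "X \<subseteq> E" for X
    unfolding \<rho>_def using that q_meas sets_H measurable_cong_sets[OF sets_H refl]
    by (subst emeasure_density) (auto intro!: nn_integral_cong simp: indicator_def subset_iff)
  \<comment> \<open>Starting points whose line climbs by at least \<open>1 / Suc n\<close> before
    time \<open>r\<close>. These sets increase with \<open>n\<close> and are compact as projections
    of compact sets, so the tube estimate applies to each of them.\<close>
  define En where "En n = {x \<in> E. \<exists>s\<in>{0..r}. h0 + 1 / Suc n \<le> h (\<phi> (line x s))}" for n
  have En_compact: "compact (En n)" for n
  proof -
    have "continuous_on (E \<times> {0..r}) (\<lambda>p. h (\<phi> (line (fst p) (snd p))))"
      by (rule continuous_on_compose2[OF continuous_h_\<phi> continuous_line]) (use line_UW in auto)
    then have "closedin (top_of_set (E \<times> {0..r}))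
        (E \<times> {0..r} \<inter> (\<lambda>p. h (\<phi> (line (fst p) (snd p)))) -` {h0 + 1 / Suc n..})"
      by (rule continuous_closedin_preimage) simp
    then have "compact (E \<times> {0..r} \<inter> (\<lambda>p. h (\<phi> (line (fst p) (snd p)))) -` {h0 + 1 / Suc n..})"
      by (rule closedin_compact[rotated]) (simp add: compact_Times E)
    then have "compact (fst ` (E \<times> {0..r} \<inter> (\<lambda>p. h (\<phi> (line (fst p) (snd p)))) -` {h0 + 1 / Suc n..}))"
      by (intro compact_continuous_image continuous_on_fst continuous_on_id)
    also have "fst ` (E \<times> {0..r} \<inter> (\<lambda>p. h (\<phi> (line (fst p) (snd p)))) -` {h0 + 1 / Suc n..}) = En n"
      by (force simp: En_def)
    finally show ?thesis .
  qed
  have Enb: "En n \<in> sets borel" for n using En_compact by (rule borel_compact)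
  have EnE: "En n \<subseteq> E" for n by (auto simp: En_def)
  define Z where "Z = E - (\<Union>n. En n)"
  have Zb: "Z \<in> sets borel" using Eb Enb by (auto simp: Z_def)
  have Z: "h (\<phi> (line x s)) = h0" if x: "x \<in> Z" and s: "s \<in> {0..r}" for x s
  proof (rule antisym)
    have "\<phi> (line x s) \<in> S" using line_UW[of x s] x s \<phi>_S by (auto simp: Z_def)
    then show "h0 \<le> h (\<phi> (line x s))" using S_above by blast
    show "h (\<phi> (line x s)) \<le> h0"
    proof (rule field_le_epsilon)
      fix e :: real assume "0 < e"
      then obtain n where "1 / real (Suc n) < e" using nat_approx_posE by blast
      moreover have "\<not> h0 + 1 / Suc n \<le> h (\<phi> (line x s))" using x s by (auto simp: Z_def En_def)
      ultimately show "h (\<phi> (line x s)) \<le> h0 + e" by linarith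
    qed
  qed
  \<comment> \<open>The tube estimate for \<open>J = {h0}\<close> bounds \<open>r\<close> times a
    positive density integrated over \<open>Z\<close> by the volume of the initial slice, which is
    0.\<close>
  have "emeasure \<rho> Z = 0"
  proof -
    have "(\<integral>\<^sup>+x. ennreal (D x * indicator E x) * (ennreal ((1 - \<epsilon>) * r) * indicator Z x) \<partial>hyperplane_measure i)
       \<le> (\<integral>\<^sup>+x\<in>E. (ennreal ((1 - \<epsilon>) * D x) * emeasure lborel {s\<in>{0..r}. h (\<phi> (line x s)) \<in> {h0}}) \<partial>hyperplane_measure i)"
    proof (rule nn_integral_mono)
      fix x :: "real^'k"
      show "ennreal (D x * indicator E x) * (ennreal ((1 - \<epsilon>) * r) * indicator Z x)
        \<le> ennreal ((1 - \<epsilon>) * D x) * emeasure lborel {s\<in>{0..r}. h (\<phi> (line x s)) \<in> {h0}} * indicator E x"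
      proof (cases "x \<in> Z")
        case True
        then have time: "{s\<in>{0..r}. h (\<phi> (line x s)) \<in> {h0}} = {0..r}"
          by (intro equalityI subsetI CollectI conjI) (simp_all only: Z singleton_iff mem_Collect_eq)
        have "x \<in> E" using True by (simp add: Z_def)
        then have "0 < D x" using EUW by (intro D_pos) auto
        then have "ennreal (D x) * ennreal ((1 - \<epsilon>) * r) = ennreal ((1 - \<epsilon>) * D x) * ennreal r"
          using r \<epsilon>(2) by (subst (1 2) ennreal_mult[symmetric]) (simp_all add: mult_ac)
        then show ?thesis unfolding time using True \<open>x \<in> E\<close> r by simp
      qed simp
    qed
    also have "\<dots> \<le> emeasure \<mu> {p \<in> S \<inter> O'. h p \<in> {h0}}"
      using r by (intro \<mu>_tube_lower_bound E O' line_UW line_O' line_D) auto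
    also have "\<dots> \<le> emeasure \<mu> (initial_slice h h0 S)"
    proof (rule emeasure_mono)
      have "initial_slice h h0 S = {p \<in> S \<inter> UNIV. h p \<in> {h0}}" by (auto simp: initial_slice_def)
      then show "initial_slice h h0 S \<in> sets \<mu>" using level_set_\<mu>[of "{h0}" UNIV] by simp
    qed (auto simp: initial_slice_def)
    finally have int0: "(\<integral>\<^sup>+x. ennreal (D x * indicator E x) * (ennreal ((1 - \<epsilon>) * r) * indicator Z x) \<partial>hyperplane_measure i) = 0"
      using \<mu>_slice by simp
    have "AE x in hyperplane_measure i. ennreal (D x * indicator E x) * (ennreal ((1 - \<epsilon>) * r) * indicator Z x) = 0"
    proof (rule nn_integral_0_iff_AE[THEN iffD1, OF _ int0])
      have "(\<lambda>x. ennreal (D x * indicator E x) * (ennreal ((1 - \<epsilon>) * r) * indicator Z x)) \<in> borel_measurable borel"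
        using D_meas Zb by measurable
      then show "(\<lambda>x. ennreal (D x * indicator E x) * (ennreal ((1 - \<epsilon>) * r) * indicator Z x))
          \<in> borel_measurable (hyperplane_measure i)"
        using measurable_cong_sets[OF sets_H refl] by blast
    qed
    then have "AE x in hyperplane_measure i. x \<notin> Z"
    proof eventually_elim
      case (elim x)
      show ?case
      proof
        assume x: "x \<in> Z"
        then have "x \<in> E" by (simp add: Z_def)
        moreover have "0 < D x" using \<open>x \<in> E\<close> EUW by (intro D_pos) auto
        ultimately show False using elim x r \<epsilon>(2) by (simp add: ennreal_eq_0_iff mult_le_0_iff)
      qed
    qed
    then have "AE x in hyperplane_measure i. ennreal (q x) * indicator Z x = 0"
      by eventually_elim simp
    then have "(\<integral>\<^sup>+x\<in>Z. ennreal (q x) \<partial>hyperplane_measure i) = (\<integral>\<^sup>+x. 0 \<partial>hyperplane_measure i)"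
      by (intro nn_integral_cong_AE)
    then show ?thesis using \<rho>[OF Zb] by (simp add: Z_def)
  qed
  have "ennreal b' < emeasure \<rho> E"
    using e b' \<beta>_patch[OF Eb E(2)] \<rho>[OF Eb] by simp
  also have "E = Z \<union> (\<Union>n. En n)" using EnE by (auto simp: Z_def)
  also have "emeasure \<rho> \<dots> \<le> emeasure \<rho> Z + emeasure \<rho> (\<Union>n. En n)"
    using Zb Enb sets_\<rho> by (intro emeasure_subadditive) auto
  also have "\<dots> = (SUP n. emeasure \<rho> (En n))"
  proof -
    have "incseq En"
    proof (rule monoI, rule subsetI)
      fix m n :: nat and x assume mn: "m \<le> n" and x: "x \<in> En m"
      have "1 / real (Suc n) \<le> 1 / real (Suc m)" using mn by (simp add: field_simps)
      then show "x \<in> En n" using x unfolding En_def by force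
    qed
    then show ?thesis using Enb sets_\<rho> \<open>emeasure \<rho> Z = 0\<close>
      by (subst SUP_emeasure_incseq) auto
  qed
  finally obtain n where n: "ennreal b' < emeasure \<rho> (En n)" by (auto simp: less_SUP_iff)
  define \<kappa> where "\<kappa> = (1 - \<epsilon>) / ((1 + \<epsilon>) * v)"
  have \<kappa>: "0 < \<kappa>" using \<epsilon> v by (simp add: \<kappa>_def)
  have \<kappa>b': "\<kappa> * b' = b * V h0 powr (real CARD('k) / 2 - 1)"
  proof -
    have "\<kappa> * b' = ((1 - \<epsilon>) * b') / ((1 + \<epsilon>) * v)" by (simp add: \<kappa>_def)
    also have "\<dots> = b * (1 / v)"
      unfolding \<epsilon>(3) using mult_divide_mult_cancel_left[of "1 + \<epsilon>" b v] \<epsilon>(1) by simp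
    finally show ?thesis unfolding v_inv .
  qed
  show ?thesis
  proof (intro exI[of _ "1 / real (Suc n)"] conjI ballI impI)
    fix J :: "real set" assume J: "J \<in> sets borel" "J \<subseteq> {h0<..<h0 + 1 / real (Suc n)}"
    have "ennreal (\<kappa> * b') * emeasure lborel J \<le> ennreal \<kappa> * emeasure lborel J * emeasure \<rho> (En n)"
    proof -
      have "ennreal (\<kappa> * b') * emeasure lborel J = ennreal \<kappa> * emeasure lborel J * ennreal b'"
        using \<kappa> b'(2) by (simp add: ennreal_mult mult_ac)
      also have "\<dots> \<le> ennreal \<kappa> * emeasure lborel J * emeasure \<rho> (En n)"
        using n by (intro mult_left_mono) auto
      finally show ?thesis .
    qed
    also have "\<dots> = (\<integral>\<^sup>+x. ennreal \<kappa> * emeasure lborel J * (ennreal (q x * indicator E x) * indicator (En n) x) \<partial>hyperplane_measure i)"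
    proof -
      have "(\<lambda>x. ennreal (q x * indicator E x) * indicator (En n) x) \<in> borel_measurable borel"
        using q_meas Enb[of n] by measurable
      then have "(\<lambda>x. ennreal (q x * indicator E x) * indicator (En n) x) \<in> borel_measurable (hyperplane_measure i)"
        using measurable_cong_sets[OF sets_H refl] by blast
      moreover have "emeasure \<rho> (En n) = (\<integral>\<^sup>+x. ennreal (q x * indicator E x) * indicator (En n) x \<partial>hyperplane_measure i)"
        unfolding \<rho>[OF Enb EnE] using EnE by (intro nn_integral_cong) (auto simp: indicator_def)
      ultimately show ?thesis by (simp add: nn_integral_cmult)
    qed
    also have "\<dots> \<le> (\<integral>\<^sup>+x\<in>En n. (ennreal ((1 - \<epsilon>) * D x) * emeasure lborel {s\<in>{0..r}. h (\<phi> (line x s)) \<in> J}) \<partial>hyperplane_measure i)"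
    proof (rule nn_integral_mono)
      fix x :: "real^'k"
      show "ennreal \<kappa> * emeasure lborel J * (ennreal (q x * indicator E x) * indicator (En n) x)
        \<le> ennreal ((1 - \<epsilon>) * D x) * emeasure lborel {s\<in>{0..r}. h (\<phi> (line x s)) \<in> J} * indicator (En n) x"
      proof (cases "x \<in> En n")
        case True
        then have x: "x \<in> E" "x \<in> U \<inter> W" "x $ i = 0" "h (\<phi> x) = h0" using EnE EUW E(2) by auto
        have qx: "0 < q x" and Dx: "0 < D x" using q_pos[OF x(2-4)] D_pos[OF x(2)] by auto
        \<comment> \<open>The bound on the speed of the line from \<open>x\<close>. By the choice of
          \<open>\<kappa>\<close>, \<open>\<kappa> * q x * L\<close> is exactly the lower bound
          \<open>(1 - \<epsilon>) * D x\<close> for the density along it.\<close>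
        define L where "L = (1 + \<epsilon>) * (v * D x) / q x"
        have L: "0 \<le> L" using qx Dx v \<epsilon> by (simp add: L_def)
        have "emeasure lborel J \<le> ennreal L * emeasure lborel {s\<in>{0..r}. h (\<phi> (line x s)) \<in> J}"
        proof (rule emeasure_le_crossing_time[OF _ _ _ _ _ L _ J])
          show "continuous_on {0..r} (\<lambda>s. h (\<phi> (line x s)))"
            by (rule continuous_h_line) (use line_UW x in auto)
          show "h (\<phi> (line x 0)) = h0" using x by (simp add: line_def)
          show "\<exists>s\<in>{0..r}. h0 + 1 / real (Suc n) \<le> h (\<phi> (line x s))" using True by (simp add: En_def)
          fix s t assume st: "0 \<le> s" "s \<le> t" "t \<le> r"
          show "h (\<phi> (line x t)) - h (\<phi> (line x s)) \<le> L * (t - s)"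
          proof (rule h_line_speed[OF _ _ st])
            fix s assume s: "0 \<le> s" "s \<le> r"
            show "line x s \<in> U \<inter> W" using line_UW[OF x(1) s] .
            show "slope i (line x s) \<le> L"
              using line_slope[OF x(1) s] qx by (simp add: L_def pos_le_divide_eq)
          qed
        qed (use r in auto)
        then have "ennreal (\<kappa> * q x) * emeasure lborel J
          \<le> ennreal (\<kappa> * q x) * (ennreal L * emeasure lborel {s\<in>{0..r}. h (\<phi> (line x s)) \<in> J})"
          by (rule mult_left_mono) simp
        also have "\<dots> = ennreal (\<kappa> * q x * L) * emeasure lborel {s\<in>{0..r}. h (\<phi> (line x s)) \<in> J}"
          using \<kappa> qx L by (simp add: ennreal_mult mult.assoc)
        also have "\<kappa> * q x * L = (1 - \<epsilon>) * D x"
          using qx v \<epsilon>(1) by (simp add: \<kappa>_def L_def)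
        finally show ?thesis using True x \<kappa> qx by (simp add: ennreal_mult mult_ac)
      qed simp
    qed
    also have "\<dots> \<le> emeasure \<mu> {p \<in> S \<inter> O'. h p \<in> J}"
      using EnE E(2) r J
      by (intro \<mu>_tube_lower_bound En_compact O' line_UW line_O' line_D) auto
    finally show "ennreal (b * V h0 powr (real CARD('k) / 2 - 1)) * emeasure lborel J
        \<le> emeasure \<mu> {p \<in> S \<inter> O'. h p \<in> J}" unfolding \<kappa>b' .
  qed simp
qed

end

section \<open>From local bounds to the whole initial boundary\<close>

lemma ennreal_less_add_split:
  assumes "0 \<le> b" "ennreal b < x + y"
  obtains b1 b2 where "0 \<le> b1" "0 \<le> b2" "b \<le> b1 + b2"
    "b1 = 0 \<or> ennreal b1 < x" "b2 = 0 \<or> ennreal b2 < y"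
proof (cases x)
  case top
  then show ?thesis using assms by (intro that[of b 0]) auto
next
  case x: (real u)
  show ?thesis
  proof (cases y)
    case top
    then show ?thesis using assms by (intro that[of 0 b]) auto
  next
    case y: (real w)
    then have less: "b < u + w" using x assms by (simp add: ennreal_less_iff flip: ennreal_plus)
    define e where "e = (u + w - b) / 2"
    have e: "0 < e" "2 * e = u + w - b" using less by (simp_all add: e_def)
    \<comment> \<open>Each summand gives up half of the slack. The maximum with 0 covers a summand
      too small for a nonnegative number strictly below it.\<close>
    show ?thesis using x y e
      by (intro that[of "max 0 (u - e)" "max 0 (w - e)"]) (auto simp: ennreal_less_iff max_def)
  qed
qed

lemma compact_separation_t2:
  fixes K L :: "'m::t2_space set"
  assumes "compact K" "compact L" "K \<inter> L = {}"
  obtains X Y where "open X" "open Y" "K \<subseteq> X" "L \<subseteq> Y" "X \<inter> Y = {}"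
proof -
  have "Hausdorff_space (euclidean :: 'm topology)"
    unfolding Hausdorff_space_def by (simp add: disjnt_def) (metis hausdorff)
  then show ?thesis
    using Hausdorff_space_compact_separation[of euclidean K L] assms that by (auto simp: disjnt_def)
qed

text \<open>Without a metric, the exhaustion comes from separation and the Lindelof property:
  countably many open sets \<open>X n\<close> cover \<open>K - L\<close>, each disjoint from an open
  \<open>Y n\<close> around \<open>L\<close>, and \<open>K - Y n\<close> is compact and contains
  \<open>K \<inter> X n\<close>.\<close>

lemma compact_diff_compact_exhaustion:
  fixes K L :: "'m::{t2_space,second_countable_topology} set"
  assumes "compact K" "compact L"
  obtains C :: "nat \<Rightarrow> 'm set" where "\<And>n. compact (C n)" "incseq C" "(\<Union>n. C n) = K - L"
proof -
  define \<F> where "\<F> = {X. open X \<and> (\<exists>Y. open Y \<and> L \<subseteq> Y \<and> X \<inter> Y = {})}"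
  obtain \<F>' where F': "\<F>' \<subseteq> \<F>" "countable \<F>'" "\<Union>\<F>' = \<Union>\<F>"
    using Lindelof[of \<F>] by (auto simp: \<F>_def)
  have cover: "K - L \<subseteq> \<Union>\<F>"
  proof
    fix p assume "p \<in> K - L"
    then obtain X Y where "open X" "open Y" "{p} \<subseteq> X" "L \<subseteq> Y" "X \<inter> Y = {}"
      using compact_separation_t2[OF compact_sing[of p] assms(2)] by auto
    then show "p \<in> \<Union>\<F>" unfolding \<F>_def by blast
  qed
  \<comment> \<open>The empty set is inserted so that the family to be enumerated is
    nonempty.\<close>
  define X where "X = from_nat_into (insert {} \<F>')"
  have range_X: "range X = insert {} \<F>'"
    unfolding X_def using F'(2) by (intro range_from_nat_into) auto
  have "\<exists>Y. open Y \<and> L \<subseteq> Y \<and> X n \<inter> Y = {}" for n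
  proof -
    have "X n \<in> insert {} \<F>" using range_X F'(1) by blast
    then show ?thesis by (cases "X n = {}") (auto simp: \<F>_def)
  qed
  then obtain Y where Y: "\<And>n. open (Y n)" "\<And>n. L \<subseteq> Y n" "\<And>n. X n \<inter> Y n = {}" by metis
  show ?thesis
  proof (rule that[of "\<lambda>n. \<Union>m\<in>{..n}. K - Y m"])
    show "compact (\<Union>m\<in>{..n}. K - Y m)" for n
      using assms(1) Y(1) by (intro compact_UN compact_diff) auto
    show "incseq (\<lambda>n. \<Union>m\<in>{..n}. K - Y m)" by (auto simp: incseq_def)
    have "p \<in> (\<Union>n. \<Union>m\<in>{..n}. K - Y m)" if "p \<in> K - L" for p
    proof -
      have "p \<in> \<Union>(range X)" using that cover F'(3) range_X by auto
      then obtain n where "p \<in> X n" by blast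
      then have "p \<in> K - Y n" using that Y(3)[of n] by blast
      then show ?thesis by blast
    qed
    then show "(\<Union>n. \<Union>m\<in>{..n}. K - Y m) = K - L" using Y(2) by blast
  qed
qed

text \<open>If \<open>y\<close> were interior, the transition map would be injective and continuous
  near it, hence open by invariance of domain. Its image would contain a ball around
  \<open>z\<close>, although it lies in a half-space with \<open>z\<close> on the bounding
  hyperplane.\<close>

lemma local_param_boundary_invariant:
  fixes \<phi> \<psi> :: "real^'k::finite \<Rightarrow> 'm::topological_space"
  assumes \<phi>: "local_param A S i U \<phi>" and \<psi>: "local_param A S j U' \<psi>"
    and y: "y \<in> U" and z: "z \<in> U'" "z $ j = 0" "\<psi> z = \<phi> y"
  shows "y $ i = 0"
proof (rule ccontr)
  assume "y $ i \<noteq> 0"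
  obtain O1 where O1: "open O1" "U = {x. 0 \<le> x $ i} \<inter> O1"
    using \<phi> by (auto simp: local_param_def openin_open)
  have U': "U' \<subseteq> {x. 0 \<le> x $ j}"
    using \<psi> by (auto simp: local_param_def dest: openin_imp_subset)
  have \<phi>_cont: "continuous_on U \<phi>" and inj_\<phi>: "inj_on \<phi> U"
    and \<psi>_inv: "continuous_on (\<psi> ` U') (inv_into U' \<psi>)" and inj_\<psi>: "inj_on \<psi> U'"
    using \<phi> \<psi> unfolding local_param_def homeomorphism_def by (auto intro: inj_on_inverseI)
  obtain Q where Q: "open Q" "\<psi> ` U' = S \<inter> Q"
    using \<psi> by (auto simp: local_param_def openin_open)
  have \<phi>S: "\<phi> ` U \<subseteq> S" using \<phi> by (auto simp: local_param_def dest: openin_imp_subset)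
  define P where "P = {x. 0 < x $ i} \<inter> O1 \<inter> \<phi> -` Q"
  have PU: "P \<subseteq> U" using O1 by (auto simp: P_def)
  have "open ({x. 0 < x $ i} \<inter> O1)"
    using O1(1) by (intro open_Int open_halfspace_component_gt_cart)
  moreover have "continuous_on ({x. 0 < x $ i} \<inter> O1) \<phi>"
    by (rule continuous_on_subset[OF \<phi>_cont]) (auto simp: O1(2))
  ultimately have P: "open P"
    unfolding P_def using Q(1) by (metis continuous_open_preimage)
  have \<phi>P: "\<phi> ` P \<subseteq> \<psi> ` U'" using PU \<phi>S Q(2) by (auto simp: P_def)
  define f where "f = inv_into U' \<psi> \<circ> \<phi>"
  have "continuous_on P f" unfolding f_def
    by (intro continuous_on_compose continuous_on_subset[OF \<phi>_cont PU] continuous_on_subset[OF \<psi>_inv \<phi>P])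
  moreover have "inj_on f P" unfolding f_def
    using inj_on_subset[OF inj_\<phi> PU] inj_on_subset[OF inj_on_inv_into[OF order_refl] \<phi>P]
    by (intro comp_inj_on)
  ultimately have fP: "open (f ` P)" using P invariance_of_domain by blast
  have "y \<in> P"
  proof -
    have "0 < y $ i" using y O1(2) \<open>y $ i \<noteq> 0\<close> by auto
    moreover have "\<phi> y \<in> Q" using z(1) Q(2) by (force simp flip: z(3))
    ultimately show ?thesis using y O1(2) by (auto simp: P_def)
  qed
  moreover have "f y = z" using z(1) inj_\<psi> by (simp add: f_def flip: z(3))
  ultimately have "z \<in> f ` P" by blast
  then obtain e where e: "0 < e" "ball z e \<subseteq> f ` P" using fP openE by blast
  have "z - (e / 2) *\<^sub>R axis j 1 \<in> ball z e" using e(1) by (simp add: dist_norm)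
  also have "f ` P \<subseteq> U'" using \<phi>P by (auto simp: f_def intro!: inv_into_into)
  with e(2) have "ball z e \<subseteq> U'" by (rule order_trans)
  finally have "0 \<le> (z - (e / 2) *\<^sub>R axis j 1) $ j" using U' by blast
  then show False using z(2) e(1) by simp
qed

context level_setting
begin

abbreviation boundary_slice :: "'m set" where
  "boundary_slice \<equiv> manifold_boundary k A S \<inter> initial_slice h h0 S"

text \<open>Lower bounds for disjoint compact pieces of $\gamma_0$ add up because they are localized in
  arbitrarily small neighbourhoods \<open>O'\<close>. Compact subsets of a good set are required to satisfy the
  bound so that overlapping pieces can be made disjoint.\<close>

definition level_bound :: "'m set \<Rightarrow> bool" where
  "level_bound K \<longleftrightarrow> (\<forall>O' b. open O' \<and> K \<subseteq> O' \<and> 0 \<le> b \<and> (b = 0 \<or> ennreal b < emeasure \<beta> K) \<longrightarrow>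
     (\<exists>\<delta>>0. \<forall>J\<in>sets borel. J \<subseteq> {h0<..<h0+\<delta>} \<longrightarrow>
        ennreal (b * V h0 powr (real CARD('k) / 2 - 1)) * emeasure lborel J
          \<le> emeasure \<mu> {p \<in> S \<inter> O'. h p \<in> J}))"

definition good :: "'m set \<Rightarrow> bool" where
  "good K \<longleftrightarrow> compact K \<and> K \<subseteq> boundary_slice \<and> (\<forall>K'. compact K' \<and> K' \<subseteq> K \<longrightarrow> level_bound K')"

lemma compact_sets_\<beta>:
  assumes "compact K" "K \<subseteq> boundary_slice"
  shows "K \<in> sets \<beta>"
  using sets_\<beta>I[OF borel_compact[OF assms(1)]] assms(2) by (metis Int_absorb1 Int_subset_iff)

text \<open>A compact \<open>K\<close> splits into \<open>K \<inter> K1\<close>, which is compact,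
  and \<open>K - K1\<close>, which need not be; the latter is exhausted by compact sets
  \<open>C n\<close> up to an arbitrarily small loss of measure. The two disjoint compact pieces
  have disjoint neighbourhoods, so the volumes found near them can be added.\<close>

lemma good_Un:
  assumes "good K1" "good K2"
  shows "good (K1 \<union> K2)"
  unfolding good_def
proof (intro conjI allI impI)
  show "compact (K1 \<union> K2)" "K1 \<union> K2 \<subseteq> boundary_slice"
    using assms by (auto simp: good_def)
  fix K assume K: "compact K \<and> K \<subseteq> K1 \<union> K2"
  show "level_bound K"
    unfolding level_bound_def
  proof (intro allI impI)
    fix O' b assume *: "open O' \<and> K \<subseteq> O' \<and> 0 \<le> b \<and> (b = 0 \<or> ennreal b < emeasure \<beta> K)"
    define w where "w = V h0 powr (real CARD('k) / 2 - 1)"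
    have w: "0 \<le> w" by (simp add: w_def)
    have cK1: "compact K1" "K1 \<subseteq> boundary_slice" and cK2: "K2 \<subseteq> boundary_slice"
      using assms by (auto simp: good_def)
    obtain C where C: "\<And>n. compact (C n)" "incseq C" "(\<Union>n. C n) = K - K1"
      using compact_diff_compact_exhaustion[of K K1] K cK1 by auto
    define L where "L = K \<inter> K1"
    have L: "compact L" "L \<subseteq> K1" using K cK1 by (auto simp: L_def compact_Int)
    have CK2: "C n \<subseteq> K2" for n using C(3) K by blast
    have sets: "L \<in> sets \<beta>" "\<And>n. C n \<in> sets \<beta>"
      by (intro compact_sets_\<beta> L order_trans[OF L(2)] cK1 C(1) order_trans[OF CK2] cK2)+
    have "\<exists>n. b = 0 \<or> ennreal b < emeasure \<beta> L + emeasure \<beta> (C n)"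
    proof (cases "b = 0")
      case False
      have "(\<Union>n. C n) \<in> sets \<beta>" using sets(2) by auto
      moreover have "L \<inter> (\<Union>n. C n) = {}" "L \<union> (\<Union>n. C n) = K" using C(3) by (auto simp: L_def)
      ultimately have "emeasure \<beta> K = emeasure \<beta> L + emeasure \<beta> (\<Union>n. C n)"
        using plus_emeasure[OF sets(1), of "\<Union>n. C n"] by (simp only:)
      also have "\<dots> = (SUP n. emeasure \<beta> L + emeasure \<beta> (C n))"
      proof -
        have "emeasure \<beta> (\<Union>n. C n) = (SUP n. emeasure \<beta> (C n))"
          using sets(2) C(2) by (intro SUP_emeasure_incseq[symmetric]) auto
        then show ?thesis by (simp only: ennreal_SUP_add_right[OF UNIV_not_empty])
      qed
      finally have SUP: "emeasure \<beta> K = (SUP n. emeasure \<beta> L + emeasure \<beta> (C n))" .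
      have "ennreal b < emeasure \<beta> K" using * False by blast
      then show ?thesis unfolding SUP less_SUP_iff by blast
    qed simp
    then obtain n where n: "b = 0 \<or> ennreal b < emeasure \<beta> L + emeasure \<beta> (C n)" by blast
    obtain b1 b2 where b12: "0 \<le> b1" "0 \<le> b2" "b \<le> b1 + b2"
      "b1 = 0 \<or> ennreal b1 < emeasure \<beta> L" "b2 = 0 \<or> ennreal b2 < emeasure \<beta> (C n)"
    proof (cases "b = 0")
      case True
      then show ?thesis using that[of 0 0] by auto
    next
      case False
      then have "ennreal b < emeasure \<beta> L + emeasure \<beta> (C n)" using n by blast
      moreover have "0 \<le> b" using * by simp
      ultimately show ?thesis by (intro ennreal_less_add_split[OF _ _ that])
    qed
    have "L \<inter> C n = {}" using C(3) by (auto simp: L_def)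
    then obtain X Y where XY: "open X" "open Y" "L \<subseteq> X" "C n \<subseteq> Y" "X \<inter> Y = {}"
      using compact_separation_t2[OF L(1) C(1)] by metis
    have "level_bound L" "level_bound (C n)"
      using assms L C(1)[of n] CK2[of n] by (simp_all add: good_def)
    note bounds = this[unfolded level_bound_def, THEN spec, THEN spec, THEN mp]
    have "L \<subseteq> O'" "C n \<subseteq> O'" using C(3) * by (auto simp: L_def)
    then have sub: "L \<subseteq> X \<inter> O'" "C n \<subseteq> Y \<inter> O'" using XY(3,4) by simp_all
    have op: "open (X \<inter> O')" "open (Y \<inter> O')" using XY(1,2) * by auto
    obtain d1 where d1: "0 < d1" "\<forall>J\<in>sets borel. J \<subseteq> {h0<..<h0+d1} \<longrightarrow>
        ennreal (b1 * w) * emeasure lborel J \<le> emeasure \<mu> {p \<in> S \<inter> (X \<inter> O'). h p \<in> J}"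
      using bounds(1)[of "X \<inter> O'" b1] op(1) sub(1) b12 unfolding w_def by auto
    obtain d2 where d2: "0 < d2" "\<forall>J\<in>sets borel. J \<subseteq> {h0<..<h0+d2} \<longrightarrow>
        ennreal (b2 * w) * emeasure lborel J \<le> emeasure \<mu> {p \<in> S \<inter> (Y \<inter> O'). h p \<in> J}"
      using bounds(2)[of "Y \<inter> O'" b2] op(2) sub(2) b12 unfolding w_def by auto
    show "\<exists>\<delta>>0. \<forall>J\<in>sets borel. J \<subseteq> {h0<..<h0+\<delta>} \<longrightarrow>
        ennreal (b * V h0 powr (real CARD('k) / 2 - 1)) * emeasure lborel J
          \<le> emeasure \<mu> {p \<in> S \<inter> O'. h p \<in> J}"
    proof (intro exI[of _ "min d1 d2"] conjI ballI impI)
      fix J :: "real set" assume J: "J \<in> sets borel" "J \<subseteq> {h0<..<h0 + min d1 d2}"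
      have m: "{p \<in> S \<inter> (X \<inter> O'). h p \<in> J} \<in> sets \<mu>" "{p \<in> S \<inter> (Y \<inter> O'). h p \<in> J} \<in> sets \<mu>"
        "{p \<in> S \<inter> O'. h p \<in> J} \<in> sets \<mu>"
        using op * J(1) by (simp_all only: level_set_\<mu>)
      have "ennreal (b * w) \<le> ennreal (b1 * w) + ennreal (b2 * w)"
        using b12 w by (simp add: mult_right_mono flip: ennreal_plus distrib_right)
      then have "ennreal (b * w) * emeasure lborel J
          \<le> (ennreal (b1 * w) + ennreal (b2 * w)) * emeasure lborel J"
        by (rule mult_right_mono) simp
      also have "\<dots> = ennreal (b1 * w) * emeasure lborel J + ennreal (b2 * w) * emeasure lborel J"
        by (rule distrib_right)
      also have "\<dots> \<le> emeasure \<mu> {p \<in> S \<inter> (X \<inter> O'). h p \<in> J} + emeasure \<mu> {p \<in> S \<inter> (Y \<inter> O'). h p \<in> J}"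
      proof (intro add_mono d1(2)[rule_format] d2(2)[rule_format] J(1))
        show "J \<subseteq> {h0<..<h0+d1}" by (rule order_trans[OF J(2)]) auto
        show "J \<subseteq> {h0<..<h0+d2}" by (rule order_trans[OF J(2)]) auto
      qed
      also have "\<dots> = emeasure \<mu> ({p \<in> S \<inter> (X \<inter> O'). h p \<in> J} \<union> {p \<in> S \<inter> (Y \<inter> O'). h p \<in> J})"
        using m XY(5) by (intro plus_emeasure) auto
      also have "\<dots> \<le> emeasure \<mu> {p \<in> S \<inter> O'. h p \<in> J}"
        using m(3) by (intro emeasure_mono) auto
      finally show "ennreal (b * V h0 powr (real CARD('k) / 2 - 1)) * emeasure lborel J
          \<le> emeasure \<mu> {p \<in> S \<inter> O'. h p \<in> J}" unfolding w_def .
    qed (use d1(1) d2(1) in simp)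
  qed
qed

lemma good_neighbourhood:
  assumes V0: "0 < V h0" and p: "p \<in> boundary_slice"
  obtains N K where "open N" "p \<in> N" "good K" "boundary_slice \<inter> N \<subseteq> K"
proof -
  obtain i :: 'k and U \<phi> x where x: "local_param A S i U \<phi>" "x \<in> U" "x $ i = 0" "\<phi> x = p"
    using p by (auto simp: manifold_boundary_def)
  have "p \<in> M" using p S_subset_M by (auto simp: initial_slice_def)
  then obtain c where c: "c \<in> A" "p \<in> fst c" using chart_cover by auto
  obtain W0 F where W0: "open W0" "x \<in> W0" "\<phi> ` (U \<inter> W0) \<subseteq> fst c" "Ck_on 1 F W0"
    "\<forall>y\<in>U \<inter> W0. F y = snd c (\<phi> y)"
    using x c unfolding local_param_def by blast
  obtain O1 where O1: "open O1" "U = {x. 0 \<le> x $ i} \<inter> O1"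
    using x(1) by (auto simp: local_param_def openin_open)
  define W where "W = W0 \<inter> O1"
  interpret level_patch M S A g h V h0 \<mu> \<beta> k i U \<phi> c F W
  proof
    show "open W" using W0 O1 by (auto simp: W_def)
    show "U \<inter> W = {x. 0 \<le> x $ i} \<inter> W" by (auto simp: W_def O1(2))
    show "\<phi> ` (U \<inter> W) \<subseteq> fst c" using W0(3) by (auto simp: W_def)
    show "Ck_on 1 F W" using W0(4) by (auto simp: W_def intro: continuous_on_subset)
    show "F y = snd c (\<phi> y)" if "y \<in> U \<inter> W" for y using W0(5) that by (auto simp: W_def)
  qed (fact V0 x c)+
  have "x \<in> W" using x W0 O1 by (auto simp: W_def)
  then obtain \<rho> where \<rho>: "0 < \<rho>" "cball x \<rho> \<subseteq> W"
    using W open_contains_cball by blast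
  define B where "B = {y \<in> cball x \<rho>. y $ i = 0 \<and> h (\<phi> y) = h0}"
  have BW: "B \<subseteq> {y \<in> W. y $ i = 0 \<and> h (\<phi> y) = h0}" using \<rho>(2) by (auto simp: B_def)
  have BUW: "B \<subseteq> U \<inter> W" by (rule boundary_subset[OF BW])
  have H: "compact (cball x \<rho> \<inter> {y. y $ i = 0})"
    by (intro compact_Int_closed compact_cball closed_Collect_eq continuous_intros)
  have HUW: "cball x \<rho> \<inter> {y. y $ i = 0} \<subseteq> U \<inter> W" using \<rho>(2) UW by auto
  have B: "compact B"
  proof -
    have "closedin (top_of_set (cball x \<rho> \<inter> {y. y $ i = 0}))
        (cball x \<rho> \<inter> {y. y $ i = 0} \<inter> (\<lambda>y. h (\<phi> y)) -` {h0})"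
      by (rule continuous_closedin_preimage[OF continuous_on_subset[OF continuous_h_\<phi> HUW]]) simp
    from closedin_compact[OF H this] show ?thesis
      by (rule back_subst[of compact]) (auto simp: B_def)
  qed
  have cont_B: "continuous_on B \<phi>" by (rule continuous_on_subset[OF continuous_\<phi>]) (use BUW in auto)
  have slice: "\<phi> ` B \<subseteq> boundary_slice"
  proof -
    have "\<phi> y \<in> manifold_boundary k A S" if "y \<in> B" for y
    proof -
      have "y \<in> U" "y $ i = 0" using that BUW by (auto simp: B_def)
      then show ?thesis unfolding manifold_boundary_def using x(1) by blast
    qed
    then show ?thesis using BUW \<phi>_S by (auto simp: initial_slice_def B_def)
  qed
  have good: "good (\<phi> ` B)"
    unfolding good_def
  proof (intro conjI allI impI slice)
    show "compact (\<phi> ` B)" by (rule compact_continuous_image[OF cont_B B])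
    fix K' assume K': "compact K' \<and> K' \<subseteq> \<phi> ` B"
    define E where "E = B \<inter> \<phi> -` K'"
    have "closedin (top_of_set B) E"
      unfolding E_def using K' by (intro continuous_closedin_preimage[OF cont_B] compact_imp_closed) auto
    then have E: "compact E" by (rule closedin_compact[OF B])
    have E_image: "\<phi> ` E = K'" using K' by (auto simp: E_def)
    have EW: "E \<subseteq> {y \<in> W. y $ i = 0 \<and> h (\<phi> y) = h0}" using BW by (auto simp: E_def)
    show "level_bound K'"
      unfolding level_bound_def
    proof (intro allI impI)
      fix O' b assume *: "open O' \<and> K' \<subseteq> O' \<and> 0 \<le> b \<and> (b = 0 \<or> ennreal b < emeasure \<beta> K')"
      show "\<exists>\<delta>>0. \<forall>J\<in>sets borel. J \<subseteq> {h0<..<h0+\<delta>} \<longrightarrow>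
          ennreal (b * V h0 powr (real CARD('k) / 2 - 1)) * emeasure lborel J
            \<le> emeasure \<mu> {p \<in> S \<inter> O'. h p \<in> J}"
      proof (cases "b = 0")
        case True
        then show ?thesis by (intro exI[of _ 1]) simp
      next
        case False
        then show ?thesis using patch_lower_bound[OF E EW, of O' b] * by (simp add: E_image)
      qed
    qed
  qed
  have "openin (top_of_set S) (\<phi> ` (U \<inter> ball x \<rho>))"
  proof -
    have "homeomorphism U (\<phi> ` U) \<phi> (inv_into U \<phi>)" "openin (top_of_set S) (\<phi> ` U)"
      using x(1) by (simp_all add: local_param_def)
    moreover have "openin (top_of_set U) (U \<inter> ball x \<rho>)" by (simp add: openin_open_Int)
    ultimately show ?thesis by (meson homeomorphism_imp_open_map openin_trans)
  qed
  then obtain N where N: "open N" "\<phi> ` (U \<inter> ball x \<rho>) = S \<inter> N" by (auto simp: openin_open)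
  show ?thesis
  proof (rule that[OF N(1) _ good])
    have "p \<in> \<phi> ` (U \<inter> ball x \<rho>)" using x \<rho>(1) by (intro image_eqI[of _ _ x]) auto
    then show "p \<in> N" using N(2) by blast
    show "boundary_slice \<inter> N \<subseteq> \<phi> ` B"
    proof
      fix p' assume p': "p' \<in> boundary_slice \<inter> N"
      then have "p' \<in> S \<inter> N" by (auto simp: initial_slice_def)
      then obtain y where y: "y \<in> U \<inter> ball x \<rho>" "p' = \<phi> y" using N(2) by blast
      \<comment> \<open>A point of the slice near \<open>p\<close> is known to be a boundary point
        only for some other parametrization. Invariance of the boundary puts it on the hyperplane of
        the present one, hence into the image of \<open>B\<close>.\<close>
      obtain j :: 'k and U' \<psi> z where "local_param A S j U' \<psi>" "z \<in> U'" "z $ j = 0" "\<psi> z = p'"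
        using p' by (auto simp: manifold_boundary_def)
      then have "y $ i = 0" using local_param_boundary_invariant[OF x(1)] y by blast
      then show "p' \<in> \<phi> ` B" using y p' by (auto simp: B_def initial_slice_def intro!: image_eqI[of _ _ y])
    qed
  qed
qed

text \<open>Countably many good sets cover the slice by Lindelof, and finite unions of them are
  good. By continuity of \<open>\<beta>\<close> from below, one finite union already has measure
  above \<open>b\<close>; its bound with \<open>O' = UNIV\<close> is the claim.\<close>

lemma level_lower_bound:
  assumes V0: "0 < V h0" and b: "0 \<le> b" "ennreal b < emeasure \<beta> boundary_slice"
  shows "\<exists>\<delta>>0. \<forall>J\<in>sets borel. J \<subseteq> {h0<..<h0+\<delta>} \<longrightarrow>
     ennreal (b * V h0 powr (real CARD('k) / 2 - 1)) * emeasure lborel J \<le> emeasure \<mu> {p \<in> S. h p \<in> J}"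
proof -
  define \<F> where "\<F> = {N. open N \<and> (\<exists>K. good K \<and> boundary_slice \<inter> N \<subseteq> K)}"
  obtain \<F>' where F': "\<F>' \<subseteq> \<F>" "countable \<F>'" "\<Union>\<F>' = \<Union>\<F>"
    using Lindelof[of \<F>] by (auto simp: \<F>_def)
  have cover: "boundary_slice \<subseteq> \<Union>\<F>"
  proof
    fix p assume "p \<in> boundary_slice"
    then obtain N K where "open N" "p \<in> N" "good K" "boundary_slice \<inter> N \<subseteq> K"
      using good_neighbourhood[OF V0] by metis
    then show "p \<in> \<Union>\<F>" unfolding \<F>_def by blast
  qed
  have good_empty: "good {}" by (auto simp: good_def level_bound_def intro!: exI[of _ 1])
  define N where "N = from_nat_into (insert {} \<F>')"
  have range_N: "range N = insert {} \<F>'"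
    unfolding N_def using F'(2) by (intro range_from_nat_into) auto
  have "\<exists>K. good K \<and> boundary_slice \<inter> N n \<subseteq> K" for n
  proof -
    have "N n \<in> insert {} \<F>" using range_N F'(1) by blast
    then show ?thesis using good_empty by (cases "N n = {}") (auto simp: \<F>_def)
  qed
  then obtain K where K: "\<And>n. good (K n)" "\<And>n. boundary_slice \<inter> N n \<subseteq> K n" by metis
  define L where "L n = (\<Union>m\<in>{..n}. K m)" for n
  have L: "good (L n)" for n
    by (induction n) (simp_all add: L_def K atMost_Suc good_Un)
  have Lb: "L n \<in> sets \<beta>" for n using L[of n] compact_sets_\<beta> by (auto simp: good_def)
  have "boundary_slice = (\<Union>n. L n)"
  proof
    show "(\<Union>n. L n) \<subseteq> boundary_slice" using L by (auto simp: good_def)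
    show "boundary_slice \<subseteq> (\<Union>n. L n)"
    proof
      fix p assume p: "p \<in> boundary_slice"
      then have "p \<in> \<Union>(range N)" using cover F'(3) range_N by auto
      then obtain n where "p \<in> N n" by blast
      then have "p \<in> L n" using p K(2)[of n] by (auto simp: L_def)
      then show "p \<in> (\<Union>n. L n)" by blast
    qed
  qed
  moreover have "incseq L" by (auto simp: L_def incseq_def intro: order_trans)
  ultimately have "emeasure \<beta> boundary_slice = (SUP n. emeasure \<beta> (L n))"
    using Lb by (subst SUP_emeasure_incseq) auto
  then obtain n where "ennreal b < emeasure \<beta> (L n)" using b(2) by (auto simp: less_SUP_iff)
  moreover have "level_bound (L n)" using L[of n] by (auto simp: good_def)
  ultimately show ?thesis using b(1) by (auto simp: level_bound_def dest: spec[of _ UNIV])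
qed

end

section \<open>The densities of a submanifold\<close>

context weight_pair_pos
begin

lemma \<theta>1_right_lim:
  assumes "0 < C1"
  shows "((\<lambda>t. a1 t / q1 t) \<longlongrightarrow> B) (at_right h0)"
proof -
  have "((\<lambda>t. a1 t / q1 t) \<longlongrightarrow> C1 * B / C1) (at_right h0)"
    using assms by (intro tendsto_divide a1_lim q1_lim) simp
  moreover have "C1 * B / C1 = B" using assms by simp
  ultimately show ?thesis by (simp only:)
qed

text \<open>Extends monotonicity of the first density to the level \<open>h0\<close>, which lies in
  its domain when \<open>C1\<close> is nonzero and where its value without the sphere factor is
  \<open>B\<close>.\<close>

lemma B_le_\<theta>1:
  assumes weak: "\<And>t. h0 < t \<Longrightarrow> t \<le> T \<Longrightarrow> P1 t / q1 t \<le> P2 t / q2 t"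
    and initial: "\<And>t. 0 < C1 \<Longrightarrow> C2 = 0 \<Longrightarrow> h0 < t \<Longrightarrow> t \<le> T \<Longrightarrow> B \<le> \<theta>2 t"
    and "0 < C1" and t: "h0 < t" "t \<le> T"
  shows "B \<le> a1 t / q1 t"
proof (rule tendsto_upperbound[OF \<theta>1_right_lim[OF \<open>0 < C1\<close>]])
  show "\<forall>\<^sub>F s in at_right h0. a1 s / q1 s \<le> a1 t / q1 t"
    unfolding eventually_at_right_field
    by (intro exI[of _ t] conjI allI impI t(1) \<theta>1_mono weak initial) (use t in auto)
qed simp

end

locale density_setting = level_setting M S A g h V h0 \<mu> \<beta> k
  for M S :: "'m::{t2_space,second_countable_topology} set"
    and A :: "('m, 'n::finite) chart set" and g :: "('m, 'n) metric"
    and h :: "'m \<Rightarrow> real" and V :: "real \<Rightarrow> real" and h0 :: real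
    and \<mu> \<beta> :: "'m measure" and k :: "'k::finite itself" +
  assumes levels_interval: "is_interval (levels M h h0)"
    and V_cont: "continuous_on (levels M h h0) V"
begin

text \<open>If \<open>h0\<close> is a critical value then \<open>V h0 = 0\<close>, hence \<open>C c = 0\<close>: the boundary terms drop out by
  themselves.\<close>

definition B :: real where "B = parallel_volume k A g h h0 S \<beta>"
definition C :: "real \<Rightarrow> real" where "C c = c / real CARD('k) * V h0 powr (real CARD('k) / 2)"
definition \<omega> :: real where "\<omega> = unit_sphere_volume CARD('k)"
definition \<nu> :: "real measure" where "\<nu> = distr \<mu> borel h"
text \<open>Set to 0 outside the levels, where nothing is known about \<open>V\<close>, so that it
  is a Borel function on the whole line.\<close>

definition W :: "real \<Rightarrow> real" where
  "W s = (if s \<in> levels M h h0 then V s powr (real CARD('k) / 2 - 1) else 0)"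

lemma \<omega>_pos: "0 < \<omega>"
  unfolding \<omega>_def unit_sphere_volume_def by (intro mult_pos_pos unit_ball_vol_pos) simp_all

lemma levels_Icc: "T \<in> levels M h h0 \<Longrightarrow> {h0..T} \<subseteq> levels M h h0"
proof
  fix s assume "T \<in> levels M h h0" "s \<in> {h0..T}"
  moreover have "h0 \<in> levels M h h0" by (simp add: levels_def)
  ultimately show "s \<in> levels M h h0"
    using mem_is_interval_1_I[OF levels_interval, of h0 T s] by simp
qed

lemma V_nonneg: "s \<in> h ` M \<Longrightarrow> 0 \<le> V s"
proof -
  assume "s \<in> h ` M"
  then obtain p where p: "p \<in> M" "h p = s" by blast
  then obtain c where c: "c \<in> A" "p \<in> fst c" using chart_cover by auto
  then show ?thesis
    using V_eq[rule_format, OF c(1) chart_mem_image[OF c(2)]] p by (simp add: chart_inv_chart[OF c])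
qed

lemma V_critical: "critical_value A h h0 \<Longrightarrow> V h0 = 0"
proof -
  assume "critical_value A h h0"
  then obtain c u where c: "c \<in> A" "u \<in> chart_image c" "h (chart_inv c u) = h0" "coord_differential h c u = 0"
    by (auto simp: critical_value_def)
  then show ?thesis
    using V_eq[rule_format, OF c(1,2)] by (simp add: gradient_def norm_wrt_def inner_wrt_def)
qed

lemma W_nonneg: "0 \<le> W s"
  by (simp add: W_def)

lemma W_meas: "W \<in> borel_measurable borel"
proof -
  have L: "levels M h h0 \<in> sets borel"
    using levels_interval by (rule real_interval_borel_measurable)
  have [measurable]: "(\<lambda>s. if s \<in> levels M h h0 then V s else 0) \<in> borel_measurable borel"
    using V_cont L by (intro borel_measurable_continuous_on_if) auto
  have "W = (\<lambda>s. indicator (levels M h h0) s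
      * (if s \<in> levels M h h0 then V s else 0) powr (real CARD('k) / 2 - 1))"
    by (auto simp: W_def indicator_def fun_eq_iff)
  also have "\<dots> \<in> borel_measurable borel" using L by measurable
  finally show ?thesis .
qed

lemma h_meas: "h \<in> borel_measurable \<mu>"
proof (rule measurableI)
  fix J :: "real set" assume "J \<in> sets borel"
  have "h -` J \<inter> space \<mu> = {p \<in> S \<inter> UNIV. h p \<in> J}" by (auto simp: space_\<mu>)
  then show "h -` J \<inter> space \<mu> \<in> sets \<mu>" using level_set_\<mu>[OF \<open>J \<in> sets borel\<close> open_UNIV] by simp
qed simp

lemma AE_above_h0: "AE p in \<mu>. h p \<noteq> h0"
proof (rule AE_I[of _ _ "initial_slice h h0 S"])
  have "initial_slice h h0 S = {p \<in> S \<inter> UNIV. h p \<in> {h0}}" by (auto simp: initial_slice_def)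
  then show "initial_slice h h0 S \<in> sets \<mu>" using level_set_\<mu>[of "{h0}" UNIV] by simp
qed (use \<mu>_slice in \<open>auto simp: space_\<mu> initial_slice_def\<close>)

text \<open>The initial slice is a null set, so closed level intervals may be replaced by intervals
  open at \<open>h0\<close>.\<close>

lemma AE_indicator_eq:
  "AE p in \<mu>. indicator {h0<..t} (h p) *\<^sub>R P (h p)
     = (indicator {p\<in>S. h0 \<le> h p \<and> h p \<le> t} p *\<^sub>R P (h p) :: real)"
  using AE_above_h0 AE_space 
proof eventually_elim
  case (elim p)
  then have "p \<in> S" "h0 < h p" using S_above by (force simp: space_\<mu>)+
  then show ?case by (simp add: indicator_def)
qed

lemma weighted_volume_eq:
  assumes "density_defined k M h V h0 S \<mu> (P, c)" "t \<in> levels M h h0" "h0 \<le> t"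
  shows "weighted_volume k A g h V h0 S \<mu> \<beta> (P, c) t = (LINT s:{h0<..t}|\<nu>. P s) + C c * B"
    and "set_integrable \<nu> {h0<..t} P"
proof -
  have [measurable]: "P \<in> borel_measurable borel" using assms by (simp add: density_defined_def)
  have int: "set_integrable \<mu> {p\<in>S. h0 \<le> h p \<and> h p \<le> t} (\<lambda>p. P (h p))"
    using assms by (simp add: density_defined_def)
  have meas: "(\<lambda>p. indicator {h0<..t} (h p) *\<^sub>R P (h p)) \<in> borel_measurable \<mu>"
    using h_meas by measurable
  have "integrable \<mu> (\<lambda>p. indicator {h0<..t} (h p) *\<^sub>R P (h p))"
    using int borel_measurable_integrable[OF int[unfolded set_integrable_def]]
    unfolding set_integrable_def
    by (subst integrable_cong_AE[OF meas _ AE_indicator_eq]) auto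
  then show "set_integrable \<nu> {h0<..t} P"
    unfolding set_integrable_def \<nu>_def by (subst integrable_distr_eq[OF h_meas]) auto
  have "(LINT s:{h0<..t}|\<nu>. P s) = (LINT p|\<mu>. indicator {h0<..t} (h p) *\<^sub>R P (h p))"
    unfolding set_lebesgue_integral_def \<nu>_def by (rule integral_distr[OF h_meas]) measurable
  also have "\<dots> = (LINT p:{p\<in>S. h0 \<le> h p \<and> h p \<le> t}|\<mu>. P (h p))"
    unfolding set_lebesgue_integral_def
    using borel_measurable_integrable[OF int[unfolded set_integrable_def]]
    by (intro integral_cong_AE meas AE_indicator_eq)
  finally have eq: "(LINT p:{p\<in>S. h0 \<le> h p \<and> h p \<le> t}|\<mu>. P (h p)) = (LINT s:{h0<..t}|\<nu>. P s)" by simp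
  have "(if critical_value A h h0 then 0
      else c / real CARD('k) * parallel_volume k A g h h0 S \<beta> * V h0 powr (real CARD('k) / 2)) = C c * B"
    using V_critical by (auto simp: C_def B_def)
  then show "weighted_volume k A g h V h0 S \<mu> \<beta> (P, c) t = (LINT s:{h0<..t}|\<nu>. P s) + C c * B"
    unfolding weighted_volume_def fst_conv snd_conv eq by (simp only:)
qed

lemma tube_volume_eq:
  assumes "density_defined k M h V h0 S \<mu> (P, c)" "t \<in> levels M h h0" "h0 \<le> t"
  shows "tube_volume k V h0 (P, c) t = \<omega> * ((LINT s:{h0<..t}|lborel. P s * W s) + C c)"
    and "set_integrable lborel {h0<..t} (\<lambda>s. P s * W s)"
proof -
  have [measurable]: "P \<in> borel_measurable borel" using assms by (simp add: density_defined_def)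
  note W_meas[measurable]
  have W: "W s = V s powr (real CARD('k) / 2 - 1)" if "s \<in> {h0..t}" for s
    using levels_Icc[OF assms(2)] that by (auto simp: W_def)
  have int: "set_integrable lborel {h0..t} (\<lambda>s. P s * V s powr (real CARD('k) / 2 - 1))"
    using assms by (simp add: density_defined_def)
  have "set_integrable lborel {h0..t} (\<lambda>s. P s * W s)"
    using int by (rule set_integrable_cong[THEN iffD1, rotated -1]) (auto simp: W)
  then show "set_integrable lborel {h0<..t} (\<lambda>s. P s * W s)"
    by (rule set_integrable_subset) auto
  have "(LINT s:{h0..t}|lborel. P s * V s powr (real CARD('k) / 2 - 1)) = (LINT s:{h0..t}|lborel. P s * W s)"
    by (rule set_lebesgue_integral_cong) (auto simp: W)
  also have "\<dots> = (LINT s:{h0<..t}|lborel. P s * W s)"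
    unfolding set_lebesgue_integral_def
  proof (rule integral_cong_AE)
    show "AE s in lborel. indicator {h0..t} s *\<^sub>R (P s * W s) = indicator {h0<..t} s *\<^sub>R (P s * W s)"
      using AE_lborel_singleton[of h0] by eventually_elim (auto simp: indicator_def)
  qed measurable
  finally show "tube_volume k V h0 (P, c) t = \<omega> * ((LINT s:{h0<..t}|lborel. P s * W s) + C c)"
    by (simp add: tube_volume_def C_def \<omega>_def)
qed

text \<open>A cosine is at most 1. In the non-integrable case the integral is 0 by convention and
  the bound is trivial.\<close>

lemma B_le_boundary: "ennreal B \<le> emeasure \<beta> boundary_slice"
proof (cases "integrable \<beta> (\<lambda>p. indicator (initial_slice h h0 S) p *\<^sub>R cos_gradient_angle k A g h S p)")
  case False
  then have "B = 0" unfolding B_def parallel_volume_def set_lebesgue_integral_def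
    by (rule not_integrable_integral_eq)
  then show ?thesis by simp
next
  case True
  let ?f = "\<lambda>p. indicator (initial_slice h h0 S) p *\<^sub>R cos_gradient_angle k A g h S p"
  have cos: "cos_gradient_angle k A g h S p \<le> 1" for p
    by (simp add: cos_gradient_angle_def Let_def)
  have "B \<le> (LINT p|\<beta>. max 0 (?f p))"
    unfolding B_def parallel_volume_def set_lebesgue_integral_def
    using True by (intro integral_mono) auto
  then have "ennreal B \<le> ennreal (LINT p|\<beta>. max 0 (?f p))" by (rule ennreal_leI)
  also have "\<dots> = (\<integral>\<^sup>+p. ennreal (max 0 (?f p)) \<partial>\<beta>)"
    using True by (intro nn_integral_eq_integral[symmetric]) auto
  also have "\<dots> \<le> (\<integral>\<^sup>+p. indicator boundary_slice p \<partial>\<beta>)"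
    using cos by (intro nn_integral_mono) (auto simp: indicator_def space_\<beta> intro!: ennreal_leI[of _ 1, simplified])
  also have "\<dots> = emeasure \<beta> boundary_slice"
  proof (rule nn_integral_indicator)
    have "boundary_slice = manifold_boundary k A S \<inter> (M \<inter> h -` {h0} )"
    proof -
      have "manifold_boundary k A S \<subseteq> S"
        unfolding manifold_boundary_def local_param_def by (auto dest: openin_imp_subset)
      then show ?thesis using S_subset_M by (auto simp: initial_slice_def)
    qed
    then show "boundary_slice \<in> sets \<beta>"
      using sets_\<beta>I[OF level_set_borel[of "{h0}"]] by simp
  qed
  finally show ?thesis .
qed

text \<open>The bound near the boundary carries the constant power of \<open>V h0\<close>, while
  \<open>W s\<close> varies with \<open>s\<close>. Continuity of \<open>V\<close> at
  \<open>h0\<close> absorbs the difference into the gap between \<open>b\<close> and an intermediate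
  \<open>b'\<close>.\<close>

lemma level_measure_lower_bound:
  assumes b: "0 \<le> b" "b < B" and "0 < C c"
  shows "\<exists>\<delta>>0. \<forall>J\<in>sets borel. J \<subseteq> {h0<..<h0+\<delta>} \<longrightarrow>
            ennreal b * (\<integral>\<^sup>+s\<in>J. ennreal (W s) \<partial>lborel) \<le> emeasure \<nu> J"
proof -
  define w where "w = V h0 powr (real CARD('k) / 2 - 1)"
  obtain b' where b': "b < b'" "b' < B" using b(2) dense by blast
  then have less: "ennreal b' < emeasure \<beta> boundary_slice"
    using b(1) less_le_trans[OF _ B_le_boundary, of "ennreal b'"] by (simp add: ennreal_less_iff)
  \<comment> \<open>Positive boundary volume shows that \<open>h0\<close> is attained, so
    \<open>V h0\<close> is a squared gradient length; \<open>0 < C c\<close> excludes the value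
    0.\<close>
  then have "boundary_slice \<noteq> {}" by auto
  then have "h0 \<in> h ` M" using S_subset_M by (auto simp: initial_slice_def)
  then have "0 \<le> V h0" by (rule V_nonneg)
  moreover have "V h0 \<noteq> 0" using assms(3) by (auto simp: C_def)
  ultimately have V0: "0 < V h0" by simp
  then have w: "0 < w" by (simp add: w_def)
  obtain \<delta>1 where \<delta>1: "0 < \<delta>1" "\<And>J. J \<in> sets borel \<Longrightarrow> J \<subseteq> {h0<..<h0+\<delta>1} \<Longrightarrow>
      ennreal (b' * w) * emeasure lborel J \<le> emeasure \<mu> {p \<in> S. h p \<in> J}"
    using level_lower_bound[OF V0 _ less] b(1) b'(1) unfolding w_def by auto
  have "((\<lambda>s. b * V s powr (real CARD('k) / 2 - 1)) \<longlongrightarrow> b * w) (at h0 within levels M h h0)"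
    unfolding w_def using V0 V_cont
    by (intro tendsto_intros) (auto simp: continuous_on_def levels_def)
  moreover have "b * w < b' * w" using b'(1) w by simp
  ultimately have "\<forall>\<^sub>F s in at h0 within levels M h h0. b * V s powr (real CARD('k) / 2 - 1) < b' * w"
    by (rule order_tendstoD(2))
  then obtain \<delta>2 where \<delta>2: "0 < \<delta>2" "\<And>s. s \<in> levels M h h0 \<Longrightarrow> s \<noteq> h0 \<Longrightarrow> dist s h0 < \<delta>2 \<Longrightarrow>
      b * V s powr (real CARD('k) / 2 - 1) < b' * w"
    by (auto simp: eventually_at)
  show ?thesis
  proof (intro exI[of _ "min \<delta>1 \<delta>2"] conjI ballI impI)
    fix J :: "real set" assume J: "J \<in> sets borel" "J \<subseteq> {h0<..<h0 + min \<delta>1 \<delta>2}"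
    have J1: "J \<subseteq> {h0<..<h0+\<delta>1}" by (rule order_trans[OF J(2)]) auto
    have "b * W s \<le> b' * w" if "s \<in> J" for s
    proof (cases "s \<in> levels M h h0")
      case True
      have "s \<in> {h0<..<h0 + min \<delta>1 \<delta>2}" using J(2) that by (rule subsetD)
      then have "s \<noteq> h0" "dist s h0 < \<delta>2" by (auto simp: dist_real_def)
      then show ?thesis using \<delta>2(2)[OF True] True by (simp add: W_def)
    qed (use b(1) b'(1) w in \<open>simp add: W_def\<close>)
    then have "ennreal b * ennreal (W s) * indicator J s \<le> ennreal (b' * w) * indicator J s" for s
      using b(1) W_nonneg[of s]
      by (cases "s \<in> J") (auto simp flip: ennreal_mult intro!: ennreal_leI)
    then have "(\<integral>\<^sup>+s. ennreal b * (ennreal (W s) * indicator J s) \<partial>lborel) \<le> (\<integral>\<^sup>+s. ennreal (b' * w) * indicator J s \<partial>lborel)"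
      by (intro nn_integral_mono) (simp add: mult.assoc)
    also have "\<dots> = ennreal (b' * w) * emeasure lborel J"
      using J by (intro nn_integral_cmult_indicator) simp
    also have "\<dots> \<le> emeasure \<mu> {p \<in> S. h p \<in> J}" by (rule \<delta>1(2)[OF J(1) J1])
    also have "\<dots> = emeasure \<nu> J"
      unfolding \<nu>_def emeasure_distr[OF h_meas J(1)]
      by (intro arg_cong[where f="emeasure \<mu>"]) (auto simp: space_\<mu>)
    finally show "ennreal b * (\<integral>\<^sup>+s\<in>J. ennreal (W s) \<partial>lborel) \<le> emeasure \<nu> J"
      using W_meas J(1) by (subst nn_integral_cmult[symmetric]) auto
  qed (use \<delta>1 \<delta>2 in simp)
qed

lemma weighted_density_eq:
  assumes "density_defined k M h V h0 S \<mu> (P, c)" "t \<in> levels M h h0" "h0 \<le> t"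
  shows "weighted_density k A g h V h0 S \<mu> \<beta> (P, c) t
    = ((LINT s:{h0<..t}|\<nu>. P s) + C c * B) / ((LINT s:{h0<..t}|lborel. P s * W s) + C c) / \<omega>"
  unfolding weighted_density_def weighted_volume_eq(1)[OF assms] tube_volume_eq(1)[OF assms]
  by (simp add: mult.commute)

text \<open>At \<open>h0\<close> both integrals are over the empty interval; the constants cancel
  and the value does not depend on the weight.\<close>

lemma weighted_density_initial:
  assumes dd: "density_defined k M h V h0 S \<mu> (P, c)" and "h0 \<in> density_domain k M h V h0 (P, c)"
  shows "C c \<noteq> 0" "weighted_density k A g h V h0 S \<mu> \<beta> (P, c) h0 = B / \<omega>"
proof -
  have h0: "h0 \<in> levels M h h0" by (simp add: levels_def)
  show "C c \<noteq> 0"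
    using assms(2) \<omega>_pos tube_volume_eq(1)[OF dd h0 order_refl]
    by (auto simp: density_domain_def set_lebesgue_integral_def)
  then show "weighted_density k A g h V h0 S \<mu> \<beta> (P, c) h0 = B / \<omega>"
    using weighted_density_eq[OF dd h0 order_refl] by (simp add: set_lebesgue_integral_def)
qed

lemma mem_density_domain:
  assumes "density_defined k M h V h0 S \<mu> w" "T \<in> levels M h h0" "h0 < t" "t \<le> T"
  shows "t \<in> levels M h h0" "t \<in> density_domain k M h V h0 w" "0 < tube_volume k V h0 w t"
proof -
  show "t \<in> levels M h h0" using levels_Icc[OF assms(2)] assms(3,4) by auto
  then show "0 < tube_volume k V h0 w t" "t \<in> density_domain k M h V h0 w"
    using assms(1,3) by (auto simp: density_defined_def density_domain_def)
qed

section \<open>Transfer to the densities of the submanifold\<close>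

context
  fixes P1 P2 :: "real \<Rightarrow> real" and c1 c2 :: real
  assumes pos1: "positive_weight (P1, c1)" and pos2: "positive_weight (P2, c2)"
    and dd1: "density_defined k M h V h0 S \<mu> (P1, c1)"
    and dd2: "density_defined k M h V h0 S \<mu> (P2, c2)"
    and mono2: "mono_on (density_domain k M h V h0 (P2, c2)) (weighted_density k A g h V h0 S \<mu> \<beta> (P2, c2))"
begin

abbreviation "\<Theta>1 \<equiv> weighted_density k A g h V h0 S \<mu> \<beta> (P1, c1)"
abbreviation "\<Theta>2 \<equiv> weighted_density k A g h V h0 S \<mu> \<beta> (P2, c2)"
abbreviation "D1 \<equiv> density_domain k M h V h0 (P1, c1)"
abbreviation "D2 \<equiv> density_domain k M h V h0 (P2, c2)"

lemma weight_pair_at: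
  assumes T: "T \<in> levels M h h0" "h0 < T"
  shows "weight_pair \<nu> W P1 P2 h0 T"
proof
  show "sets \<nu> = sets borel" by (simp add: \<nu>_def)
  show "P1 \<in> borel_measurable borel" "P2 \<in> borel_measurable borel"
    using dd1 dd2 by (simp_all add: density_defined_def)
  show "0 \<le> P1 s" "0 \<le> P2 s" for s using pos1 pos2 by (simp_all add: positive_weight_def)
  show "set_integrable \<nu> {h0<..T} P1" "set_integrable \<nu> {h0<..T} P2"
    using weighted_volume_eq(2)[OF dd1 T(1)] weighted_volume_eq(2)[OF dd2 T(1)] T(2) by simp_all
  show "set_integrable lborel {h0<..T} (\<lambda>s. P1 s * W s)" "set_integrable lborel {h0<..T} (\<lambda>s. P2 s * W s)"
    using tube_volume_eq(2)[OF dd1 T(1)] tube_volume_eq(2)[OF dd2 T(1)] T(2) by simp_all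
qed (fact W_meas W_nonneg T(2))+

lemma
  assumes T: "T \<in> levels M h h0" "h0 < T" and t: "h0 < t" "t \<le> T"
  shows \<Theta>1_eq: "\<Theta>1 t = weight_pair.a1 \<nu> P1 (C c1) B h0 t / weight_pair.q1 W P1 (C c1) h0 t / \<omega>"
    and \<Theta>2_eq: "\<Theta>2 t = weight_pair.\<theta>2 \<nu> W P2 (C c2) B h0 t / \<omega>"
    and tube1_eq: "tube_volume k V h0 (P1, c1) t = \<omega> * weight_pair.q1 W P1 (C c1) h0 t"
    and tube2_eq: "tube_volume k V h0 (P2, c2) t = \<omega> * weight_pair.q2 W P2 (C c2) h0 t"
proof -
  interpret weight_pair \<nu> W P1 P2 "C c1" "C c2" B h0 T by (rule weight_pair_at[OF T])
  have tL: "t \<in> levels M h h0" using mem_density_domain(1)[OF dd1 T(1) t] .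
  have "h0 \<le> t" using t by simp
  note eqs = weighted_density_eq[OF dd1 tL this] weighted_density_eq[OF dd2 tL this]
    tube_volume_eq(1)[OF dd1 tL this] tube_volume_eq(1)[OF dd2 tL this]
  show "\<Theta>1 t = a1 t / q1 t / \<omega>" unfolding a1_def q1_def by (rule eqs)
  show "\<Theta>2 t = \<theta>2 t / \<omega>" unfolding \<theta>2_def a2_def q2_def by (rule eqs)
  show "tube_volume k V h0 (P1, c1) t = \<omega> * q1 t" unfolding q1_def by (rule eqs)
  show "tube_volume k V h0 (P2, c2) t = \<omega> * q2 t" unfolding q2_def by (rule eqs)
qed

lemma weight_pair_pos_at:
  assumes T: "T \<in> levels M h h0" "h0 < T"
  shows "weight_pair_pos \<nu> W P1 P2 (C c1) (C c2) B h0 T"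
proof -
  interpret weight_pair \<nu> W P1 P2 "C c1" "C c2" B h0 T by (rule weight_pair_at[OF T])
  show ?thesis
  proof
    show "0 < q1 t" if "h0 < t" "t \<le> T" for t
      using mem_density_domain(3)[OF dd1 T(1) that] \<omega>_pos
      unfolding tube1_eq[OF T that] by (simp add: zero_less_mult_iff)
    show "0 < q2 t" if "h0 < t" "t \<le> T" for t
      using mem_density_domain(3)[OF dd2 T(1) that] \<omega>_pos
      unfolding tube2_eq[OF T that] by (simp add: zero_less_mult_iff)
    show "\<theta>2 s \<le> \<theta>2 t" if "h0 < s" "s \<le> t" "t \<le> T" for s t
    proof -
      have s: "h0 < s" "s \<le> T" and t: "h0 < t" "t \<le> T" using that by auto
      have "\<Theta>2 s \<le> \<Theta>2 t"
        using mono_onD[OF mono2 mem_density_domain(2)[OF dd2 T(1) s] mem_density_domain(2)[OF dd2 T(1) t] that(2)] .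
      then show ?thesis
        unfolding \<Theta>2_eq[OF T s] \<Theta>2_eq[OF T t] using \<omega>_pos by (simp add: divide_le_cancel)
    qed
  qed
qed

text \<open>The point where the geometry of \<open>S\<close> near its boundary enters: it supplies
  the assumption \<open>initial\<close> of the comparison on the line.\<close>

lemma initial_\<theta>2:
  assumes T: "T \<in> levels M h h0" "h0 < T" and C: "0 < C c1" "C c2 = 0" and t: "h0 < t" "t \<le> T"
  shows "B \<le> weight_pair.\<theta>2 \<nu> W P2 (C c2) B h0 t"
proof -
  interpret weight_pair_pos \<nu> W P1 P2 "C c1" "C c2" B h0 T by (rule weight_pair_pos_at[OF T])
  show ?thesis by (rule initial_density_le[OF level_measure_lower_bound[OF _ _ C(1)] C(2) t])
qed

lemma
  assumes T: "T \<in> levels M h h0" "h0 < T" and t: "h0 < t" "t \<le> T"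
  shows weaker_at12: "weaker k M h V h0 (P1, c1) (P2, c2) \<Longrightarrow>
      P1 t / weight_pair.q1 W P1 (C c1) h0 t \<le> P2 t / weight_pair.q2 W P2 (C c2) h0 t"
    and weaker_at21: "weaker k M h V h0 (P2, c2) (P1, c1) \<Longrightarrow>
      P2 t / weight_pair.q2 W P2 (C c2) h0 t \<le> P1 t / weight_pair.q1 W P1 (C c1) h0 t"
proof -
  interpret weight_pair \<nu> W P1 P2 "C c1" "C c2" B h0 T by (rule weight_pair_at[OF T])
  have D: "t \<in> D1" "t \<in> D2"
    using mem_density_domain(2)[OF dd1 T(1) t] mem_density_domain(2)[OF dd2 T(1) t] .
  have cancel: "x / (\<omega> * y) \<le> x' / (\<omega> * y') \<longleftrightarrow> x / y \<le> x' / y'" for x y x' y' :: real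
    using \<omega>_pos divide_le_cancel[of "x / y" \<omega> "x' / y'"] by (simp add: mult.commute)
  show "P1 t / q1 t \<le> P2 t / q2 t" if "weaker k M h V h0 (P1, c1) (P2, c2)"
  proof -
    have "P1 t / tube_volume k V h0 (P1, c1) t \<le> P2 t / tube_volume k V h0 (P2, c2) t"
      using that D by (simp add: weaker_def)
    then show ?thesis unfolding tube1_eq[OF T t] tube2_eq[OF T t] cancel .
  qed
  show "P2 t / q2 t \<le> P1 t / q1 t" if "weaker k M h V h0 (P2, c2) (P1, c1)"
  proof -
    have "P2 t / tube_volume k V h0 (P2, c2) t \<le> P1 t / tube_volume k V h0 (P1, c1) t"
      using that D by (simp add: weaker_def)
    then show ?thesis unfolding tube1_eq[OF T t] tube2_eq[OF T t] cancel .
  qed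
qed

lemma density_domain_cases:
  assumes "t \<in> density_domain k M h V h0 w"
  obtains "t = h0" | "h0 < t" "t \<in> levels M h h0"
  using assms by (force simp: density_domain_def)

lemma \<Theta>1_le_\<Theta>2:
  assumes weak: "weaker k M h V h0 (P1, c1) (P2, c2)" and t: "t \<in> D1" "t \<in> D2"
  shows "\<Theta>1 t \<le> \<Theta>2 t"
  using t(1)
proof (cases rule: density_domain_cases)
  case 1
  then show ?thesis using t weighted_density_initial(2)[OF dd1] weighted_density_initial(2)[OF dd2] by simp
next
  case T: 2
  \<comment> \<open>The level \<open>t\<close> itself serves as the right end \<open>T\<close>; only
    levels up to \<open>t\<close> matter.\<close>
  interpret weight_pair_pos \<nu> W P1 P2 "C c1" "C c2" B h0 t by (rule weight_pair_pos_at[OF T(2,1)])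
  have "a1 t \<le> \<theta>2 t * q1 t"
    by (rule a1_le_\<theta>2_q1[OF weaker_at12[OF T(2,1) _ _ weak] initial_\<theta>2[OF T(2,1)] T(1) order_refl])
  then have "a1 t / q1 t \<le> \<theta>2 t"
    using q1_pos[OF T(1) order_refl] by (simp add: pos_divide_le_eq)
  then show ?thesis
    unfolding \<Theta>1_eq[OF T(2,1) T(1) order_refl] \<Theta>2_eq[OF T(2,1) T(1) order_refl]
    by (rule divide_right_mono[OF _ less_imp_le[OF \<omega>_pos]])
qed

lemma \<Theta>1_mono:
  assumes weak: "weaker k M h V h0 (P1, c1) (P2, c2)"
  shows "mono_on D1 \<Theta>1"
proof (rule mono_onI)
  fix s t assume s: "s \<in> D1" and t: "t \<in> D1" and st: "s \<le> t"
  show "\<Theta>1 s \<le> \<Theta>1 t"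
    using t
  proof (cases rule: density_domain_cases)
    case 1
    then have "s = t" using s st by (auto simp: density_domain_def)
    then show ?thesis by simp
  next
    case T: 2
    interpret weight_pair_pos \<nu> W P1 P2 "C c1" "C c2" B h0 t by (rule weight_pair_pos_at[OF T(2,1)])
    show ?thesis
      using s
    proof (cases rule: density_domain_cases)
      case 1
      then have "C c1 \<noteq> 0" "\<Theta>1 s = B / \<omega>" using s weighted_density_initial[OF dd1] by simp_all
      moreover have "B \<le> a1 t / q1 t"
        using \<open>C c1 \<noteq> 0\<close> C_nonneg(1)
        by (intro B_le_\<theta>1[OF weaker_at12[OF T(2,1) _ _ weak] initial_\<theta>2[OF T(2,1)] _ T(1) order_refl]) auto
      ultimately show ?thesis
        unfolding \<Theta>1_eq[OF T(2,1) T(1) order_refl] using \<omega>_pos by (simp only: divide_right_mono[OF _ less_imp_le])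
    next
      case s: 2
      have "a1 s / q1 s \<le> a1 t / q1 t"
        by (rule \<theta>1_mono[OF weaker_at12[OF T(2,1) _ _ weak] initial_\<theta>2[OF T(2,1)] s(1) st order_refl])
      then show ?thesis
        unfolding \<Theta>1_eq[OF T(2,1) T(1) order_refl] \<Theta>1_eq[OF T(2,1) s(1) st]
        by (rule divide_right_mono[OF _ less_imp_le[OF \<omega>_pos]])
    qed
  qed
qed

lemma \<Theta>2_le_\<Theta>1:
  assumes weak: "weaker k M h V h0 (P2, c2) (P1, c1)"
    and zero: "\<forall>t\<in>D1 \<inter> D2. h0 < t \<and> P2 t = 0 \<longrightarrow> P1 t = 0"
    and t: "t \<in> D1" "t \<in> D2"
  shows "\<Theta>2 t \<le> \<Theta>1 t"
  using t(1)
proof (cases rule: density_domain_cases)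
  case 1
  then show ?thesis using t weighted_density_initial(2)[OF dd1] weighted_density_initial(2)[OF dd2] by simp
next
  case T: 2
  interpret weight_pair_pos \<nu> W P1 P2 "C c1" "C c2" B h0 t by (rule weight_pair_pos_at[OF T(2,1)])
  have vanish: "P1 s = 0" if "h0 < s" "s \<le> t" "P2 s = 0" for s
    using zero that mem_density_domain(2)[OF dd1 T(2) that(1,2)] mem_density_domain(2)[OF dd2 T(2) that(1,2)]
    by blast
  have "\<theta>2 t * q1 t \<le> a1 t"
    by (rule \<theta>2_q1_le_a1[OF weaker_at21[OF T(2,1) _ _ weak] vanish T(1) order_refl])
  then have "\<theta>2 t \<le> a1 t / q1 t"
    using q1_pos[OF T(1) order_refl] by (simp add: pos_le_divide_eq)
  then show ?thesis
    unfolding \<Theta>1_eq[OF T(2,1) T(1) order_refl] \<Theta>2_eq[OF T(2,1) T(1) order_refl]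
    by (rule divide_right_mono[OF _ less_imp_le[OF \<omega>_pos]])
qed

end

end

theorem lemma3p11:
  fixes M S :: "'m::{t2_space,second_countable_topology} set"
    and A :: "('m, 'n::finite) chart set"
    and g :: "('m, 'n) metric"
    and h :: "'m \<Rightarrow> real"
    and U V P1 P2 :: "real \<Rightarrow> real"
    and h0 c1 c2 :: real
    and \<mu> \<beta> :: "'m measure"
  defines "k \<equiv> TYPE('k::finite)"
  defines "\<Theta>1 \<equiv> weighted_density k A g h V h0 S \<mu> \<beta> (P1, c1)"
    and "\<Theta>2 \<equiv> weighted_density k A g h V h0 S \<mu> \<beta> (P2, c2)"
    and "D1 \<equiv> density_domain k M h V h0 (P1, c1)"
    and "D2 \<equiv> density_domain k M h V h0 (P2, c2)"
  assumes "riemannian_manifold M A g"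
    and "C2_function A h"
    and "\<forall>c\<in>A. \<forall>u\<in>chart_image c. hessian g h c u = U (h (chart_inv c u)) *\<^sub>R g c u"
    and "\<forall>c\<in>A. \<forall>u\<in>chart_image c. V (h (chart_inv c u)) = (norm_wrt (g c u) (gradient g h c u))\<^sup>2"
    and "is_interval (levels M h h0)"
    and "\<forall>s\<in>levels M h h0. (V has_real_derivative 2 * U s) (at s within levels M h h0)"
    and "submanifold k M A S"
    and "\<forall>p\<in>S. h0 \<le> h p"
    and "volume_measure k A g S \<mu>"
    and "boundary_volume_measure k A (rescaled_metric h V g) S \<beta>"
    and "emeasure \<mu> (initial_slice h h0 S) = 0"
    and "\<not> critical_value A h h0 \<longrightarrow>
           set_integrable \<beta> (initial_slice h h0 S) (cos_gradient_angle k A g h S)"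
    and "positive_weight (P1, c1)" and "positive_weight (P2, c2)"
    and "density_defined k M h V h0 S \<mu> (P1, c1)"
    and "density_defined k M h V h0 S \<mu> (P2, c2)"
  shows "(weaker k M h V h0 (P1, c1) (P2, c2) \<and> mono_on D2 \<Theta>2
            \<longrightarrow> mono_on D1 \<Theta>1 \<and> (\<forall>t\<in>D1 \<inter> D2. \<Theta>1 t \<le> \<Theta>2 t))
       \<and> (weaker k M h V h0 (P2, c2) (P1, c1) \<and> mono_on D2 \<Theta>2
            \<and> (\<forall>t\<in>D1 \<inter> D2. h0 < t \<and> P2 t = 0 \<longrightarrow> P1 t = 0)
            \<longrightarrow> (\<forall>t\<in>D1 \<inter> D2. \<Theta>2 t \<le> \<Theta>1 t))"
proof -
  have V_cont: "continuous_on (levels M h h0) V"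
    using assms(11) by (meson DERIV_continuous continuous_on_eq_continuous_within)
  interpret density_setting M S A g h V h0 \<mu> \<beta> k
    by unfold_locales (fact assms V_cont)+
  note pair = assms(18-21)
  show ?thesis
    unfolding \<Theta>1_def \<Theta>2_def D1_def D2_def
  proof (intro conjI impI ballI; elim conjE)
    assume "weaker k M h V h0 (P1, c1) (P2, c2)"
      and mono: "mono_on (density_domain k M h V h0 (P2, c2)) (weighted_density k A g h V h0 S \<mu> \<beta> (P2, c2))"
    then show "mono_on (density_domain k M h V h0 (P1, c1)) (weighted_density k A g h V h0 S \<mu> \<beta> (P1, c1))"
      by (intro \<Theta>1_mono[OF pair mono])
  next
    fix t
    assume weak: "weaker k M h V h0 (P1, c1) (P2, c2)"
      and mono: "mono_on (density_domain k M h V h0 (P2, c2)) (weighted_density k A g h V h0 S \<mu> \<beta> (P2, c2))"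
      and "t \<in> density_domain k M h V h0 (P1, c1) \<inter> density_domain k M h V h0 (P2, c2)"
    then show "weighted_density k A g h V h0 S \<mu> \<beta> (P1, c1) t \<le> weighted_density k A g h V h0 S \<mu> \<beta> (P2, c2) t"
      by (intro \<Theta>1_le_\<Theta>2[OF pair mono weak]) simp_all
  next
    fix t
    assume weak: "weaker k M h V h0 (P2, c2) (P1, c1)"
      and mono: "mono_on (density_domain k M h V h0 (P2, c2)) (weighted_density k A g h V h0 S \<mu> \<beta> (P2, c2))"
      and zero: "\<forall>t\<in>density_domain k M h V h0 (P1, c1) \<inter> density_domain k M h V h0 (P2, c2).
        h0 < t \<and> P2 t = 0 \<longrightarrow> P1 t = 0"
      and "t \<in> density_domain k M h V h0 (P1, c1) \<inter> density_domain k M h V h0 (P2, c2)"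
    then show "weighted_density k A g h V h0 S \<mu> \<beta> (P2, c2) t \<le> weighted_density k A g h V h0 S \<mu> \<beta> (P1, c1) t"
      by (intro \<Theta>2_le_\<Theta>1[OF pair mono weak zero]) simp_all
  qed
qed

end
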